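(* Let $k$ be a field and let $m,n\in\mathbb N$. Let $R=k[x_1,\dots,x_{m+n}]$ and $S=k[X_1,\dots,X_{m+n}]$ be polynomial rings, with $R$ acting on $S$ by the contraction action $\circ$. Let \[F=X_1^{a_1}\cdots X_{m+n}^{a_{m+n}}\left(c_1X_1^{b_1}\cdots X_m^{b_m}-c_2X_{m+1}^{b_{m+1}}\cdots X_{m+n}^{b_{m+n}}\right)\in S\] be a binomial, where $a_1,\dots,a_{m+n},b_1,\dots,b_{m+n}\in\mathbb Z_{\ge 0}$ and $c_1,c_2\in k\setminus\{0\}$. Let \[d_1=\#\{i\mid b_i\neq 0,\ i=1,\dots,m\},\qquad d_2=\#\{i\mid b_i\neq 0,\ i=m+1,\dots,m+n\}.\] Suppose that $d_1\ge d_2\ge 1$ and \[b_{d_1+1}=b_{d_1+2}=\cdots=b_m=0,\qquad b_{m+d_2+1}=b_{m+d_2+2}=\cdots=b_{m+n}=0.\] Let \[v=\min\{i\in\mathbb N\mid (x_1^{b_1}\cdots x_m^{b_m})^i\circ(X_1^{a_1}\cdots X_m^{a_m})=0\}.\] Then the following hold. (1) $R/\operatorname{Ann}_R(F)$ is a complete intersection if and only if one of the following conditions holds: (a) $d_1=d_2=1$; (b) $d_1\ge 2$, $d_2=1$ and $a_{m+1}+1\ge v\,b_{m+1}$. (2) Suppose that $d_1=d_2=1$. Let $w=\min\{i\in\mathbb N\mid a_{m+1}+1\le i\,b_{m+1}\}$ and \[I=(x_2^{a_2+1},\dots,x_m^{a_m+1},x_{m+2}^{a_{m+2}+1},\dots,x_{m+n}^{a_{m+n}+1})\subset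 R.\] (a) If $v<w$, then \[\operatorname{Ann}_R(F)=\Big(x_1^{a_1+b_1+1},\ \sum_{i=0}^{v}c_1^{v-i}c_2^i x_1^{ib_1}x_{m+1}^{a_{m+1}+1-ib_{m+1}}\Big)+I.\] (b) If $v>w$, then \[\operatorname{Ann}_R(F)=\Big(x_{m+1}^{a_{m+1}+b_{m+1}+1},\ \sum_{i=0}^{w}c_1^{i}c_2^{w-i}x_1^{a_1+1-ib_1}x_{m+1}^{ib_{m+1}}\Big)+I.\] (c) If $v=w$, then $\operatorname{Ann}_R(F)=(p,q)+I$, where \[p=\sum_{i=0}^{v}c_1^{v-i}c_2^i x_1^{ib_1}x_{m+1}^{(v-i)b_{m+1}},\qquad q=\sum_{i=0}^{v-1}c_1^{v-1-i}c_2^i x_1^{a_1+1-(v-1-i)b_1}x_{m+1}^{a_{m+1}+1-ib_{m+1}}.\] (3) Suppose that $d_2=1$ and $a_{m+1}+1\ge v\,b_{m+1}$. Then \[\operatorname{Ann}_R(F)=(x_1^{a_1+b_1+1},\dots,x_m^{a_m+b_m+1},\,p,\,x_{m+2}^{a_{m+2}+1},\dots,x_{m+n}^{a_{m+n}+1}),\] where \[p=\sum_{i=0}^{v}c_1^{v-i}c_2^i(x_1^{b_1}\cdots x_m^{b_m})^i x_{m+1}^{a_{m+1}+1-ib_{m+1}}.\]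
   Context: $\mathbb N$ denotes the positive integers. For polynomial rings $R=k[x_1,\dots,x_N]$ and $S=k[X_1,\dots,X_N]$ over a field $k$, the contraction action $\circ$ of $R$ on $S$ is the $k$-bilinear action determined by \[x_1^{\alpha_1}\cdots x_N^{\alpha_N}\circ X_1^{\beta_1}\cdots X_N^{\beta_N}=\begin{cases}X_1^{\beta_1-\alpha_1}\cdots X_N^{\beta_N-\alpha_N}&\text{if }\beta_i\ge \alpha_i\text{ for all }i,\\0&\text{otherwise,}\end{cases}\] for $\alpha_i,\beta_i\in\mathbb Z_{\ge 0}$; it makes $S$ an $R$-module. For $F\in S\setminus\{0\}$, $\operatorname{Ann}_R(F)=\{f\in R\mid f\circ F=0\}$. It is an $(x_1,\dots,x_N)$-primary ideal of $R$, and $R/\operatorname{Ann}_R(F)$ is an Artinian Gorenstein local ring. *)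

theory Defs
  imports "HOL-Library.Poly_Mapping" "HOL-Algebra.Ideal"
begin

text \<open>Polynomials in indeterminates indexed by naturals: an exponent vector is a finitely supported
  function \<open>nat \<Rightarrow>\<^sub>0 nat\<close>, a polynomial a finitely supported family of coefficients.  Their ring
  operations are those of \<^theory>\<open>HOL-Library.Poly_Mapping\<close>.\<close>

type_synonym 'k mpoly = "(nat \<Rightarrow>\<^sub>0 nat) \<Rightarrow>\<^sub>0 'k"

definition const :: "'k::field \<Rightarrow> 'k mpoly" where
  "const c = Poly_Mapping.single 0 c"

definition var :: "nat \<Rightarrow> 'k::field mpoly" where
  "var i = Poly_Mapping.single (Poly_Mapping.single i 1) 1"

text \<open>\<open>k[x\<^sub>1,\<dots>,x\<^sub>N]\<close>: only the indeterminates with indices \<open>1,\<dots>,N\<close> may occur.  The same set of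
  polynomials also serves as \<open>S = k[X\<^sub>1,\<dots>,X\<^sub>N]\<close>, with \<open>var i\<close> read as \<open>X\<^sub>i\<close>.\<close>

definition polynomial_ring :: "nat \<Rightarrow> 'k::field mpoly ring" where
  "polynomial_ring N =
     \<lparr>carrier = {f. \<forall>\<alpha>\<in>Poly_Mapping.keys f. Poly_Mapping.keys \<alpha> \<subseteq> {1..N}},
      mult = (*), one = 1, zero = 0, add = (+)\<rparr>"

text \<open>Bilinear extension of the contraction of monomials.  Divisibility of monomials is spelled out
  componentwise because \<open>\<le>\<close> on \<open>nat \<Rightarrow>\<^sub>0 nat\<close> is a lexicographic order.\<close>

definition contract :: "'k::field mpoly \<Rightarrow> 'k mpoly \<Rightarrow> 'k mpoly" where
  "contract f F =
     (\<Sum>\<alpha>\<in>Poly_Mapping.keys f. \<Sum>\<beta>\<in>Poly_Mapping.keys F.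
        if \<forall>i. Poly_Mapping.lookup \<alpha> i \<le> Poly_Mapping.lookup \<beta> i
        then Poly_Mapping.single (\<beta> - \<alpha>) (Poly_Mapping.lookup f \<alpha> * Poly_Mapping.lookup F \<beta>)
        else 0)"

definition Ann :: "'k::field mpoly ring \<Rightarrow> 'k mpoly \<Rightarrow> 'k mpoly set" where
  "Ann R F = {f \<in> carrier R. contract f F = 0}"

text \<open>A sequence in a commutative ring is regular if it generates a proper ideal and every entry is a
  nonzerodivisor modulo the ideal generated by the preceding ones.\<close>

definition regular_sequence :: "('a, 'b) ring_scheme \<Rightarrow> 'a list \<Rightarrow> bool" where
  "regular_sequence R fs \<longleftrightarrow>
     set fs \<subseteq> carrier R \<and> Idl\<^bsub>R\<^esub> (set fs) \<noteq> carrier R \<and>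
     (\<forall>i<length fs. \<forall>g\<in>carrier R.
        fs ! i \<otimes>\<^bsub>R\<^esub> g \<in> Idl\<^bsub>R\<^esub> (set (take i fs)) \<longrightarrow> g \<in> Idl\<^bsub>R\<^esub> (set (take i fs)))"

text \<open>\<open>R/I\<close> is a complete intersection, for a quotient of a polynomial ring \<open>R\<close>: the ideal \<open>I\<close> is
  generated by an \<open>R\<close>-regular sequence.\<close>

definition quotient_complete_intersection :: "('a, 'b) ring_scheme \<Rightarrow> 'a set \<Rightarrow> bool" where
  "quotient_complete_intersection R I \<longleftrightarrow>
     (\<exists>fs. regular_sequence R fs \<and> I = Idl\<^bsub>R\<^esub> (set fs))"

lemma keys_add_exponent:
  fixes \<alpha> \<beta> :: "nat \<Rightarrow>\<^sub>0 nat"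
  shows "Poly_Mapping.keys (\<alpha> + \<beta>) = Poly_Mapping.keys \<alpha> \<union> Poly_Mapping.keys \<beta>"
  by (auto simp: in_keys_iff lookup_add)

lemma cring_polynomial_ring: "cring (polynomial_ring N :: 'k::field mpoly ring)"
proof -
  define C where "C = {f :: 'k mpoly. \<forall>\<alpha>\<in>Poly_Mapping.keys f. Poly_Mapping.keys \<alpha> \<subseteq> {1..N}}"
  have add: "f + g \<in> C" if "f \<in> C" "g \<in> C" for f g
    using that Poly_Mapping.keys_add[of f g] unfolding C_def by blast
  have mult: "f * g \<in> C" if fg: "f \<in> C" "g \<in> C" for f g
    unfolding C_def
  proof (intro CollectI ballI)
    fix \<alpha> assume "\<alpha> \<in> Poly_Mapping.keys (f * g)"
    with keys_mult[of f g] obtain \<beta> \<gamma> where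
      "\<alpha> = \<beta> + \<gamma>" "\<beta> \<in> Poly_Mapping.keys f" "\<gamma> \<in> Poly_Mapping.keys g"
      by blast
    with fg show "Poly_Mapping.keys \<alpha> \<subseteq> {1..N}"
      using keys_add_exponent[of \<beta> \<gamma>] unfolding C_def by blast
  qed
  have neg: "\<exists>g\<in>C. f + g = 0" if "f \<in> C" for f
    using that by (intro bexI[of _ "- f"]) (auto simp: C_def in_keys_iff)
  have zero: "0 \<in> C" and one: "1 \<in> C"
    by (auto simp: C_def)
  have "cring \<lparr>carrier = C, mult = (*), one = 1, zero = 0, add = (+)\<rparr>"
    by (rule cringI)
      (auto intro!: abelian_groupI comm_monoidI add mult zero one neg
        simp: algebra_simps)
  then show ?thesis
    unfolding polynomial_ring_def C_def .
qed

lemma contract_monomial: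
  "contract (Poly_Mapping.single \<alpha> 1) (Poly_Mapping.single \<beta> (1::'k::field)) =
     (if \<forall>i. Poly_Mapping.lookup \<alpha> i \<le> Poly_Mapping.lookup \<beta> i
      then Poly_Mapping.single (\<beta> - \<alpha>) 1 else 0)"
  unfolding contract_def by (simp del: not_all)

end

theory Submission
  imports Defs "HOL.Vector_Spaces"
begin

text \<open>Write \<open>\<alpha>\<close> for the exponent vector \<open>a\<close>, and \<open>U\<close>, \<open>W\<close> for the parts of \<open>b\<close> in the first and in the
  second block of variables, so that \<open>F = c X\<^bsup>\<alpha>+U\<^esup> - d X\<^bsup>\<alpha>+W\<^esup>\<close> with \<open>c = c\<^sub>1\<close> and \<open>d = c\<^sub>2\<close>.  Comparing the
  coefficients of \<open>X\<^bsup>\<alpha>+U-z\<^esup>\<close> shows that \<open>f\<close> annihilates \<open>F\<close> if and only if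
  \<open>c f\<^sub>z = d f\<^bsub>z-U+W\<^esub>\<close> for all integer vectors \<open>z \<le> \<alpha> + U\<close>, where \<open>f\<^sub>z = 0\<close> if \<open>z\<close> has a
  negative entry (\<open>Ann_eq_A\<close>).  So the annihilator consists of the solutions of a two-term recurrence
  along the lines of direction \<open>U - W\<close>, and all arguments below follow such lines until they
  reach a negative entry.

  Elements of the annihilator are found by putting coefficients \<open>c\<^bsup>s-i\<^esup> d\<^sup>i\<close> on a segment
  \<open>z + i (U - W)\<close>, \<open>0 \<le> i \<le> s\<close>; this solves the recurrence if neither the first point nor the one
  after the last is \<open>\<le> \<alpha> + U\<close> (\<open>chain_poly_in_A\<close>).  All generators in the
  theorem are of this kind, the powers of variables being the segments of one point.  That they generate
  is shown by division with respect to the degree in \<open>x\<^bsub>m+1\<^esub>\<close>: a remainder that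
  satisfies the recurrence and avoids the leading monomials is zero (\<open>eq_A_I\<close>).  They form a regular sequence
  because powers of distinct variables do, a polynomial that is monic in a further variable can be
  appended, and, if \<open>v = w\<close>, the last generator \<open>q\<close> is related to a power of \<open>x\<^sub>1\<close> modulo the one
  before it (\<open>generators_long_second\<close>, \<open>generators_equal\<close>).

  In the remaining cases the annihilator \<open>A\<close> has too many minimal generators.  Call \<open>z\<close> a
  corner if the coefficient of every element of \<open>A\<close> at \<open>z - e\<^sub>l\<close> is zero for all \<open>l\<close>; then the coefficient at
  \<open>z\<close> is a functional on \<open>A/(x\<^sub>1,\<dots>,x\<^sub>N) A\<close>, and a set of corners that is dual to a family in
  \<open>A\<close> bounds the number of generators from below (\<open>number_of_generators_ge\<close>).  The
  powers of the variables provide \<open>N\<close> corners, or \<open>N - 1\<close> if a block has a single variable with nonzero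
  exponent, and one or two suitable segments complete these to \<open>N + 1\<close>.
  A regular sequence in \<open>N\<close> variables has at most \<open>N\<close> entries, by a dimension count
  (\<open>regular_sequence_length_le\<close>).\<close>

section \<open>Polynomial rings and their ideals\<close>

abbreviation "lookup \<equiv> Poly_Mapping.lookup"
abbreviation "keys \<equiv> Poly_Mapping.keys"
abbreviation "monom \<equiv> Poly_Mapping.single"
abbreviation PR :: "nat \<Rightarrow> 'k::field mpoly set" where "PR N \<equiv> carrier (polynomial_ring N)"
abbreviation Idl_PR :: "nat \<Rightarrow> 'k::field mpoly set \<Rightarrow> 'k mpoly set"
  where "Idl_PR N S \<equiv> genideal (polynomial_ring N) S"

lemma PR_iff: "f \<in> PR N \<longleftrightarrow> (\<forall>\<mu>\<in>keys f. keys \<mu> \<subseteq> {1..N})"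
  by (simp add: polynomial_ring_def)

lemma polynomial_ring_simps [simp]:
  "mult (polynomial_ring N) = (*)" "one (polynomial_ring N) = 1"
  "zero (polynomial_ring N) = 0" "add (polynomial_ring N) = (+)"
  by (simp_all add: polynomial_ring_def)

lemma PR_0 [simp]: "0 \<in> PR N" and PR_1 [simp]: "1 \<in> PR N"
  by (simp_all add: PR_iff)

lemma PR_add: "f \<in> PR N \<Longrightarrow> g \<in> PR N \<Longrightarrow> f + g \<in> PR N"
  using keys_add[of f g] by (auto simp: PR_iff)

lemma PR_uminus: "f \<in> PR N \<Longrightarrow> - f \<in> PR N"
  by (simp add: PR_iff)

lemma PR_diff: "f \<in> PR N \<Longrightarrow> g \<in> PR N \<Longrightarrow> f - g \<in> PR N"
  using PR_add[of f N "- g"] PR_uminus[of g N] by simp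

lemma PR_mult:
  assumes "f \<in> PR N" "g \<in> PR N" shows "f * g \<in> PR N"
proof -
  interpret cring "polynomial_ring N :: 'a mpoly ring" by (rule cring_polynomial_ring)
  show ?thesis using m_closed[OF assms] by simp
qed

lemma PR_sum: "(\<And>i. i \<in> A \<Longrightarrow> f i \<in> PR N) \<Longrightarrow> sum f A \<in> PR N"
  by (induction A rule: infinite_finite_induct) (auto intro: PR_add)

lemma PR_monom: "keys \<mu> \<subseteq> {1..N} \<Longrightarrow> monom \<mu> c \<in> PR N"
  by (simp add: PR_iff)

lemma var_power: "var i ^ e = monom (monom i e) (1::'k::field)"
  by (induction e) (simp_all add: var_def mult_single flip: single_add)

lemma PR_var_power: "i \<in> {1..N} \<Longrightarrow> var i ^ e \<in> PR N"
  unfolding var_power by (rule PR_monom) auto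

lemma sum_monomials: "(\<Sum>\<mu>\<in>keys f. monom \<mu> (lookup f \<mu>)) = f"
  by (rule poly_mapping_eqI) (auto simp: lookup_sum lookup_single when_def in_keys_iff)

lemma lookup_monom_mult:
  fixes \<mu> :: "nat \<Rightarrow>\<^sub>0 nat" and f :: "'k::field mpoly"
  shows "lookup (monom \<mu> c * f) \<nu> =
    (if \<forall>i. lookup \<mu> i \<le> lookup \<nu> i then c * lookup f (\<nu> - \<mu>) else 0)"
proof -
  have "lookup (monom \<mu> c * f) \<nu> = (\<Sum>l. (c * (\<Sum>q. lookup f q when \<nu> = l + q)) when l = \<mu>)"
    unfolding lookup_mult lookup_single when_mult by (simp add: eq_commute[of \<mu>])
  also have "\<dots> = c * (\<Sum>q. lookup f q when \<nu> = \<mu> + q)"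
    by simp
  also have "(\<Sum>q. lookup f q when \<nu> = \<mu> + q) =
      (if \<forall>i. lookup \<mu> i \<le> lookup \<nu> i then lookup f (\<nu> - \<mu>) else 0)"
  proof (cases "\<forall>i. lookup \<mu> i \<le> lookup \<nu> i")
    case True
    then have "\<nu> = \<mu> + q \<longleftrightarrow> q = \<nu> - \<mu>" for q
      by (auto simp: poly_mapping_eq_iff lookup_add lookup_minus fun_eq_iff)
    then show ?thesis using True by simp
  next
    case False
    then have "\<nu> \<noteq> \<mu> + q" for q
      by (auto simp: lookup_add)
    then show ?thesis using False by (simp only: if_False) simp
  qed
  finally show ?thesis by simp
qed

lemma lookup_monom0_mult:
  fixes f :: "('a::comm_monoid_add) \<Rightarrow>\<^sub>0 'k::field"
  shows "lookup (monom 0 c * f) \<nu> = c * lookup f \<nu>"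
  unfolding lookup_mult lookup_single when_mult by simp

lemma ideal_PR_I:
  assumes "J \<subseteq> PR N" "0 \<in> J" "\<And>f g. f \<in> J \<Longrightarrow> g \<in> J \<Longrightarrow> f + g \<in> J"
    and mult: "\<And>f g. f \<in> J \<Longrightarrow> g \<in> PR N \<Longrightarrow> g * f \<in> J"
  shows "ideal J (polynomial_ring N :: 'k::field mpoly ring)"
proof -
  interpret R: cring "polynomial_ring N :: 'k mpoly ring" by (rule cring_polynomial_ring)
  have neg: "- f \<in> J" if "f \<in> J" for f
    using mult[OF that PR_uminus[OF PR_1]] by simp
  have inv: "a_inv (polynomial_ring N) f = - f" if "f \<in> PR N" for f :: "'k mpoly"
    using R.minus_equality[of "- f" f] that PR_uminus[OF that] by simp
  show ?thesis
  proof (rule idealI)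
    show "ring (polynomial_ring N :: 'k mpoly ring)" by (rule R.ring_axioms)
    show "subgroup J (add_monoid (polynomial_ring N))"
    proof (rule group.subgroupI)
      show "group (add_monoid (polynomial_ring N :: 'k mpoly ring))"
        by (rule R.a_group)
      fix f assume f: "f \<in> J"
      then have "f \<in> PR N" using assms(1) by blast
      then have "inv\<^bsub>add_monoid (polynomial_ring N)\<^esub> f = - f"
        using inv by (simp add: a_inv_def)
      then show "inv\<^bsub>add_monoid (polynomial_ring N)\<^esub> f \<in> J" using neg[OF f] by simp
    qed (use assms in auto)
  qed (use mult in \<open>auto simp: mult.commute\<close>)
qed

lemma ideal_PRD:
  assumes "ideal J (polynomial_ring N :: 'k::field mpoly ring)"
  shows ideal_subset: "J \<subseteq> PR N" and ideal_0: "0 \<in> J"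
    and ideal_add: "f \<in> J \<Longrightarrow> g \<in> J \<Longrightarrow> f + g \<in> J"
    and ideal_mult: "g \<in> PR N \<Longrightarrow> f \<in> J \<Longrightarrow> g * f \<in> J"
proof -
  interpret ideal J "polynomial_ring N :: 'k mpoly ring" by fact
  show "J \<subseteq> PR N" using Icarr by auto
  show "0 \<in> J" using additive_subgroup.zero_closed[OF additive_subgroup_axioms] by simp
  show "f \<in> J \<Longrightarrow> g \<in> J \<Longrightarrow> f + g \<in> J" using additive_subgroup.a_closed[OF additive_subgroup_axioms] by simp
  show "g \<in> PR N \<Longrightarrow> f \<in> J \<Longrightarrow> g * f \<in> J" using I_l_closed by simp
qed

lemma ideal_uminus:
  assumes "ideal J (polynomial_ring N :: 'k::field mpoly ring)" "f \<in> J"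
  shows "- f \<in> J"
  using ideal_mult[OF assms(1) PR_uminus[OF PR_1] assms(2)] by simp

lemma ideal_diff:
  assumes "ideal J (polynomial_ring N :: 'k::field mpoly ring)" "f \<in> J" "g \<in> J"
  shows "f - g \<in> J"
  using ideal_add[OF assms(1,2) ideal_uminus[OF assms(1,3)]] by simp

lemma ideal_sum:
  assumes "ideal J (polynomial_ring N :: 'k::field mpoly ring)" "\<And>i. i \<in> A \<Longrightarrow> f i \<in> J"
  shows "sum f A \<in> J"
  using assms(2)
  by (induction A rule: infinite_finite_induct)
    (auto intro: ideal_add[OF assms(1)] ideal_0[OF assms(1)])

lemma ideal_scaleD:
  assumes J: "ideal J (polynomial_ring N :: 'k::field mpoly ring)"
    and "monom 0 c * f \<in> J" "c \<noteq> 0"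
  shows "f \<in> J"
proof -
  have "monom 0 (inverse c) * (monom 0 c * f) \<in> J"
    by (rule ideal_mult[OF J]) (use assms in \<open>auto intro: PR_monom\<close>)
  then show ?thesis
    using \<open>c \<noteq> 0\<close> by (simp add: mult_single flip: mult.assoc)
qed

lemma Idl_PR_ideal: "S \<subseteq> PR N \<Longrightarrow> ideal (Idl_PR N S) (polynomial_ring N :: 'k::field mpoly ring)"
  by (intro ring.genideal_ideal cring.axioms cring_polynomial_ring)

lemma Idl_PR_self: "S \<subseteq> PR N \<Longrightarrow> f \<in> S \<Longrightarrow> f \<in> Idl_PR N (S :: 'k::field mpoly set)"
  using ring.genideal_self[OF cring.axioms(1)[OF cring_polynomial_ring]] by blast

lemma Idl_PR_minimal:
  "ideal J (polynomial_ring N :: 'k::field mpoly ring) \<Longrightarrow> S \<subseteq> J \<Longrightarrow> Idl_PR N S \<subseteq> J"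
  by (rule ring.genideal_minimal[OF cring.axioms(1)[OF cring_polynomial_ring]])

lemma Idl_PR_mono: "S \<subseteq> T \<Longrightarrow> T \<subseteq> PR N \<Longrightarrow> Idl_PR N S \<subseteq> Idl_PR N (T :: 'k::field mpoly set)"
  by (rule Idl_PR_minimal[OF Idl_PR_ideal]) (auto intro: Idl_PR_self)

lemma Idl_PR_empty: "Idl_PR N {} = {0 :: 'k::field mpoly}"
proof
  have "ideal {0} (polynomial_ring N :: 'k mpoly ring)"
    by (rule ideal_PR_I) auto
  then show "Idl_PR N {} \<subseteq> {0 :: 'k mpoly}" by (rule Idl_PR_minimal) simp
  show "{0} \<subseteq> Idl_PR N ({} :: 'k mpoly set)"
    using ideal_0[OF Idl_PR_ideal[of "{}"]] by simp
qed

lemma Idl_PR_insertE: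
  assumes f: "f \<in> PR N" and S: "S \<subseteq> PR N" and h: "h \<in> Idl_PR N (insert f S)"
  obtains g s where "g \<in> PR N" "s \<in> Idl_PR N S" "h = g * f + (s :: 'k::field mpoly)"
proof -
  note idl = Idl_PR_ideal[OF S]
  let ?J = "{g * f + s | g s. g \<in> PR N \<and> s \<in> Idl_PR N S}"
  have "ideal ?J (polynomial_ring N)"
  proof (rule ideal_PR_I)
    show "?J \<subseteq> PR N"
      using f ideal_subset[OF idl] by (auto intro!: PR_add PR_mult)
    show "0 \<in> ?J" using ideal_0[OF idl] by (auto intro!: exI[of _ 0])
    fix x y assume "x \<in> ?J" "y \<in> ?J"
    then obtain g s g' s' where "x = g * f + s" "y = g' * f + s'"
      "g \<in> PR N" "s \<in> Idl_PR N S" "g' \<in> PR N" "s' \<in> Idl_PR N S" by blast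
    then have "x + y = (g + g') * f + (s + s')" "g + g' \<in> PR N" "s + s' \<in> Idl_PR N S"
      by (auto simp: algebra_simps intro: PR_add ideal_add[OF idl])
    then show "x + y \<in> ?J" by blast
  next
    fix x y :: "'k mpoly" assume "x \<in> ?J" and y: "y \<in> PR N"
    then obtain g s where "x = g * f + s" "g \<in> PR N" "s \<in> Idl_PR N S" by blast
    then have "y * x = (y * g) * f + y * s" "y * g \<in> PR N" "y * s \<in> Idl_PR N S"
      using y by (auto simp: distrib_left mult.assoc intro: PR_mult ideal_mult[OF idl])
    then show "y * x \<in> ?J" by blast
  qed
  moreover have "insert f S \<subseteq> ?J"
  proof
    fix x assume "x \<in> insert f S"
    then consider "x = f" | "x \<in> S" by blast
    then show "x \<in> ?J"
    proof cases
      case 1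
      then have "x = 1 * f + 0" "(1 :: 'k mpoly) \<in> PR N" "0 \<in> Idl_PR N S"
        using ideal_0[OF idl] by auto
      then show ?thesis by blast
    next
      case 2
      then have "x = 0 * f + x" "(0 :: 'k mpoly) \<in> PR N" "x \<in> Idl_PR N S"
        using Idl_PR_self[OF S] by auto
      then show ?thesis by blast
    qed
  qed
  ultimately have "Idl_PR N (insert f S) \<subseteq> ?J" by (rule Idl_PR_minimal)
  then show ?thesis using h that by blast
qed


section \<open>The length of a regular sequence\<close>

text \<open>The index type is left arbitrary because two vector spaces are needed: the polynomials and, for
  counting generators, the tuples of coefficients at finitely many corners.\<close>

interpretation coeffs: vector_space "\<lambda>c (f :: ('a::comm_monoid_add) \<Rightarrow>\<^sub>0 'k::field). monom 0 c * f"
  by unfold_locales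
    (simp_all add: distrib_left distrib_right single_add mult_single flip: mult.assoc)

text \<open>Bounding every exponent separately keeps the space closed under products in the same way as the
  total degree, but makes its dimension the plain power \<open>(d + 1)\<^sup>N\<close>.\<close>

definition box_polys :: "nat \<Rightarrow> nat \<Rightarrow> 'k::field mpoly set" where
  "box_polys N d = {f \<in> PR N. \<forall>\<mu>\<in>keys f. \<forall>i. lookup \<mu> i \<le> d}"

definition indep_mod :: "'k::field mpoly set \<Rightarrow> 'k mpoly set \<Rightarrow> bool" where
  "indep_mod J T \<longleftrightarrow>
     finite T \<and> (\<forall>u. (\<Sum>t\<in>T. monom 0 (u t) * t) \<in> J \<longrightarrow> (\<forall>t\<in>T. u t = 0))"

lemma indep_modD:
  "indep_mod J T \<Longrightarrow> (\<Sum>t\<in>T. monom 0 (u t) * t) \<in> J \<Longrightarrow> t \<in> T \<Longrightarrow> u t = 0"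
  unfolding indep_mod_def by blast

lemma box_polys_mono: "d \<le> e \<Longrightarrow> box_polys N d \<subseteq> box_polys N e"
  unfolding box_polys_def by (auto intro: order_trans)

lemma box_polys_mult:
  assumes "f \<in> box_polys N d" "g \<in> box_polys N e"
  shows "f * g \<in> box_polys N (d + e)"
proof -
  have "lookup \<mu> i \<le> d + e" if \<mu>: "\<mu> \<in> keys (f * g)" for \<mu> i
  proof -
    obtain \<alpha> \<beta> where "\<mu> = \<alpha> + \<beta>" "\<alpha> \<in> keys f" "\<beta> \<in> keys g"
      using keys_mult[of f g] \<mu> by blast
    then show ?thesis using assms by (auto simp: box_polys_def lookup_add intro: add_mono)
  qed
  then show ?thesis using assms by (auto simp: box_polys_def intro: PR_mult)
qed

lemma finite_family_in_box_polys:
  assumes "finite S" "S \<subseteq> PR N"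
  shows "\<exists>d. S \<subseteq> box_polys N d"
proof -
  have "finite (\<Union>f\<in>S. \<Union>\<mu>\<in>keys f. lookup \<mu> ` keys \<mu>)"
    by (intro finite_UN_I finite_imageI finite_keys assms(1))
  from this[unfolded finite_nat_set_iff_bounded_le]
  obtain d where d: "\<forall>x\<in>(\<Union>f\<in>S. \<Union>\<mu>\<in>keys f. lookup \<mu> ` keys \<mu>). x \<le> d" ..
  have "lookup \<mu> i \<le> d" if "f \<in> S" "\<mu> \<in> keys f" for f \<mu> i
  proof (cases "i \<in> keys \<mu>")
    case True
    then show ?thesis using that d by blast
  qed (simp add: in_keys_iff)
  then have "S \<subseteq> box_polys N d" using assms(2) unfolding box_polys_def by blast
  then show ?thesis by blast
qed

lemma box_polys_dimension:
  "\<exists>E. finite E \<and> card E \<le> (d + 1) ^ N \<and> (box_polys N d :: 'k::field mpoly set) \<subseteq> coeffs.span E"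
proof -
  let ?M = "{\<mu> :: nat \<Rightarrow>\<^sub>0 nat. keys \<mu> \<subseteq> {1..N} \<and> (\<forall>i. lookup \<mu> i \<le> d)}"
  let ?r = "\<lambda>\<mu> :: nat \<Rightarrow>\<^sub>0 nat. restrict (lookup \<mu>) {1..N}"
  have inj: "inj_on ?r ?M"
  proof (rule inj_onI)
    fix \<mu> \<nu> assume \<mu>: "\<mu> \<in> ?M" and \<nu>: "\<nu> \<in> ?M" and eq: "?r \<mu> = ?r \<nu>"
    show "\<mu> = \<nu>"
    proof (rule poly_mapping_eqI)
      fix i show "lookup \<mu> i = lookup \<nu> i"
      proof (cases "i \<in> {1..N}")
        case True then show ?thesis using fun_cong[OF eq, of i] by simp
      next
        case False
        then have "i \<notin> keys \<mu>" "i \<notin> keys \<nu>" using \<mu> \<nu> by blast+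
        then show ?thesis by (simp add: in_keys_iff)
      qed
    qed
  qed
  have sub: "?r ` ?M \<subseteq> {1..N} \<rightarrow>\<^sub>E {..d}" by auto
  have fin: "finite ({1..N} \<rightarrow>\<^sub>E {..d})" by (simp add: finite_PiE)
  have finM: "finite ?M" using finite_imageD[OF finite_subset[OF sub fin] inj] .
  have "card ?M \<le> card ({1..N} \<rightarrow>\<^sub>E {..d})"
    using card_inj_on_le[OF inj sub fin] .
  then have card: "card ?M \<le> (d + 1) ^ N" by (simp add: card_PiE)
  let ?E = "(\<lambda>\<mu>. monom \<mu> (1::'k)) ` ?M"
  have "f \<in> coeffs.span ?E" if f: "f \<in> box_polys N d" for f :: "'k mpoly"
  proof -
    have "(\<Sum>\<mu>\<in>keys f. monom 0 (lookup f \<mu>) * monom \<mu> 1) \<in> coeffs.span ?E"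
      by (intro coeffs.span_sum coeffs.span_scale coeffs.span_base imageI)
        (use f in \<open>auto simp: box_polys_def PR_iff\<close>)
    then show ?thesis by (simp add: mult_single sum_monomials)
  qed
  then show ?thesis
    using finM card card_image_le[OF finM, of "\<lambda>\<mu>. monom \<mu> (1::'k)"]
    by (intro exI[of _ ?E]) auto
qed

lemma indep_mod_card_le:
  assumes "indep_mod {0} T" "T \<subseteq> box_polys N d"
  shows "card (T :: 'k::field mpoly set) \<le> (d + 1) ^ N"
proof -
  obtain E :: "'k mpoly set"
    where E: "finite E" "card E \<le> (d + 1) ^ N" "box_polys N d \<subseteq> coeffs.span E"
    using box_polys_dimension by blast
  have "coeffs.independent T"
    using assms(1) unfolding indep_mod_def by (auto simp: coeffs.dependent_finite)
  then show ?thesis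
    using coeffs.independent_span_bound[OF E(1), of T] E(2,3) assms(2)
    by (meson order_trans)
qed

text \<open>Multiplication by a nonzerodivisor \<open>f\<close> embeds \<open>R/J\<close> in itself, and the image vanishes in \<open>R/J'\<close>
  because \<open>f \<in> J'\<close>.  So the products \<open>f\<^sup>i s\<close> with \<open>i \<le> l\<close> and \<open>s \<in> S\<close> are independent modulo \<open>J\<close>: in a
  relation, reduction modulo \<open>J'\<close> kills the coefficients with \<open>i = 0\<close>, and a factor \<open>f\<close> can be cancelled
  from the rest.\<close>

lemma indep_mod_nonzerodivisor_powers:
  fixes f :: "'k::field mpoly"
  assumes J: "ideal J (polynomial_ring N)" and J': "ideal J' (polynomial_ring N)"
    and sub: "J \<subseteq> J'" "f \<in> J'"
    and nzd: "\<And>g. g \<in> PR N \<Longrightarrow> f * g \<in> J \<Longrightarrow> g \<in> J"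
    and f: "f \<in> box_polys N D"
    and S: "indep_mod J' S" "S \<subseteq> box_polys N d"
  shows "\<exists>T. indep_mod J T \<and> T \<subseteq> box_polys N (d + l * D) \<and> card T = (l + 1) * card S"
proof (induction l)
  case 0
  show ?case using S sub by (intro exI[of _ S]) (auto simp: indep_mod_def)
next
  case (Suc l)
  then obtain T where T: "indep_mod J T" "T \<subseteq> box_polys N (d + l * D)"
    and cT: "card T = (l + 1) * card S" by blast
  have T_PR: "T \<subseteq> PR N" using T(2) by (auto simp: box_polys_def)
  have fins: "finite S" "finite T" using S T by (auto simp: indep_mod_def)
  have inj: "inj_on ((*) f) T"
  proof (rule inj_onI, rule ccontr)
    fix t t' assume t: "t \<in> T" "t' \<in> T" "f * t = f * t'" "t \<noteq> t'"
    then have "f * (t - t') \<in> J" using ideal_0[OF J] by (simp add: right_diff_distrib)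
    moreover have "t - t' \<in> PR N" using t(1,2) T_PR by (auto intro!: PR_diff)
    ultimately have "t - t' \<in> J" using nzd by blast
    moreover define u where "u = (\<lambda>s. if s = t then 1 else if s = t' then -1 else 0 :: 'k)"
    moreover have "(\<Sum>s\<in>T. monom 0 (u s) * s) = t - t'"
    proof -
      have "(\<Sum>s\<in>T. monom 0 (u s) * s) = (\<Sum>s\<in>{t, t'}. monom 0 (u s) * s)"
        by (rule sum.mono_neutral_right) (use t fins in \<open>auto simp: u_def\<close>)
      then show ?thesis using t by (simp add: u_def single_uminus)
    qed
    ultimately have "u t = 0" using indep_modD[OF T(1) _ t(1), of u] by simp
    then show False by (simp add: u_def)
  qed
  have fT: "f * t \<in> J'" if "t \<in> PR N" for t
    using ideal_mult[OF J' that sub(2)] by (simp add: mult.commute)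
  have disj: "S \<inter> (*) f ` T = {}"
  proof (rule ccontr)
    assume "S \<inter> (*) f ` T \<noteq> {}"
    then obtain t where t: "t \<in> T" "f * t \<in> S" by auto
    define u where "u = (\<lambda>s. if s = f * t then 1 else 0 :: 'k)"
    have "(\<Sum>s\<in>S. monom 0 (u s) * s) = (\<Sum>s\<in>{f * t}. monom 0 (u s) * s)"
      by (rule sum.mono_neutral_right) (use t fins in \<open>auto simp: u_def\<close>)
    also have "\<dots> = f * t" by (simp add: u_def)
    finally have "(\<Sum>s\<in>S. monom 0 (u s) * s) \<in> J'"
      using fT t(1) T_PR by auto
    then have "u (f * t) = 0" by (rule indep_modD[OF S(1) _ t(2)])
    then show False by (simp add: u_def)
  qed
  let ?T = "S \<union> (*) f ` T"
  have "indep_mod J ?T"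
    unfolding indep_mod_def
  proof (intro conjI allI impI)
    show "finite ?T" using fins by simp
    fix u :: "'k mpoly \<Rightarrow> 'k" assume u: "(\<Sum>t\<in>?T. monom 0 (u t) * t) \<in> J"
    define A where "A = (\<Sum>s\<in>S. monom 0 (u s) * s)"
    define B where "B = (\<Sum>t\<in>T. monom 0 (u (f * t)) * t)"
    have B_PR: "B \<in> PR N"
      unfolding B_def using T_PR by (auto intro!: PR_sum PR_mult PR_monom)
    have "(\<Sum>t\<in>?T. monom 0 (u t) * t) = A + f * B"
      unfolding A_def B_def sum.union_disjoint[OF fins(1) finite_imageI[OF fins(2)] disj]
        sum.reindex[OF inj]
      by (simp add: sum_distrib_left mult.left_commute)
    then have AB: "A + f * B \<in> J" using u by simp
    then have "(A + f * B) - f * B \<in> J'"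
      using ideal_diff[OF J'] fT[OF B_PR] sub(1) by blast
    then have uS: "\<forall>s\<in>S. u s = 0"
      using indep_modD[OF S(1), of u] unfolding A_def by simp
    then have "A = 0" by (simp add: A_def)
    then have "B \<in> J" using nzd[OF B_PR] AB by simp
    then have "\<forall>t\<in>T. u (f * t) = 0"
      using indep_modD[OF T(1), of "\<lambda>t. u (f * t)"] unfolding B_def by blast
    then show "\<forall>t\<in>?T. u t = 0" using uS by auto
  qed
  moreover have "?T \<subseteq> box_polys N (d + Suc l * D)"
  proof -
    have "S \<subseteq> box_polys N (d + Suc l * D)"
      using S(2) box_polys_mono[of d "d + Suc l * D" N] by (rule order_trans) simp
    moreover have "f * t \<in> box_polys N (d + Suc l * D)" if "t \<in> T" for t
      using box_polys_mult[OF f, of t "d + l * D"] that T(2) by (auto simp: algebra_simps)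
    ultimately show ?thesis by auto
  qed
  moreover have "card ?T = (Suc l + 1) * card S"
    using cT by (simp add: card_Un_disjoint[OF fins(1) finite_imageI[OF fins(2)] disj]
        card_image[OF inj])
  ultimately show ?case by blast
qed

text \<open>Iterating, the products of powers at most \<open>j\<close> of the \<open>r\<close> elements are linearly independent.
  There are \<open>(j+1)\<^sup>r\<close> of them in a space of dimension at most a constant times \<open>(j+1)\<^sup>N\<close>, so \<open>r > N\<close>
  is impossible for large \<open>j\<close>.\<close>

lemma regular_sequence_length_le:
  fixes fs :: "'k::field mpoly list"
  assumes reg: "regular_sequence (polynomial_ring N) fs"
  shows "length fs \<le> N"
proof (rule ccontr)
  assume "\<not> length fs \<le> N"
  then have len: "N + 1 \<le> length fs" by simp
  have fs: "set fs \<subseteq> PR N" using reg by (simp add: regular_sequence_def)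
  obtain D where D: "set fs \<subseteq> box_polys N D"
    using finite_family_in_box_polys[OF _ fs] by auto
  define r where "r = length fs"
  \<comment> \<open>chosen to equal the constant in the dimension bound, which is then exceeded\<close>
  define j where "j = (r * D + 1) ^ N"
  have sub: "set (take i fs) \<subseteq> PR N" for i
    using fs set_take_subset[of i fs] by blast
  have "\<exists>T. indep_mod (Idl_PR N (set (take (r - k) fs))) T \<and> T \<subseteq> box_polys N (k * (j * D)) \<and>
      card T = (j + 1) ^ k" if "k \<le> r" for k
    using that
  proof (induction k)
    case 0
    have id: "ideal (Idl_PR N (set fs)) (polynomial_ring N)" by (rule Idl_PR_ideal[OF fs])
    have "1 \<notin> Idl_PR N (set fs)"
      using reg ideal.one_imp_carrier[OF id] by (auto simp: regular_sequence_def)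
    then have "u = 0" if "monom 0 u \<in> Idl_PR N (set fs)" for u :: 'k
      using ideal_scaleD[OF id, of u 1] that by auto
    then have "indep_mod (Idl_PR N (set fs)) {1}" by (simp add: indep_mod_def)
    moreover have "{1 :: 'k mpoly} \<subseteq> box_polys N 0" by (simp add: box_polys_def)
    ultimately show ?case by (intro exI[of _ "{1}"]) (simp add: r_def)
  next
    case (Suc k)
    then obtain S where S: "indep_mod (Idl_PR N (set (take (r - k) fs))) S"
      "S \<subseteq> box_polys N (k * (j * D))" "card S = (j + 1) ^ k" by auto
    define i where "i = r - Suc k"
    have i: "i < length fs" "r - k = Suc i" using Suc.prems by (auto simp: i_def r_def)
    have set_eq: "set (take (Suc i) fs) = insert (fs ! i) (set (take i fs))"
      using i(1) by (simp add: take_Suc_conv_app_nth)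
    obtain T where "indep_mod (Idl_PR N (set (take i fs))) T"
      "T \<subseteq> box_polys N (k * (j * D) + j * D)" "card T = (j + 1) * card S"
    proof -
      have "\<exists>T. indep_mod (Idl_PR N (set (take i fs))) T \<and>
          T \<subseteq> box_polys N (k * (j * D) + j * D) \<and> card T = (j + 1) * card S"
      proof (rule indep_mod_nonzerodivisor_powers[where f = "fs ! i"])
        show "fs ! i \<in> Idl_PR N (set (take (Suc i) fs))"
          by (rule Idl_PR_self[OF sub]) (simp add: set_eq)
        show "Idl_PR N (set (take i fs)) \<subseteq> Idl_PR N (set (take (Suc i) fs))"
          by (rule Idl_PR_mono[OF _ sub]) (auto simp: set_eq)
        show "g \<in> Idl_PR N (set (take i fs))"
          if "g \<in> PR N" "fs ! i * g \<in> Idl_PR N (set (take i fs))" for g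
          using reg i(1) that by (simp add: regular_sequence_def)
      qed (use S i D in \<open>auto intro: Idl_PR_ideal[OF sub]\<close>)
      then show ?thesis using that by blast
    qed
    then show ?case
      using S(3) unfolding i_def[symmetric] by (intro exI[of _ T]) (auto simp: algebra_simps)
  qed
  from this[of r] obtain T :: "'k mpoly set" where
    "indep_mod {0} T" "T \<subseteq> box_polys N (r * (j * D))" and cT: "card T = (j + 1) ^ r"
    by (auto simp: Idl_PR_empty)
  then have "(j + 1) ^ r \<le> (r * (j * D) + 1) ^ N"
    using indep_mod_card_le by metis
  also have "\<dots> \<le> ((r * D + 1) * (j + 1)) ^ N"
    by (intro power_mono) (simp_all add: algebra_simps)
  also have "\<dots> = j * (j + 1) ^ N" by (simp only: power_mult_distrib j_def)
  also have "\<dots> < (j + 1) ^ (N + 1)" by simp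
  also have "\<dots> \<le> (j + 1) ^ r" using len by (intro power_increasing) (auto simp: r_def)
  finally show False by simp
qed


section \<open>Coefficients at integer vectors\<close>

definition ivec :: "(nat \<Rightarrow>\<^sub>0 nat) \<Rightarrow> nat \<Rightarrow> int" where
  "ivec \<mu> = (\<lambda>i. int (lookup \<mu> i))"

definition expo :: "(nat \<Rightarrow> int) \<Rightarrow> nat \<Rightarrow>\<^sub>0 nat" where
  "expo z = inv_into UNIV ivec z"

text \<open>Extending the coefficients of a polynomial by zero to integer vectors removes all case distinctions
  about divisibility of monomials: \<open>coeff_at_monom_mult\<close> and the recurrence for the annihilator hold
  without side conditions on signs.\<close>

definition coeff_at :: "'k::field mpoly \<Rightarrow> (nat \<Rightarrow> int) \<Rightarrow> 'k" where
  "coeff_at f z = (if z \<in> range ivec then lookup f (expo z) else 0)"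

definition exponent_vector :: "nat \<Rightarrow> (nat \<Rightarrow> int) \<Rightarrow> bool" where
  "exponent_vector N z \<longleftrightarrow> (\<forall>i. 0 \<le> z i) \<and> (\<forall>i. i \<notin> {1..N} \<longrightarrow> z i = 0)"

lemma ivec_nonneg [simp]: "0 \<le> ivec \<mu> i"
  by (simp add: ivec_def)

lemma inj_ivec: "inj ivec"
  by (rule injI) (auto simp: ivec_def fun_eq_iff intro: poly_mapping_eqI)

lemma ivec_eq_iff [simp]: "ivec \<mu> = ivec \<nu> \<longleftrightarrow> \<mu> = \<nu>"
  using inj_ivec by (auto dest: injD)

lemma expo_ivec [simp]: "expo (ivec \<mu>) = \<mu>"
  by (simp add: expo_def inj_ivec)

lemma ivec_add: "ivec (\<mu> + \<nu>) = (\<lambda>i. ivec \<mu> i + ivec \<nu> i)"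
  by (simp add: ivec_def lookup_add)

lemma ivec_0 [simp]: "ivec 0 = (\<lambda>i. 0)"
  by (simp add: ivec_def)

lemma ivec_single: "ivec (monom l e) = (\<lambda>i. if i = l then int e else 0)"
  by (auto simp: ivec_def lookup_single when_def)

lemma range_ivec_iff: "z \<in> range ivec \<longleftrightarrow> (\<forall>i. 0 \<le> z i) \<and> finite {i. z i \<noteq> 0}"
proof
  assume "z \<in> range ivec"
  then obtain \<mu> where "z = ivec \<mu>" by blast
  then show "(\<forall>i. 0 \<le> z i) \<and> finite {i. z i \<noteq> 0}" by (simp add: ivec_def)
next
  assume z: "(\<forall>i. 0 \<le> z i) \<and> finite {i. z i \<noteq> 0}"
  have "{i. nat (z i) \<noteq> 0} \<subseteq> {i. z i \<noteq> 0}" by auto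
  then have fin: "finite {i. nat (z i) \<noteq> 0}" using z finite_subset by blast
  have "z = ivec (Abs_poly_mapping (\<lambda>i. nat (z i)))"
    using z fin by (simp add: ivec_def fun_eq_iff)
  then show "z \<in> range ivec" by blast
qed

lemma exponent_vector_in_range: "exponent_vector N z \<Longrightarrow> z \<in> range ivec"
  unfolding range_ivec_iff exponent_vector_def
  by (metis (mono_tags, lifting) finite_atLeastAtMost finite_subset mem_Collect_eq subsetI)

lemma ivec_expo [simp]: "exponent_vector N z \<Longrightarrow> ivec (expo z) = z"
  unfolding expo_def by (rule f_inv_into_f) (rule exponent_vector_in_range)

lemma exponent_vector_ivec: "exponent_vector N (ivec \<mu>) \<longleftrightarrow> keys \<mu> \<subseteq> {1..N}"
  by (auto simp: exponent_vector_def ivec_def in_keys_iff subset_iff)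

lemma coeff_at_ivec [simp]: "coeff_at f (ivec \<mu>) = lookup f \<mu>"
  by (simp add: coeff_at_def)

lemma coeff_at_negative: "z i < 0 \<Longrightarrow> coeff_at f z = 0"
  by (auto simp: coeff_at_def range_ivec_iff not_le[symmetric])

lemma coeff_at_0 [simp]: "coeff_at 0 z = 0"
  by (simp add: coeff_at_def)

lemma coeff_at_add: "coeff_at (f + g) z = coeff_at f z + coeff_at g z"
  by (simp add: coeff_at_def lookup_add)

lemma coeff_at_sum: "coeff_at (sum f S) z = (\<Sum>i\<in>S. coeff_at (f i) z)"
  by (induction S rule: infinite_finite_induct) (simp_all add: coeff_at_add)

lemma coeff_at_monom: "coeff_at (monom \<mu> c) z = (if z = ivec \<mu> then c else 0)"
proof (cases "z \<in> range ivec")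
  case True
  then show ?thesis by (auto simp: lookup_single when_def)
next
  case False
  then show ?thesis by (auto simp: coeff_at_def)
qed

lemma coeff_at_monom_mult:
  "coeff_at (monom \<mu> c * f) z = c * coeff_at f (\<lambda>i. z i - ivec \<mu> i)"
proof (cases "z \<in> range ivec")
  case True
  then obtain \<nu> where z: "z = ivec \<nu>" by blast
  show ?thesis
  proof (cases "\<forall>i. lookup \<mu> i \<le> lookup \<nu> i")
    case True
    then have "(\<lambda>i. z i - ivec \<mu> i) = ivec (\<nu> - \<mu>)"
      by (simp add: z ivec_def lookup_minus fun_eq_iff of_nat_diff)
    then show ?thesis using True by (simp add: z lookup_monom_mult)
  next
    case False
    then obtain i where "z i - ivec \<mu> i < 0" by (auto simp: z ivec_def not_le)
    then have "coeff_at f (\<lambda>i. z i - ivec \<mu> i) = 0" by (rule coeff_at_negative)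
    then show ?thesis using False unfolding z coeff_at_ivec lookup_monom_mult by auto
  qed
next
  case False
  have "(\<lambda>i. z i - ivec \<mu> i) \<notin> range ivec"
  proof
    assume "(\<lambda>i. z i - ivec \<mu> i) \<in> range ivec"
    then obtain \<kappa> where "(\<lambda>i. z i - ivec \<mu> i) = ivec \<kappa>" by blast
    then have "z = ivec (\<kappa> + \<mu>)" by (simp add: ivec_add fun_eq_iff algebra_simps)
    then show False using False by blast
  qed
  then show ?thesis using False by (simp add: coeff_at_def)
qed

lemma poly_zeroI: "(\<And>z. coeff_at f z = 0) \<Longrightarrow> f = 0"
  by (metis coeff_at_ivec lookup_zero poly_mapping_eqI)

lemma coeff_at_nonzeroD:
  assumes "f \<in> PR N" "coeff_at f z \<noteq> 0"
  shows "exponent_vector N z"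
proof -
  obtain \<mu> where z: "z = ivec \<mu>" using assms(2) by (auto simp: coeff_at_def split: if_splits)
  then have "\<mu> \<in> keys f" using assms(2) by (simp add: in_keys_iff)
  then show ?thesis using assms(1) by (simp add: z PR_iff exponent_vector_ivec)
qed

section \<open>Corners and the number of generators\<close>

text \<open>At a corner \<open>z\<close>, taking the coefficient kills \<open>(x\<^sub>1,\<dots>,x\<^sub>N) A\<close>, because the coefficient of \<open>x\<^sub>l h\<close> at
  \<open>z\<close> is that of \<open>h\<close> at \<open>z - e\<^sub>l\<close>.  So it is a functional on the space \<open>A/(x\<^sub>1,\<dots>,x\<^sub>N) A\<close> of minimal
  generators.\<close>

definition corner :: "'k::field mpoly set \<Rightarrow> (nat \<Rightarrow> int) \<Rightarrow> bool" where
  "corner A z \<longleftrightarrow> (\<forall>h\<in>A. \<forall>l. coeff_at h (\<lambda>i. z i - (if i = l then 1 else 0)) = 0)"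

lemma coeff_at_corner_mult:
  assumes A: "ideal A (polynomial_ring N :: 'k::field mpoly ring)" and z: "corner A z"
    and h: "h \<in> A" and g: "g \<in> PR N"
  shows "coeff_at (g * h) z = lookup g 0 * coeff_at h z"
proof -
  have zero: "coeff_at (monom \<mu> c * h) z = 0" if \<mu>: "\<mu> \<in> keys g" "\<mu> \<noteq> 0" for \<mu> c
  proof -
    have "keys \<mu> \<noteq> {}" using \<mu>(2) by simp
    then obtain l where l: "l \<in> keys \<mu>" by blast
    define \<nu> where "\<nu> = \<mu> - monom l 1"
    have \<mu>_eq: "\<mu> = \<nu> + monom l 1"
      using l by (auto simp: \<nu>_def poly_mapping_eq_iff fun_eq_iff lookup_add lookup_minus
          lookup_single when_def in_keys_iff)
    have "keys \<mu> \<subseteq> {1..N}" using g \<mu>(1) by (simp add: PR_iff)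
    then have "monom \<nu> c \<in> PR N"
      unfolding \<mu>_eq keys_add_exponent by (intro PR_monom) simp
    then have "monom \<nu> c * h \<in> A" by (rule ideal_mult[OF A _ h])
    then have "coeff_at (monom \<nu> c * h) (\<lambda>i. z i - (if i = l then 1 else 0)) = 0"
      using z by (simp add: corner_def)
    moreover have "(\<lambda>i. z i - (if i = l then 1 else 0) - ivec \<nu> i) = (\<lambda>i. z i - ivec \<mu> i)"
      by (auto simp: \<mu>_eq ivec_add ivec_single fun_eq_iff)
    ultimately show ?thesis by (simp add: coeff_at_monom_mult)
  qed
  have "coeff_at (g * h) z = coeff_at ((\<Sum>\<mu>\<in>keys g. monom \<mu> (lookup g \<mu>)) * h) z"
    by (simp add: sum_monomials)
  also have "\<dots> = (\<Sum>\<mu>\<in>keys g. coeff_at (monom \<mu> (lookup g \<mu>) * h) z)"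
    by (simp add: sum_distrib_right coeff_at_sum)
  also have "\<dots> = (\<Sum>\<mu>\<in>keys g. if \<mu> = 0 then lookup g 0 * coeff_at h z else 0)"
  proof (rule sum.cong)
    fix \<mu> assume "\<mu> \<in> keys g"
    then show "coeff_at (monom \<mu> (lookup g \<mu>) * h) z =
        (if \<mu> = 0 then lookup g 0 * coeff_at h z else 0)"
      by (cases "\<mu> = 0") (simp_all add: coeff_at_monom_mult zero[unfolded coeff_at_monom_mult])
  qed simp
  also have "\<dots> = lookup g 0 * coeff_at h z"
    by (auto simp: in_keys_iff)
  finally show ?thesis .
qed

text \<open>By \<open>coeff_at_corner_mult\<close> the tuple \<open>\<Lambda>\<close> of the coefficients at the corners maps \<open>A\<close> into the linear span of
  the images of the generators.  The elements \<open>G k\<close> show that this span contains all unit vectors.\<close>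

lemma number_of_generators_ge:
  fixes fs :: "'k::field mpoly list" and G :: "nat \<Rightarrow> 'k mpoly"
  assumes A: "ideal A (polynomial_ring N)" and gen: "A = Idl_PR N (set fs)"
    and fs: "set fs \<subseteq> PR N"
    and K: "finite K" and corner: "\<And>k. k \<in> K \<Longrightarrow> corner A (z k)"
    and G: "\<And>k. k \<in> K \<Longrightarrow> G k \<in> A"
    and diag: "\<And>k. k \<in> K \<Longrightarrow> coeff_at (G k) (z k) \<noteq> 0"
    and off: "\<And>k k'. k \<in> K \<Longrightarrow> k' \<in> K \<Longrightarrow> k \<noteq> k' \<Longrightarrow> coeff_at (G k) (z k') = 0"
  shows "card K \<le> length fs"
proof -
  define \<Lambda> :: "'k mpoly \<Rightarrow> nat \<Rightarrow>\<^sub>0 'k" where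
    "\<Lambda> f = (\<Sum>k\<in>K. monom k (coeff_at f (z k)))" for f
  have \<Lambda>_add: "\<Lambda> (f + g) = \<Lambda> f + \<Lambda> g" for f g
    by (simp add: \<Lambda>_def coeff_at_add single_add sum.distrib)
  have \<Lambda>_mult: "\<Lambda> (g * h) = monom 0 (lookup g 0) * \<Lambda> h" if "h \<in> A" "g \<in> PR N" for g h
    unfolding \<Lambda>_def sum_distrib_left mult_single
    by (rule sum.cong) (use that in \<open>auto simp: coeff_at_corner_mult[OF A corner]\<close>)
  define E where "E = \<Lambda> ` set fs"
  let ?L = "{f \<in> A. \<Lambda> f \<in> coeffs.span E}"
  have "ideal ?L (polynomial_ring N)"
    by (rule ideal_PR_I)
      (use ideal_subset[OF A] ideal_0[OF A] in \<open>auto simp: \<Lambda>_add \<Lambda>_mult \<Lambda>_def[of 0]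
        intro: ideal_add[OF A] ideal_mult[OF A] coeffs.span_add coeffs.span_scale coeffs.span_zero\<close>)
  moreover have "set fs \<subseteq> ?L"
    using Idl_PR_self[OF fs] unfolding gen[symmetric]
    by (auto simp: E_def intro: coeffs.span_base)
  ultimately have "Idl_PR N (set fs) \<subseteq> ?L" by (rule Idl_PR_minimal)
  then have span: "\<Lambda> f \<in> coeffs.span E" if "f \<in> A" for f
    using gen that by blast
  have \<Lambda>_G: "\<Lambda> (G k) = monom k (coeff_at (G k) (z k))" if "k \<in> K" for k
  proof -
    have "\<Lambda> (G k) = (\<Sum>k'\<in>K. if k' = k then monom k (coeff_at (G k) (z k)) else 0)"
      unfolding \<Lambda>_def by (rule sum.cong) (use off[OF that] in auto)
    then show ?thesis using K that by simp
  qed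
  define B where "B = (\<lambda>k. monom k (1::'k)) ` K"
  have inj: "inj_on (\<lambda>k. monom k (1::'k)) K"
  proof (rule inj_onI)
    fix k k' :: nat assume "monom k (1::'k) = monom k' 1"
    then have "keys (monom k (1::'k)) = keys (monom k' (1::'k))" by (rule arg_cong)
    then show "k = k'" by simp
  qed
  have "coeffs.independent B"
  proof (rule coeffs.independent_if_scalars_zero)
    show "finite B" using K by (simp add: B_def)
    fix u x assume sum: "(\<Sum>x\<in>B. monom 0 (u x) * x) = 0" and "x \<in> B"
    then obtain k where k: "k \<in> K" "x = monom k 1" by (auto simp: B_def)
    have "(\<Sum>x\<in>B. monom 0 (u x) * x) = (\<Sum>k\<in>K. monom k (u (monom k 1)))"
      unfolding B_def by (simp add: sum.reindex[OF inj] mult_single)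
    then have "lookup (\<Sum>k\<in>K. monom k (u (monom k 1))) k = 0"
      using sum by simp
    then show "u x = 0"
      using K k by (simp add: lookup_sum lookup_single when_def)
  qed
  moreover have "B \<subseteq> coeffs.span E"
  proof
    fix x assume "x \<in> B"
    then obtain k where k: "k \<in> K" "x = monom k 1" by (auto simp: B_def)
    have "x = monom 0 (inverse (coeff_at (G k) (z k))) * \<Lambda> (G k)"
      using diag[OF k(1)] by (simp add: \<Lambda>_G[OF k(1)] k(2) mult_single)
    also have "\<dots> \<in> coeffs.span E"
      by (rule coeffs.span_scale[OF span[OF G[OF k(1)]]])
    finally show "x \<in> coeffs.span E" .
  qed
  moreover have "finite E" by (simp add: E_def)
  ultimately have "card B \<le> card E"
    using coeffs.independent_span_bound by blast
  also have "card E \<le> length fs"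
    unfolding E_def by (rule order_trans[OF card_image_le card_length]) simp
  finally show ?thesis unfolding B_def by (simp add: card_image[OF inj])
qed

lemma not_complete_intersection_of_corners:
  fixes G :: "nat \<Rightarrow> 'k::field mpoly"
  assumes A: "ideal A (polynomial_ring N)"
    and corner: "\<And>k. k \<le> N \<Longrightarrow> corner A (z k)"
    and G: "\<And>k. k \<le> N \<Longrightarrow> G k \<in> A"
    and diag: "\<And>k. k \<le> N \<Longrightarrow> coeff_at (G k) (z k) \<noteq> 0"
    and off: "\<And>k k'. k \<le> N \<Longrightarrow> k' \<le> N \<Longrightarrow> k \<noteq> k' \<Longrightarrow> coeff_at (G k) (z k') = 0"
  shows "\<not> quotient_complete_intersection (polynomial_ring N) A"
proof
  assume "quotient_complete_intersection (polynomial_ring N) A"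
  then obtain fs where reg: "regular_sequence (polynomial_ring N) fs"
    and gen: "A = Idl_PR N (set fs)" by (auto simp: quotient_complete_intersection_def)
  have "card {..N} \<le> length fs"
    by (rule number_of_generators_ge[OF A gen _ _ corner G diag off])
      (use reg in \<open>auto simp: regular_sequence_def\<close>)
  then show False using regular_sequence_length_le[OF reg] by simp
qed


section \<open>The annihilator as the solutions of a recurrence\<close>

definition binomial_ann ::
  "nat \<Rightarrow> (nat \<Rightarrow> int) \<Rightarrow> (nat \<Rightarrow> int) \<Rightarrow> (nat \<Rightarrow> int) \<Rightarrow> 'k::field \<Rightarrow> 'k \<Rightarrow> 'k mpoly set" where
  "binomial_ann N \<alpha> U W c d = {f \<in> PR N. \<forall>z. (\<forall>i. z i \<le> \<alpha> i + U i) \<longrightarrow>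
     c * coeff_at f z = d * coeff_at f (\<lambda>i. z i - U i + W i)}"

text \<open>Exchanging the two terms of the binomial replaces \<open>z\<close> by \<open>z - U + W\<close> in the recurrence.  This is what
  allows every statement below to be used for both orders of the blocks.\<close>

lemma binomial_ann_swap: "binomial_ann N \<alpha> W U d c = binomial_ann N \<alpha> U W c d"
proof -
  have "binomial_ann N \<alpha> U W c d \<subseteq> binomial_ann N \<alpha> W U d c" for U W and c d :: 'a
  proof
    fix f assume f: "f \<in> binomial_ann N \<alpha> U W c d"
    have "d * coeff_at f z = c * coeff_at f (\<lambda>i. z i - W i + U i)"
      if z: "\<forall>i. z i \<le> \<alpha> i + W i" for z
    proof -
      have "c * coeff_at f (\<lambda>i. z i - W i + U i) =
          d * coeff_at f (\<lambda>i. z i - W i + U i - U i + W i)"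
        using f z unfolding binomial_ann_def by (auto simp: algebra_simps)
      then show ?thesis by simp
    qed
    then show "f \<in> binomial_ann N \<alpha> W U d c" using f by (auto simp: binomial_ann_def)
  qed
  then show ?thesis by blast
qed

locale binomial_system =
  fixes N :: nat and \<alpha> U W :: "nat \<Rightarrow> int" and c d :: "'k::field"
  assumes vectors: "exponent_vector N \<alpha>" "exponent_vector N U" "exponent_vector N W"
    and disjoint: "\<And>i. U i = 0 \<or> W i = 0"
    and supports: "\<exists>i. U i \<noteq> 0" "\<exists>i. W i \<noteq> 0"
    and units: "c \<noteq> 0" "d \<noteq> 0"
begin

lemma swap: "binomial_system N \<alpha> W U d c"
  using vectors disjoint supports units by unfold_locales auto

abbreviation "A \<equiv> binomial_ann N \<alpha> U W c d"

text \<open>The recurrence links \<open>z\<close> with \<open>shift z (-1)\<close>, and its region of validity is \<open>below_top\<close>.  Going up means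
  adding \<open>U - W\<close>, going down subtracting it.\<close>

definition shift :: "(nat \<Rightarrow> int) \<Rightarrow> int \<Rightarrow> nat \<Rightarrow> int" where
  "shift z t = (\<lambda>i. z i + t * (U i - W i))"

definition below_top :: "(nat \<Rightarrow> int) \<Rightarrow> bool" where
  "below_top z \<longleftrightarrow> (\<forall>i. z i \<le> \<alpha> i + U i)"

lemma nonneg [simp]: "0 \<le> \<alpha> i" "0 \<le> U i" "0 \<le> W i"
  using vectors by (auto simp: exponent_vector_def)

lemma positive: "U i \<noteq> 0 \<Longrightarrow> 0 < U i \<and> W i = 0" "W i \<noteq> 0 \<Longrightarrow> 0 < W i \<and> U i = 0"
  using disjoint[of i] nonneg(2,3)[of i] by linarith+

lemma positive_of_exceeds:
  "\<alpha> i < t * U i \<Longrightarrow> 0 < U i \<and> W i = 0" "\<alpha> i < t * W i \<Longrightarrow> 0 < W i \<and> U i = 0"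
proof -
  show "\<alpha> i < t * U i \<Longrightarrow> 0 < U i \<and> W i = 0"
    using positive(1)[of i] nonneg(1)[of i] by (cases "U i = 0") auto
  show "\<alpha> i < t * W i \<Longrightarrow> 0 < W i \<and> U i = 0"
    using positive(2)[of i] nonneg(1)[of i] by (cases "W i = 0") auto
qed

lemma outside: "i \<notin> {1..N} \<Longrightarrow> \<alpha> i = 0 \<and> U i = 0 \<and> W i = 0"
  using vectors by (auto simp: exponent_vector_def)

lemma A_iff:
  "f \<in> A \<longleftrightarrow> f \<in> PR N \<and>
    (\<forall>z. below_top z \<longrightarrow> c * coeff_at f z = d * coeff_at f (shift z (-1)))"
proof -
  have "shift z (-1) = (\<lambda>i. z i - U i + W i)" for z
    by (simp add: shift_def fun_eq_iff algebra_simps)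
  then show ?thesis by (simp add: binomial_ann_def below_top_def)
qed

lemma A_recurrence: "f \<in> A \<Longrightarrow> below_top z \<Longrightarrow> c * coeff_at f z = d * coeff_at f (shift z (-1))"
  by (simp add: A_iff)

lemma ideal_A: "ideal A (polynomial_ring N)"
proof (rule ideal_PR_I)
  show "A \<subseteq> PR N" by (auto simp: A_iff)
  show "0 \<in> A" by (simp add: A_iff)
  show add: "f + g \<in> A" if "f \<in> A" "g \<in> A" for f g
    using that by (auto simp: A_iff coeff_at_add distrib_left intro: PR_add)
  have monom: "monom \<mu> e * f \<in> A" if f: "f \<in> A" and \<mu>: "keys \<mu> \<subseteq> {1..N}" for \<mu> e f
    unfolding A_iff
  proof (intro conjI allI impI)
    show "monom \<mu> e * f \<in> PR N"
      by (intro PR_mult PR_monom \<mu>) (use f in \<open>simp add: A_iff\<close>)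
    fix z assume z: "below_top z"
    have "z i - ivec \<mu> i \<le> \<alpha> i + U i" for i
      using z ivec_nonneg[of \<mu> i] by (auto simp: below_top_def intro: order_trans[rotated])
    then have "c * coeff_at f (\<lambda>i. z i - ivec \<mu> i) =
        d * coeff_at f (shift (\<lambda>i. z i - ivec \<mu> i) (-1))"
      by (intro A_recurrence[OF f]) (simp add: below_top_def)
    moreover have "shift (\<lambda>i. z i - ivec \<mu> i) (-1) = (\<lambda>i. shift z (-1) i - ivec \<mu> i)"
      by (simp add: shift_def fun_eq_iff)
    ultimately show "c * coeff_at (monom \<mu> e * f) z = d * coeff_at (monom \<mu> e * f) (shift z (-1))"
      by (simp add: coeff_at_monom_mult mult.left_commute)
  qed
  show "g * f \<in> A" if f: "f \<in> A" and g: "g \<in> PR N" for f g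
  proof -
    have "(\<Sum>\<mu>\<in>S. monom \<mu> (lookup g \<mu>) * f) \<in> A" if "S \<subseteq> keys g" "finite S" for S
      using that(2,1)
    proof (induction S rule: finite_induct)
      case empty show ?case by (simp add: A_iff)
    next
      case (insert \<mu> S)
      then show ?case using monom[OF f] g by (auto simp: PR_iff intro!: add)
    qed
    from this[of "keys g"] show ?thesis
      by (simp add: sum_monomials flip: sum_distrib_right)
  qed
qed

lemma chain:
  assumes f: "f \<in> A" and below: "\<And>t. 1 \<le> t \<Longrightarrow> t \<le> s \<Longrightarrow> below_top (shift \<kappa> (int t))"
  shows "c ^ s * coeff_at f (shift \<kappa> (int s)) = d ^ s * coeff_at f \<kappa>"
  using below
proof (induction s)
  case 0 then show ?case by (simp add: shift_def)
next
  case (Suc s)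
  have "shift (shift \<kappa> (int (Suc s))) (-1) = shift \<kappa> (int s)"
    by (simp add: shift_def fun_eq_iff algebra_simps)
  then have "c * coeff_at f (shift \<kappa> (int (Suc s))) = d * coeff_at f (shift \<kappa> (int s))"
    using A_recurrence[OF f Suc.prems[of "Suc s"]] by simp
  then have "c ^ Suc s * coeff_at f (shift \<kappa> (int (Suc s))) =
      d * (c ^ s * coeff_at f (shift \<kappa> (int s)))"
    by (simp add: mult.left_commute mult.assoc)
  also have "\<dots> = d ^ Suc s * coeff_at f \<kappa>"
    using Suc by simp
  finally show ?case .
qed

text \<open>The typical use: following the line from \<open>\<kappa>\<close> upwards, where the recurrence applies at every step, until some
  entry is negative.  Corners also need single steps in the other direction (\<open>step_zero\<close>).\<close>

lemma chain_zero:
  assumes "f \<in> A" "\<And>t. 1 \<le> t \<Longrightarrow> t \<le> s \<Longrightarrow> below_top (shift \<kappa> (int t))"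
    and "coeff_at f (shift \<kappa> (int s)) = 0"
  shows "coeff_at f \<kappa> = 0"
  using chain[OF assms(1), of s \<kappa>, OF assms(2)] assms(3) units by simp

lemma step_zero:
  assumes "f \<in> A" "below_top z" "shift z (-1) u < 0"
  shows "coeff_at f z = 0"
  using A_recurrence[OF assms(1,2)] coeff_at_negative[of "shift z (-1)" u f] assms(3) units by simp

definition chain_poly :: "(nat \<Rightarrow> int) \<Rightarrow> nat \<Rightarrow> 'k mpoly" where
  "chain_poly z s = (\<Sum>i=0..s. monom (expo (shift z (int i))) (c ^ (s - i) * d ^ i))"

lemma coeff_at_chain_poly:
  assumes "\<And>i. i \<le> s \<Longrightarrow> exponent_vector N (shift z (int i))"
  shows "coeff_at (chain_poly z s) x =
    (\<Sum>i=0..s. if x = shift z (int i) then c ^ (s - i) * d ^ i else 0)"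
  unfolding chain_poly_def coeff_at_sum coeff_at_monom
  by (rule sum.cong) (simp_all add: ivec_expo[OF assms])

lemma coeff_at_chain_poly_zero:
  assumes "\<And>i. i \<le> s \<Longrightarrow> exponent_vector N (shift z (int i))"
    and "\<And>i. i \<le> s \<Longrightarrow> x \<noteq> shift z (int i)"
  shows "coeff_at (chain_poly z s) x = 0"
  using assms(2) by (simp add: coeff_at_chain_poly[OF assms(1)])

lemma shift_eq_iff: "shift z s = shift z t \<longleftrightarrow> s = t"
proof
  assume eq: "shift z s = shift z t"
  obtain i where "U i \<noteq> 0" using supports by blast
  then have "U i - W i \<noteq> 0" using disjoint[of i] by auto
  then show "s = t" using fun_cong[OF eq, of i] by (simp add: shift_def)
qed simp

lemma shift_0 [simp]: "shift z 0 = z"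
  by (simp add: shift_def)

lemma coeff_at_chain_poly_start:
  assumes "\<And>i. i \<le> s \<Longrightarrow> exponent_vector N (shift z (int i))"
  shows "coeff_at (chain_poly z s) z = c ^ s"
proof -
  have "z = shift z (int i) \<longleftrightarrow> i = 0" for i
    using shift_eq_iff[of z 0 "int i"] by auto
  then have "coeff_at (chain_poly z s) z = (\<Sum>i=0..s. if i = 0 then c ^ s else 0)"
    using coeff_at_chain_poly[of s z z, OF assms] by (auto intro: sum.cong)
  then show ?thesis by simp
qed

text \<open>Inside the segment the two sides of the recurrence agree by the choice of the coefficients, so the only
  obstructions are at the first point and at the point after the last one.  In the proof, \<open>e i\<close> is
  the contribution of the point number \<open>i\<close>, and the difference of the two sides telescopes to
  \<open>e 0 - e (Suc s)\<close>.\<close>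

lemma chain_poly_in_A:
  assumes vec: "\<And>i. i \<le> s \<Longrightarrow> exponent_vector N (shift z (int i))"
    and start: "\<not> below_top z" and stop: "\<not> below_top (shift z (int s + 1))"
  shows "chain_poly z s \<in> A"
  unfolding A_iff
proof (intro conjI allI impI)
  show "chain_poly z s \<in> PR N"
    unfolding chain_poly_def
    by (intro PR_sum PR_monom) (simp add: vec ivec_expo[OF vec] del: One_nat_def flip: exponent_vector_ivec)
  fix x assume x: "below_top x"
  define e where "e i = (if x = shift z (int i) then c ^ (Suc s - i) * d ^ i else 0)" for i
  have "shift x (-1) = shift z (int i) \<longleftrightarrow> x = shift z (int (Suc i))" for i
    by (auto simp: shift_def fun_eq_iff algebra_simps)
  then have "d * coeff_at (chain_poly z s) (shift x (-1)) = (\<Sum>i=0..s. e (Suc i))"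
    by (auto simp: coeff_at_chain_poly[OF vec] sum_distrib_left e_def intro!: sum.cong)
  moreover have "c * coeff_at (chain_poly z s) x = (\<Sum>i=0..s. e i)"
    by (auto simp: coeff_at_chain_poly[OF vec] sum_distrib_left e_def Suc_diff_le intro!: sum.cong)
  moreover have "e 0 = 0" "e (Suc s) = 0"
    using x start stop by (auto simp: e_def add.commute)
  moreover have "(\<Sum>i=0..s. e (Suc i)) + e 0 = (\<Sum>i=0..s. e i) + e (Suc s)"
    by (induction s) (simp_all add: algebra_simps)
  ultimately show "c * coeff_at (chain_poly z s) x = d * coeff_at (chain_poly z s) (shift x (-1))"
    by simp
qed

section \<open>Corners of the annihilator\<close>

text \<open>The exponent of the first power of \<open>x\<^sub>k\<close> that kills both terms of the binomial.  Since \<open>U\<close> and \<open>W\<close>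
  have disjoint supports, \<open>U k + W k\<close> is the maximum of the two.\<close>

definition pure :: "nat \<Rightarrow> nat \<Rightarrow> int" where
  "pure k = (\<lambda>i. if i = k then \<alpha> k + U k + W k + 1 else 0)"

lemma pure_vec: "k \<in> {1..N} \<Longrightarrow> exponent_vector N (pure k)"
  by (auto simp: pure_def exponent_vector_def intro!: add_nonneg_nonneg)

lemma pure_in_A:
  assumes "k \<in> {1..N}" shows "chain_poly (pure k) 0 \<in> A"
proof (rule chain_poly_in_A)
  show "\<not> below_top (pure k)"
    unfolding below_top_def not_all by (rule exI[of _ k]) (simp add: pure_def not_le)
  show "\<not> below_top (shift (pure k) (int 0 + 1))"
    unfolding below_top_def not_all
    by (rule exI[of _ k]) (simp add: pure_def shift_def not_le)
qed (simp add: pure_vec[OF assms])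

text \<open>One step of the recurrence subtracts \<open>U\<close>, and makes the entry \<open>u\<close> negative.\<close>

lemma corner_pure_U:
  assumes "W k = 0" "U u \<noteq> 0" "u \<noteq> k"
  shows "corner A (pure k)"
  unfolding corner_def
proof (intro ballI allI)
  fix h l assume h: "h \<in> A"
  let ?z = "\<lambda>i. pure k i - (if i = l then 1 else 0)"
  show "coeff_at h ?z = 0"
  proof (cases "l = k")
    case True
    have "W u = 0" "0 < U u" using positive assms(2) by auto
    then show ?thesis
      using assms(1,3) True
      by (intro step_zero[OF h, of _ u]) (auto simp: below_top_def pure_def shift_def)
  next
    case False
    then show ?thesis by (intro coeff_at_negative[of _ l]) (simp add: pure_def)
  qed
qed

lemma corner_pure:
  assumes "W k = 0 \<and> U u \<noteq> 0 \<or> U k = 0 \<and> W u \<noteq> 0" "u \<noteq> k"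
  shows "corner A (pure k)"
proof -
  interpret S: binomial_system N \<alpha> W U d c by (rule swap)
  have "S.pure k = pure k" by (simp add: pure_def S.pure_def algebra_simps fun_eq_iff)
  then show ?thesis
    using assms corner_pure_U[of k u] S.corner_pure_U[of k u]
    by (auto simp: binomial_ann_swap)
qed

text \<open>The coordinates outside the support of \<open>W\<close> allow \<open>v\<close> steps upwards: each step adds \<open>U\<close>, and
  \<open>v U \<le> \<alpha> + U\<close>.\<close>

lemma stays_below_top:
  assumes "\<And>i. (int v - 1) * U i \<le> \<alpha> i" "\<And>i. W i = 0 \<Longrightarrow> \<kappa> i \<le> 0" "t \<le> v" "W i = 0"
  shows "shift \<kappa> (int t) i \<le> \<alpha> i + U i"
proof -
  have "int t * U i \<le> int v * U i" using assms(3) by (intro mult_right_mono) auto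
  also have "\<dots> \<le> \<alpha> i + U i" using assms(1)[of i] by (simp add: algebra_simps)
  finally show ?thesis using assms(2,4) by (fastforce simp: shift_def)
qed

text \<open>Here \<open>v\<close> is the least number with \<open>v U \<le> \<alpha>\<close> false, and \<open>v W \<le> \<alpha>\<close> still holds.  The segment starting at
  \<open>v W\<close> would lie in the region of the recurrence at its first point, so the entry \<open>j\<close> is raised
  to \<open>\<alpha> j + 1\<close>; every \<open>j\<close> in the support of \<open>W\<close> can be used.  For the corner property at \<open>z - e\<^sub>l\<close> there are
  two reasons: if \<open>l = j\<close>, the recurrence applies at \<open>z - e\<^sub>l\<close> itself, and one step down leads to a
  negative entry; for the other \<open>l\<close> in the support of \<open>W\<close>, \<open>v\<close> steps up make the entry \<open>l\<close> equal to \<open>-1\<close>.\<close>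

lemma corner_strict:
  assumes v: "1 \<le> v" and vU: "\<alpha> u < int v * U u" and prevU: "\<And>i. (int v - 1) * U i \<le> \<alpha> i"
    and vW: "\<And>i. int v * W i \<le> \<alpha> i" and j: "W j \<noteq> 0"
  defines "z \<equiv> (\<lambda>i. if i = j then \<alpha> j + 1 else int v * W i)"
  shows "corner A z" and "chain_poly z v \<in> A"
    and "\<And>i. i \<le> v \<Longrightarrow> exponent_vector N (shift z (int i))"
proof -
  have Wj: "0 < W j" "U j = 0" using positive j by auto
  have jN: "j \<in> {1..N}" using outside j by blast
  have U_u: "0 < U u" "W u = 0" "u \<noteq> j"
    using positive_of_exceeds(1)[OF vU] Wj by auto
  have tW: "int t * W i \<le> \<alpha> i" if "t \<le> v" for t i
    using vW[of i] mult_right_mono[of "int t" "int v" "W i"] that by simp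
  show vec: "exponent_vector N (shift z (int t))" if t: "t \<le> v" for t
    unfolding exponent_vector_def
  proof (intro conjI allI impI)
    fix i
    have "int t * W i \<le> int v * W i + int t * U i"
      using t by (intro add_increasing2 mult_right_mono) auto
    then show "0 \<le> shift z (int t) i"
      using tW[OF t, of j] Wj by (auto simp: shift_def z_def algebra_simps)
  next
    fix i assume "i \<notin> {1..N}"
    then show "shift z (int t) i = 0"
      using outside[of i] jN by (auto simp: shift_def z_def)
  qed
  show "chain_poly z v \<in> A"
  proof (rule chain_poly_in_A[OF vec])
    show "\<not> below_top z"
      unfolding below_top_def not_all by (rule exI[of _ j]) (simp add: z_def Wj)
    show "\<not> below_top (shift z (int v + 1))"
      unfolding below_top_def not_all
      by (rule exI[of _ u]) (use vU U_u in \<open>simp add: z_def shift_def algebra_simps\<close>)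
  qed
  show "corner A z"
    unfolding corner_def
  proof (intro ballI allI)
    fix h l assume h: "h \<in> A"
    let ?z = "\<lambda>i. z i - (if i = l then 1 else 0)"
    consider (j) "l = j" | (W) "l \<noteq> j" "W l \<noteq> 0" | (U) "l \<noteq> j" "W l = 0" by blast
    then show "coeff_at h ?z = 0"
    proof cases
      case j
      then show ?thesis
        using U_u Wj tW[of v]
        by (intro step_zero[OF h, of _ u])
          (auto simp: below_top_def shift_def z_def intro: add_increasing2)
    next
      case W
      show ?thesis
      proof (rule chain_zero[OF h, where s = v])
        show "coeff_at h (shift ?z (int v)) = 0"
          by (rule coeff_at_negative[of _ l])
            (use W disjoint[of l] in \<open>auto simp: shift_def z_def\<close>)
        fix t assume t: "1 \<le> t" "t \<le> v"
        have "shift ?z (int t) i \<le> \<alpha> i + U i" for i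
        proof (cases "W i = 0")
          case True
          then show ?thesis
            using t Wj by (intro stays_below_top[OF prevU]) (auto simp: z_def)
        next
          case False
          then have "1 * 1 \<le> int t * W i"
            using t positive(2)[of i] by (intro mult_mono) auto
          moreover have "U i = 0" using False positive by blast
          ultimately show ?thesis using vW[of i]
            by (auto simp: shift_def z_def)
        qed
        then show "below_top (shift ?z (int t))" by (simp add: below_top_def)
      qed
    next
      case U
      then show ?thesis by (intro coeff_at_negative[of _ l]) (simp add: z_def)
    qed
  qed
qed

text \<open>If \<open>v\<close> is least for \<open>U\<close> and for \<open>W\<close> simultaneously, the segment from \<open>v W\<close> to \<open>v U\<close> already leaves the region of
  the recurrence at both ends.\<close>

lemma corner_equal:
  assumes v: "1 \<le> v" and vU: "\<alpha> u < int v * U u" and prevU: "\<And>i. (int v - 1) * U i \<le> \<alpha> i"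
    and vW: "\<alpha> w < int v * W w" and prevW: "\<And>i. (int v - 1) * W i \<le> \<alpha> i"
  defines "z \<equiv> (\<lambda>i. int v * W i)"
  shows "corner A z" and "chain_poly z v \<in> A"
    and "\<And>i. i \<le> v \<Longrightarrow> exponent_vector N (shift z (int i))"
proof -
  have U_u: "0 < U u" "W u = 0"
    using positive_of_exceeds(1)[OF vU] by auto
  have W_w: "0 < W w" "U w = 0"
    using positive_of_exceeds(2)[OF vW] by auto
  show vec: "exponent_vector N (shift z (int t))" if t: "t \<le> v" for t
    unfolding exponent_vector_def
  proof (intro conjI allI impI)
    fix i
    have "int t * W i \<le> int v * W i + int t * U i"
      using t by (intro add_increasing2 mult_right_mono) auto
    then show "0 \<le> shift z (int t) i"
      by (auto simp: shift_def z_def algebra_simps)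
  next
    fix i assume "i \<notin> {1..N}"
    then show "shift z (int t) i = 0"
      using outside[of i] by (auto simp: shift_def z_def)
  qed
  show "chain_poly z v \<in> A"
  proof (rule chain_poly_in_A[OF vec])
    show "\<not> below_top z"
      unfolding below_top_def not_all by (rule exI[of _ w]) (use vW W_w in \<open>simp add: z_def\<close>)
    show "\<not> below_top (shift z (int v + 1))"
      unfolding below_top_def not_all
      by (rule exI[of _ u]) (use vU U_u in \<open>simp add: z_def shift_def algebra_simps\<close>)
  qed
  show "corner A z"
    unfolding corner_def
  proof (intro ballI allI)
    fix h l assume h: "h \<in> A"
    let ?z = "\<lambda>i. z i - (if i = l then 1 else 0)"
    show "coeff_at h ?z = 0"
    proof (cases "W l = 0")
      case False
      show ?thesis
      proof (rule chain_zero[OF h, where s = v])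
        show "coeff_at h (shift ?z (int v)) = 0"
          by (rule coeff_at_negative[of _ l])
            (use False disjoint[of l] in \<open>auto simp: shift_def z_def\<close>)
        fix t assume t: "1 \<le> t" "t \<le> v"
        have "shift ?z (int t) i \<le> \<alpha> i + U i" for i
        proof (cases "W i = 0")
          case True
          then show ?thesis
            using t by (intro stays_below_top[OF prevU]) (auto simp: z_def)
        next
          case False
          have "1 * W i \<le> int t * W i" using t by (intro mult_right_mono) auto
          then show ?thesis using False prevW[of i] disjoint[of i]
            by (auto simp: shift_def z_def algebra_simps)
        qed
        then show "below_top (shift ?z (int t))" by (simp add: below_top_def)
      qed
    next
      case True
      then show ?thesis by (intro coeff_at_negative[of _ l]) (simp add: z_def)
    qed
  qed
qed

text \<open>A second segment, for the case that \<open>v\<close> is least for both exponents and \<open>W\<close> is supported at \<open>y\<close> only.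
  It has one point less, and leaves the region of the recurrence through the entry \<open>y\<close> at its
  start and through the entry \<open>j\<close> after its end: the start \<open>z\<close> is chosen such that \<open>z y\<close> and
  the entry \<open>j\<close> of the last point are \<open>\<alpha> y + 1\<close> and \<open>\<alpha> j + 1\<close>.\<close>

lemma mixed_chain:
  assumes v: "1 \<le> v" and prevU: "(int v - 1) * U j \<le> \<alpha> j"
    and y: "\<And>i. i \<noteq> y \<Longrightarrow> W i = 0" and prevW: "(int v - 1) * W y \<le> \<alpha> y"
    and j: "U j \<noteq> 0" and Wy: "W y \<noteq> 0"
  defines "z \<equiv> (\<lambda>i. if i = j then \<alpha> j + 1 - (int v - 1) * U j else if i = y then \<alpha> y + 1 else 0)"
  shows "chain_poly z (v - 1) \<in> A"
    and "\<And>i. i \<le> v - 1 \<Longrightarrow> exponent_vector N (shift z (int i))"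
proof -
  have Uj: "0 < U j" "W j = 0" using positive j by auto
  have Wy: "0 < W y" "U y = 0" using positive Wy by auto
  have ne: "y \<noteq> j" using Uj Wy by auto
  have jyN: "j \<in> {1..N}" "y \<in> {1..N}" using outside Uj Wy by force+
  have int_v: "int (v - 1) = int v - 1" using v by simp
  show vec: "exponent_vector N (shift z (int t))" if t: "t \<le> v - 1" for t
    unfolding exponent_vector_def
  proof (intro conjI allI impI)
    fix i
    have "int t * W y \<le> (int v - 1) * W y" using t int_v by (intro mult_right_mono) auto
    then have ty: "int t * W y \<le> \<alpha> y" using prevW by simp
    have "(int v - 1) * U j \<le> 1 + \<alpha> j + int t * U j"
      by (rule order_trans[OF prevU]) simp
    then show "0 \<le> shift z (int t) i"
      using ty y[of i] Uj Wy ne by (auto simp: shift_def z_def algebra_simps)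
  next
    fix i assume "i \<notin> {1..N}"
    then show "shift z (int t) i = 0"
      using outside[of i] jyN by (auto simp: shift_def z_def)
  qed
  show "chain_poly z (v - 1) \<in> A"
  proof (rule chain_poly_in_A[OF vec])
    show "\<not> below_top z"
      unfolding below_top_def not_all by (rule exI[of _ y]) (use ne Wy in \<open>simp add: z_def\<close>)
    show "\<not> below_top (shift z (int (v - 1) + 1))"
      unfolding below_top_def not_all int_v
      by (rule exI[of _ j]) (use Uj in \<open>simp add: z_def shift_def algebra_simps\<close>)
  qed
qed

text \<open>The starting point has only the entries \<open>j\<close> and \<open>y\<close>.  Lowering \<open>y\<close> permits a step down, which is negative at
  the second element \<open>u\<close> of the support of \<open>U\<close>.  Lowering \<open>j\<close> permits \<open>v\<close> steps up, and the last one is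
  negative at \<open>y\<close> precisely because \<open>\<alpha> y + 1 < v W y\<close>.\<close>

lemma corner_mixed:
  assumes v: "1 \<le> v" and prevU: "\<And>i. (int v - 1) * U i \<le> \<alpha> i"
    and y: "\<And>i. i \<noteq> y \<Longrightarrow> W i = 0" and prevW: "(int v - 1) * W y \<le> \<alpha> y"
    and vW: "\<alpha> y + 1 < int v * W y"
    and j: "U j \<noteq> 0" and u: "U u \<noteq> 0" "u \<noteq> j"
  defines "z \<equiv> (\<lambda>i. if i = j then \<alpha> j + 1 - (int v - 1) * U j else if i = y then \<alpha> y + 1 else 0)"
  shows "corner A z" and "chain_poly z (v - 1) \<in> A"
    and "\<And>i. i \<le> v - 1 \<Longrightarrow> exponent_vector N (shift z (int i))"
proof -
  have Uj: "0 < U j" "W j = 0" using positive j by auto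
  have Uu: "0 < U u" "W u = 0" using positive u by auto
  have Wy: "0 < W y" "U y = 0" using positive_of_exceeds(2)[of y "int v"] vW by auto
  have ne: "y \<noteq> j" "u \<noteq> y" using Uj Uu Wy by auto
  note mixed = mixed_chain[OF v prevU y prevW j Wy(1)[THEN less_imp_neq, symmetric], folded z_def]
  show "chain_poly z (v - 1) \<in> A" by (rule mixed(1))
  show "exponent_vector N (shift z (int i))" if "i \<le> v - 1" for i by (rule mixed(2)) (use that in auto)
  show "corner A z"
    unfolding corner_def
  proof (intro ballI allI)
    fix h l assume h: "h \<in> A"
    let ?z = "\<lambda>i. z i - (if i = l then 1 else 0)"
    have v0: "0 \<le> (int v - 1) * U j" using v Uj by simp
    consider (y) "l = y" | (j) "l = j" | (other) "l \<noteq> y" "l \<noteq> j" by blast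
    then show "coeff_at h ?z = 0"
    proof cases
      case y
      then show ?thesis
        using Uu Uj Wy ne v0 u
        by (intro step_zero[OF h, of _ u]) (auto simp: below_top_def shift_def z_def)
    next
      case j
      show ?thesis
      proof (rule chain_zero[OF h, where s = v])
        show "coeff_at h (shift ?z (int v)) = 0"
          by (rule coeff_at_negative[of _ y])
            (use j vW ne Wy in \<open>auto simp: shift_def z_def\<close>)
        fix t assume t: "1 \<le> t" "t \<le> v"
        have "shift ?z (int t) i \<le> \<alpha> i + U i" for i
        proof -
          consider "i = j" | "i = y" | "i \<noteq> j" "i \<noteq> y" by blast
          then show ?thesis
          proof cases
            case 1
            have "int t * U j \<le> int v * U j" using t by (intro mult_right_mono) auto
            then show ?thesis using 1 j Uj by (simp add: shift_def z_def algebra_simps)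
          next
            case 2
            have "1 * 1 \<le> int t * W y" using t Wy by (intro mult_mono) auto
            then show ?thesis using 2 j Wy ne by (simp add: shift_def z_def)
          next
            case 3
            have "int t * U i \<le> int v * U i" using t by (intro mult_right_mono) auto
            then show ?thesis
              using 3 j y[of i] prevU[of i] by (simp add: shift_def z_def algebra_simps)
          qed
        qed
        then show "below_top (shift ?z (int t))" by (simp add: below_top_def)
      qed
    next
      case other
      then show ?thesis by (intro coeff_at_negative[of _ l]) (simp add: z_def)
    qed
  qed
qed

end


context binomial_system
begin

section \<open>Too many corners\<close>

lemma coeff_at_pure:
  assumes "k \<in> {1..N}"
  shows "coeff_at (chain_poly (pure k) 0) x = (if x = pure k then 1 else 0)"
  using coeff_at_chain_poly[of 0 "pure k" x] pure_vec[OF assms] by simp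

lemma pure_neq: "z i \<noteq> 0 \<Longrightarrow> i \<noteq> k \<Longrightarrow> z \<noteq> pure k"
  by (auto simp: pure_def)

lemma pure_eq_iff: "pure k = pure k' \<longleftrightarrow> k = k'"
proof
  assume eq: "pure k = pure k'"
  have "0 < \<alpha> k + U k + W k + 1" using nonneg[of k] by linarith
  then have "pure k k \<noteq> 0" by (simp only: pure_def refl if_True less_imp_neq[symmetric] not_False_eq_True)
  then show "k = k'" using pure_neq[of "pure k" k k'] eq by auto
qed simp

text \<open>With two variables in each block, all \<open>N\<close> powers of variables give corners.  One more comes from the
  segment of \<open>corner_strict\<close> or \<open>corner_equal\<close>, stored at the index \<open>0\<close>; it differs from the powers
  because all points of the segment have at least two nonzero entries.\<close>

lemma not_ci_two_two:
  assumes v: "1 \<le> v" and vU: "\<alpha> u < int v * U u"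
    and prevU: "\<And>i. (int v - 1) * U i \<le> \<alpha> i" and prevW: "\<And>i. (int v - 1) * W i \<le> \<alpha> i"
    and U2: "U u1 \<noteq> 0" "U u2 \<noteq> 0" "u1 \<noteq> u2" and W2: "W w1 \<noteq> 0" "W w2 \<noteq> 0" "w1 \<noteq> w2"
  shows "\<not> quotient_complete_intersection (polynomial_ring N) A"
proof -
  obtain z where z: "corner A z" "chain_poly z v \<in> A"
    and vec: "\<And>t. t \<le> v \<Longrightarrow> exponent_vector N (shift z (int t))"
    and zW: "\<And>i. W i \<noteq> 0 \<Longrightarrow> z i \<noteq> 0" and zU: "\<And>i. U i \<noteq> 0 \<Longrightarrow> z i = 0"
  proof (cases "\<forall>i. int v * W i \<le> \<alpha> i")
    case True
    show ?thesis
      by (rule that[of "\<lambda>i. if i = w1 then \<alpha> w1 + 1 else int v * W i"])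
        (use corner_strict[OF v vU prevU _ W2(1)] True v nonneg(1)[of w1] positive W2(1) in
          \<open>auto simp: add_nonneg_eq_0_iff\<close>)
  next
    case False
    then obtain w where w: "\<alpha> w < int v * W w" by (auto simp: not_le)
    show ?thesis
      by (rule that[of "\<lambda>i. int v * W i"])
        (use corner_equal[OF v vU prevU w prevW] v positive in auto)
  qed
  have ne: "pure k \<noteq> shift z (int t)" if "t \<le> v" for k t
  proof (cases "t = 0")
    case True
    obtain i where "i \<noteq> k" "W i \<noteq> 0" using W2 by metis
    then show ?thesis using True pure_neq[of z i k] zW by auto
  next
    case False
    obtain i where i: "i \<noteq> k" "U i \<noteq> 0" using U2 by metis
    then have "shift z (int t) i \<noteq> 0" using False zU positive by (simp add: shift_def)
    then show ?thesis using i(1) pure_neq[of "shift z (int t)" i k] by auto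
  qed
  show ?thesis
  proof (rule not_complete_intersection_of_corners[OF ideal_A])
    let ?z = "\<lambda>k. if k = 0 then z else pure k"
    let ?G = "\<lambda>k. if k = 0 then chain_poly z v else chain_poly (pure k) 0"
    have in_N: "k \<in> {1..N}" if "k \<le> N" "k \<noteq> 0" for k using that by auto
    fix k assume k: "k \<le> N"
    obtain i j where "i \<noteq> k" "U i \<noteq> 0" "j \<noteq> k" "W j \<noteq> 0" using U2 W2 by metis
    then have "corner A (pure k)"
      using disjoint[of k] corner_pure[of k i] corner_pure[of k j] by blast
    then show "corner A (?z k)" using z by simp
    show "?G k \<in> A" using z pure_in_A in_N k by auto
    show "coeff_at (?G k) (?z k) \<noteq> 0"
      using coeff_at_chain_poly_start[OF vec] coeff_at_pure in_N k units by auto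
    fix k' assume "k' \<le> N" "k \<noteq> k'"
    then show "coeff_at (?G k) (?z k') = 0"
      using coeff_at_chain_poly_zero[OF vec ne] in_N k ne[of 0]
      by (auto simp: coeff_at_pure pure_eq_iff)
  qed
qed

text \<open>If \<open>U\<close> is supported at \<open>y\<close> only, the power of \<open>x\<^sub>y\<close> need not be a corner, so \<open>N - 1\<close> powers are left.  But
  \<open>corner_strict\<close> can be used with two different \<open>j\<close>.  The two corners are stored at the indices \<open>0\<close> and
  \<open>y\<close>.\<close>

lemma not_ci_single_strict:
  assumes v: "1 \<le> v" and y: "\<And>i. i \<noteq> y \<Longrightarrow> U i = 0" and vU: "\<alpha> y < int v * U y"
    and prevU: "(int v - 1) * U y \<le> \<alpha> y" and vW: "\<And>i. int v * W i \<le> \<alpha> i"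
    and W2: "W w1 \<noteq> 0" "W w2 \<noteq> 0" "w1 \<noteq> w2"
  shows "\<not> quotient_complete_intersection (polynomial_ring N) A"
proof -
  define z where "z j = (\<lambda>i. if i = j then \<alpha> j + 1 else int v * W i)" for j
  have Uy: "0 < U y" "W y = 0" using positive_of_exceeds(1)[OF vU] by auto
  then have yN: "y \<in> {1..N}" using outside[of y] by force
  have "(int v - 1) * U i \<le> \<alpha> i" for i using prevU y[of i] by (cases "i = y") auto
  note strict = corner_strict[OF v vU this vW, folded z_def]
  have z_pos: "z j i \<noteq> 0" if "W i \<noteq> 0" for i j
    using that v nonneg(1)[of j] by (simp add: z_def add_nonneg_eq_0_iff)
  have z_y: "z j y = 0" if "W j \<noteq> 0" for j using that Uy by (auto simp: z_def)
  have ne_pure: "pure k \<noteq> shift (z j) (int t)" if "k \<noteq> y" "W j \<noteq> 0" for k j t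
  proof (cases "t = 0")
    case True
    obtain i where "i \<noteq> k" "W i \<noteq> 0" using W2 by metis
    then show ?thesis using True pure_neq[of "z j" i k] z_pos by auto
  next
    case False
    then have "shift (z j) (int t) y \<noteq> 0" using Uy z_y[OF that(2)] by (simp add: shift_def)
    then show ?thesis using that(1) pure_neq[of "shift (z j) (int t)" y k] by auto
  qed
  have ne_pure_z: "z j \<noteq> pure k" if "k \<noteq> y" "W j \<noteq> 0" for k j
    using ne_pure[OF that, of 0] by auto
  have ne: "z j' \<noteq> shift (z j) (int t)" if "W j \<noteq> 0" "W j' \<noteq> 0" "j \<noteq> j'" for j j' t
  proof
    assume eq: "z j' = shift (z j) (int t)"
    have "t = 0" using fun_cong[OF eq, of y] Uy z_y that by (simp add: shift_def)
    then show False using fun_cong[OF eq, of j] that vW[of j] by (simp add: z_def)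
  qed
  have zero_pure: "coeff_at (chain_poly (z j) v) (pure k) = 0" if "k \<noteq> y" "W j \<noteq> 0" for k j
    by (rule coeff_at_chain_poly_zero[OF strict(3)[OF that(2)] ne_pure[OF that]])
  have zero_z: "coeff_at (chain_poly (z j) v) (z j') = 0"
    if "W j \<noteq> 0" "W j' \<noteq> 0" "j \<noteq> j'" for j j'
    by (rule coeff_at_chain_poly_zero[OF strict(3)[OF that(1)] ne[OF that]])
  show ?thesis
  proof (rule not_complete_intersection_of_corners[OF ideal_A])
    let ?z = "\<lambda>k. if k = 0 then z w1 else if k = y then z w2 else pure k"
    let ?G = "\<lambda>k. if k = 0 then chain_poly (z w1) v else if k = y then chain_poly (z w2) v
      else chain_poly (pure k) 0"
    have in_N: "k \<in> {1..N}" if "k \<le> N" "k \<noteq> 0" for k using that by auto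
    have y0: "y \<noteq> 0" using yN by auto
    fix k assume k: "k \<le> N"
    obtain j where "j \<noteq> k" "W j \<noteq> 0" using W2 by metis
    then have "corner A (pure k)" if "k \<noteq> y"
      using y[OF that] corner_pure[of k j] by blast
    then show "corner A (?z k)" using strict(1) W2 by simp
    show "?G k \<in> A" using strict(2) W2 pure_in_A in_N k by auto
    show "coeff_at (?G k) (?z k) \<noteq> 0"
      using coeff_at_chain_poly_start[OF strict(3)] W2 coeff_at_pure in_N k units by auto
    fix k' assume "k' \<le> N" "k \<noteq> k'"
    then show "coeff_at (?G k) (?z k') = 0"
      using zero_pure[OF _ W2(1)] zero_pure[OF _ W2(2)] zero_z[OF W2] zero_z[OF W2(2,1) W2(3)[symmetric]]
        in_N k y0 ne_pure_z[OF _ W2(1)] ne_pure_z[OF _ W2(2)]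
      by (auto simp: coeff_at_pure pure_eq_iff)
  qed
qed

text \<open>Again one power is missing and two segments replace it: the one of \<open>corner_equal\<close>, read from its other end,
  and the one of \<open>corner_mixed\<close>.\<close>

lemma not_ci_single_equal:
  assumes v: "1 \<le> v" and vU: "\<alpha> u < int v * U u"
    and prevU: "\<And>i. (int v - 1) * U i \<le> \<alpha> i"
    and y: "\<And>i. i \<noteq> y \<Longrightarrow> W i = 0" and prevW: "(int v - 1) * W y \<le> \<alpha> y"
    and vW: "\<alpha> y + 1 < int v * W y"
    and U2: "U u1 \<noteq> 0" "U u2 \<noteq> 0" "u1 \<noteq> u2"
  shows "\<not> quotient_complete_intersection (polynomial_ring N) A"
proof -
  \<comment> \<open>the corner at \<open>v U\<close>, the end of the segment, is its start after exchanging the blocks\<close>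
  interpret S: binomial_system N \<alpha> W U d c by (rule swap)
  define z where "z = (\<lambda>i. int v * U i)"
  define q where "q = (\<lambda>i. if i = u1 then \<alpha> u1 + 1 - (int v - 1) * U u1
    else if i = y then \<alpha> y + 1 else 0)"
  have vW': "\<alpha> y < int v * W y" using vW by simp
  have Wy: "0 < W y" "U y = 0" using positive_of_exceeds(2)[OF vW'] by auto
  then have yN: "y \<in> {1..N}" using outside[of y] by force
  have ne_y: "u1 \<noteq> y" "u2 \<noteq> y" using U2 Wy by auto
  have prevW': "(int v - 1) * W i \<le> \<alpha> i" for i using prevW y[of i] by (cases "i = y") auto
  note equal = S.corner_equal[OF v vW' prevW' vU prevU, folded z_def,
      unfolded binomial_ann_swap[of N \<alpha> W U d c]]
  note mixed = corner_mixed[OF v prevU y prevW vW U2(1,2) U2(3)[symmetric], folded q_def]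
  have ne_z_pure: "pure k \<noteq> S.shift z (int t)" if "k \<noteq> y" for k t
  proof (cases "t = 0")
    case True
    obtain i where "i \<noteq> k" "U i \<noteq> 0" using U2 by metis
    then show ?thesis using True pure_neq[of z i k] v by (auto simp: z_def)
  next
    case False
    then have "S.shift z (int t) y \<noteq> 0" using Wy by (simp add: S.shift_def z_def)
    then show ?thesis using that pure_neq[of "S.shift z (int t)" y k] by auto
  qed
  have ne_q: "x \<noteq> shift q (int t)" if "t \<le> v - 1" "x y = 0" for x t
  proof -
    have "int t * W y \<le> (int v - 1) * W y"
      using that v by (intro mult_right_mono) auto
    then have "int t * W y \<le> \<alpha> y" using prevW by (rule order_trans)
    then have "0 < shift q (int t) y"
      using Wy ne_y by (simp add: shift_def q_def)
    then show ?thesis using that(2) by auto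
  qed
  have ne_z_q: "q \<noteq> S.shift z (int t)" for t
  proof
    assume eq: "q = S.shift z (int t)"
    have "int v * U u2 = int t * U u2"
      using fun_cong[OF eq, of u2] U2 ne_y positive by (simp add: S.shift_def q_def z_def algebra_simps)
    then have "t = v" using U2 by simp
    then have "q u1 = 0"
      using fun_cong[OF eq, of u1] U2 positive by (simp add: S.shift_def z_def algebra_simps)
    then show False using prevU[of u1] by (simp add: q_def)
  qed
  have zero_z_pure: "coeff_at (S.chain_poly z v) (pure k) = 0" if "k \<noteq> y" for k
    by (rule S.coeff_at_chain_poly_zero[OF equal(3) ne_z_pure[OF that]])
  have zero_z_q: "coeff_at (S.chain_poly z v) q = 0"
    by (rule S.coeff_at_chain_poly_zero[OF equal(3) ne_z_q])
  have zero_q: "coeff_at (chain_poly q (v - 1)) x = 0" if "x y = 0" for x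
    by (rule coeff_at_chain_poly_zero[OF mixed(3)]) (use ne_q that in blast)+
  show ?thesis
  proof (rule not_complete_intersection_of_corners[OF ideal_A])
    let ?z = "\<lambda>k. if k = 0 then z else if k = y then q else pure k"
    let ?G = "\<lambda>k. if k = 0 then S.chain_poly z v else if k = y then chain_poly q (v - 1)
      else chain_poly (pure k) 0"
    have in_N: "k \<in> {1..N}" if "k \<le> N" "k \<noteq> 0" for k using that by auto
    have y0: "y \<noteq> 0" using yN by auto
    have zy: "z y = 0" and qy: "q y \<noteq> 0"
      using Wy ne_y nonneg(1)[of y] by (auto simp: z_def q_def add_nonneg_eq_0_iff)
    have pure_y: "pure k y = 0" if "k \<noteq> y" for k using that by (simp add: pure_def)
    fix k assume k: "k \<le> N"
    obtain j where "j \<noteq> k" "U j \<noteq> 0" using U2 by metis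
    then have "corner A (pure k)" if "k \<noteq> y"
      using y[OF that] corner_pure[of k j] by blast
    then show "corner A (?z k)" using equal(1) mixed(1) by simp
    show "?G k \<in> A" using equal(2) mixed(2) pure_in_A in_N k by auto
    show "coeff_at (?G k) (?z k) \<noteq> 0"
      using S.coeff_at_chain_poly_start[OF equal(3)] coeff_at_chain_poly_start[OF mixed(3)]
        coeff_at_pure in_N k units by auto
    fix k' assume "k' \<le> N" "k \<noteq> k'"
    then show "coeff_at (?G k) (?z k') = 0"
      using zero_z_pure zero_z_q zero_q[of z, OF zy] zero_q[of "pure k'", OF pure_y]
        in_N k y0 zy qy pure_y ne_z_pure[of _ 0]
      by (auto simp: coeff_at_pure pure_eq_iff)
  qed
qed

end


section \<open>Division with remainder and nonzerodivisors\<close>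

text \<open>Division by leading monomials, where only the degree in \<open>x\<^sub>y\<close> has to drop: this degree is a natural number,
  so the reduction ends although monomials of the same degree in \<open>x\<^sub>y\<close> are not compared.\<close>

lemma remainder_exists:
  fixes f :: "'k::field mpoly"
  assumes J: "ideal J (polynomial_ring N)"
    and step: "\<And>\<mu>. keys \<mu> \<subseteq> {1..N} \<Longrightarrow> \<mu> \<notin> B \<Longrightarrow>
      \<exists>g\<in>J. lookup g \<mu> \<noteq> 0 \<and> (\<forall>\<nu>\<in>keys g. \<nu> \<noteq> \<mu> \<longrightarrow> lookup \<nu> y < lookup \<mu> y)"
    and f: "f \<in> PR N"
  shows "\<exists>r\<in>PR N. f - r \<in> J \<and> keys r \<subseteq> B"
proof -
  define P where "P f \<longleftrightarrow> (\<exists>r\<in>PR N. f - r \<in> J \<and> keys r \<subseteq> B)" for f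
  have P_0: "P 0" using ideal_0[OF J] by (auto simp: P_def intro!: bexI[of _ 0])
  have P_add: "P (f + g)" if fg: "P f" "P g" for f g
  proof -
    obtain r s where rs: "r \<in> PR N" "f - r \<in> J" "keys r \<subseteq> B"
      "s \<in> PR N" "g - s \<in> J" "keys s \<subseteq> B" using fg unfolding P_def by blast
    have "f + g - (r + s) = (f - r) + (g - s)" by simp
    then have "f + g - (r + s) \<in> J" using ideal_add[OF J rs(2,5)] by metis
    moreover have "keys (r + s) \<subseteq> B" using keys_add[of r s] rs(3,6) by blast
    ultimately show ?thesis unfolding P_def using PR_add[OF rs(1,4)] by blast
  qed
  have P_sum: "P (\<Sum>\<mu>\<in>S. F \<mu>)" if "finite S" "\<And>\<mu>. \<mu> \<in> S \<Longrightarrow> P (F \<mu>)"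
    for S :: "(nat \<Rightarrow>\<^sub>0 nat) set" and F
    using that by (induction S rule: finite_induct) (auto intro: P_0 P_add)
  have P_monom: "P (monom \<mu> c)" if "keys \<mu> \<subseteq> {1..N}" for \<mu> and c :: 'k
    using that
  proof (induction "lookup \<mu> y" arbitrary: \<mu> c rule: less_induct)
    case less
    show ?case
    proof (cases "\<mu> \<in> B")
      case True
      then show ?thesis
        using less.prems ideal_0[OF J] unfolding P_def
        by (intro bexI[of _ "monom \<mu> c"]) (auto intro!: PR_monom)
    next
      case False
      with step less.prems obtain g where g: "g \<in> J" "lookup g \<mu> \<noteq> 0"
        "\<forall>\<nu>\<in>keys g. \<nu> \<noteq> \<mu> \<longrightarrow> lookup \<nu> y < lookup \<mu> y" by blast
      have gPR: "g \<in> PR N" using g(1) ideal_subset[OF J] by blast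
      define e where "e = c / lookup g \<mu>"
      define h where "h = monom \<mu> c - monom 0 e * g"
      have hPR: "h \<in> PR N" unfolding h_def
        by (intro PR_diff PR_mult PR_monom gPR) (use less.prems in auto)
      have "lookup h \<mu> = 0" using g(2) by (simp add: h_def lookup_minus lookup_monom0_mult e_def)
      moreover have "lookup h \<nu> = - e * lookup g \<nu>" if "\<nu> \<noteq> \<mu>" for \<nu>
        using that by (simp add: h_def lookup_minus lookup_monom0_mult lookup_single_not_eq)
      ultimately have keys_h: "\<nu> \<in> keys g \<and> \<nu> \<noteq> \<mu>" if "\<nu> \<in> keys h" for \<nu>
        using that unfolding in_keys_iff by (metis mult_zero_right)
      have "P (\<Sum>\<nu>\<in>keys h. monom \<nu> (lookup h \<nu>))"
      proof (rule P_sum)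
        fix \<nu> assume "\<nu> \<in> keys h"
        then show "P (monom \<nu> (lookup h \<nu>))"
          using less.hyps keys_h g(3) hPR by (simp add: PR_iff)
      qed simp
      then have "P h" by (simp add: sum_monomials)
      then obtain r where r: "r \<in> PR N" "h - r \<in> J" "keys r \<subseteq> B" by (auto simp: P_def)
      have "monom 0 e * g \<in> J" by (rule ideal_mult[OF J _ g(1)]) (simp add: PR_monom)
      then have "(h - r) + monom 0 e * g \<in> J" using r(2) by (intro ideal_add[OF J])
      moreover have "(h - r) + monom 0 e * g = monom \<mu> c - r" by (simp add: h_def)
      ultimately show ?thesis using r by (auto simp: P_def)
    qed
  qed
  have "P (\<Sum>\<mu>\<in>keys f. monom \<mu> (lookup f \<mu>))"
    using f unfolding PR_iff by (intro P_sum P_monom) auto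
  then show ?thesis by (simp add: P_def sum_monomials)
qed

text \<open>Supplies the reduction steps for \<open>remainder_exists\<close>.\<close>

lemma leading_multiple:
  fixes p :: "'k::field mpoly"
  assumes J: "ideal J (polynomial_ring N)" and p: "p \<in> J"
    and lead: "lookup p \<mu>\<^sub>0 \<noteq> 0" "\<And>\<nu>. \<nu> \<in> keys p \<Longrightarrow> \<nu> \<noteq> \<mu>\<^sub>0 \<Longrightarrow> lookup \<nu> y < lookup \<mu>\<^sub>0 y"
    and \<mu>: "keys \<mu> \<subseteq> {1..N}" "\<And>i. lookup \<mu>\<^sub>0 i \<le> lookup \<mu> i"
  shows "\<exists>g\<in>J. lookup g \<mu> \<noteq> 0 \<and> (\<forall>\<nu>\<in>keys g. \<nu> \<noteq> \<mu> \<longrightarrow> lookup \<nu> y < lookup \<mu> y)"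
proof
  define \<kappa> where "\<kappa> = \<mu> - \<mu>\<^sub>0"
  have \<mu>_eq: "\<mu> = \<kappa> + \<mu>\<^sub>0"
    using \<mu>(2) by (simp add: \<kappa>_def poly_mapping_eq_iff fun_eq_iff lookup_add lookup_minus)
  have "keys \<kappa> \<subseteq> {1..N}" using \<mu>(1) unfolding \<mu>_eq keys_add_exponent by simp
  then show "monom \<kappa> 1 * p \<in> J" by (intro ideal_mult[OF J] PR_monom p)
  have "lookup \<nu> y < lookup \<mu> y" if \<nu>: "\<nu> \<in> keys (monom \<kappa> 1 * p)" "\<nu> \<noteq> \<mu>" for \<nu>
  proof -
    obtain a where "\<nu> = \<kappa> + a" "a \<in> keys p"
      using keys_mult[of "monom \<kappa> 1" p] \<nu>(1) by (auto split: if_splits)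
    then show ?thesis using lead(2)[of a] \<nu>(2) by (auto simp: \<mu>_eq lookup_add)
  qed
  moreover have "lookup (monom \<kappa> 1 * p) \<mu> = lookup p \<mu>\<^sub>0"
    by (simp add: lookup_monom_mult \<mu>_eq lookup_add)
  ultimately show "lookup (monom \<kappa> 1 * p) \<mu> \<noteq> 0 \<and>
      (\<forall>\<nu>\<in>keys (monom \<kappa> 1 * p). \<nu> \<noteq> \<mu> \<longrightarrow> lookup \<nu> y < lookup \<mu> y)"
    using lead(1) by simp
qed

definition power_gens :: "(nat \<Rightarrow> nat) \<Rightarrow> nat set \<Rightarrow> 'k::field mpoly set" where
  "power_gens e L = (\<lambda>l. var l ^ e l) ` L"

lemma power_gens_PR: "L \<subseteq> {1..N} \<Longrightarrow> power_gens e L \<subseteq> PR N"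
  unfolding power_gens_def by (auto intro!: PR_var_power)

lemma mem_power_ideal_iff:
  fixes f :: "'k::field mpoly"
  assumes L: "L \<subseteq> {1..N}"
  shows "f \<in> Idl_PR N (power_gens e L) \<longleftrightarrow>
    f \<in> PR N \<and> (\<forall>\<mu>\<in>keys f. \<exists>l\<in>L. e l \<le> lookup \<mu> l)"
proof
  let ?J = "{f :: 'k mpoly. f \<in> PR N \<and> (\<forall>\<mu>\<in>keys f. \<exists>l\<in>L. e l \<le> lookup \<mu> l)}"
  have "ideal ?J (polynomial_ring N)"
  proof (rule ideal_PR_I)
    fix f g :: "'k mpoly" assume f: "f \<in> ?J"
    show "f + g \<in> ?J" if "g \<in> ?J" using f that keys_add[of f g] by (auto intro: PR_add)
    show "g * f \<in> ?J" if g: "g \<in> PR N"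
    proof -
      have "\<exists>l\<in>L. e l \<le> lookup \<mu> l" if "\<mu> \<in> keys (g * f)" for \<mu>
      proof -
        obtain a b where "\<mu> = a + b" "b \<in> keys f" using keys_mult[of g f] \<open>\<mu> \<in> _\<close> by blast
        moreover from this f obtain l where "l \<in> L" "e l \<le> lookup b l" by auto
        ultimately show ?thesis by (auto simp: lookup_add intro!: bexI[of _ l])
      qed
      then show ?thesis using f g by (auto intro: PR_mult)
    qed
  qed auto
  moreover have "power_gens e L \<subseteq> ?J"
    using power_gens_PR[OF L, where e = e and ?'a = 'k] unfolding power_gens_def var_power
    by (auto intro!: bexI)
  ultimately have "Idl_PR N (power_gens e L) \<subseteq> ?J" by (rule Idl_PR_minimal)
  then show "f \<in> Idl_PR N (power_gens e L) \<Longrightarrow>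
      f \<in> PR N \<and> (\<forall>\<mu>\<in>keys f. \<exists>l\<in>L. e l \<le> lookup \<mu> l)" by blast
next
  note sub = power_gens_PR[OF L, where e = e and ?'a = 'k]
  note J = Idl_PR_ideal[OF sub]
  assume f: "f \<in> PR N \<and> (\<forall>\<mu>\<in>keys f. \<exists>l\<in>L. e l \<le> lookup \<mu> l)"
  have "monom \<mu> (lookup f \<mu>) \<in> Idl_PR N (power_gens e L)" if \<mu>: "\<mu> \<in> keys f" for \<mu>
  proof -
    obtain l where l: "l \<in> L" "e l \<le> lookup \<mu> l" using f \<mu> by blast
    define \<kappa> where "\<kappa> = \<mu> - monom l (e l)"
    have \<mu>_eq: "\<mu> = \<kappa> + monom l (e l)"
      using l(2) by (auto simp: \<kappa>_def poly_mapping_eq_iff fun_eq_iff lookup_add lookup_minus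
          lookup_single when_def)
    have "keys \<mu> \<subseteq> {1..N}" using f \<mu> by (simp add: PR_iff)
    then have "keys \<kappa> \<subseteq> {1..N}" unfolding \<mu>_eq keys_add_exponent by simp
    moreover have "(var l ^ e l :: 'k mpoly) \<in> Idl_PR N (power_gens e L)"
      by (rule Idl_PR_self[OF sub]) (use l in \<open>auto simp: power_gens_def\<close>)
    ultimately have "monom \<kappa> (lookup f \<mu>) * var l ^ e l \<in> Idl_PR N (power_gens e L)"
      by (intro ideal_mult[OF J] PR_monom)
    then show ?thesis by (simp add: var_power mult_single \<mu>_eq)
  qed
  then have "(\<Sum>\<mu>\<in>keys f. monom \<mu> (lookup f \<mu>)) \<in> Idl_PR N (power_gens e L)"
    by (rule ideal_sum[OF J])
  then show "f \<in> Idl_PR N (power_gens e L)" by (simp add: sum_monomials)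
qed

text \<open>Membership in the monomial ideal \<open>M\<close> is decided monomial by monomial and does not depend on the exponent of \<open>x\<^sub>y\<close>.
  Discard from \<open>g\<close> the monomials in \<open>M\<close>, and let \<open>\<mu>\<close> be one of the remaining \<open>S\<close> with largest degree in \<open>x\<^sub>y\<close>.  In the
  product, \<open>\<mu>\<close> times the leading monomial \<open>x\<^sub>y\<^sup>s\<close> cannot cancel, and it is not in \<open>M\<close>.\<close>

lemma monic_nonzerodivisor:
  fixes p g :: "'k::field mpoly"
  assumes L: "L \<subseteq> {1..N}" "y \<notin> L" and p: "p \<in> PR N"
    and lead: "lookup p (monom y s) \<noteq> 0"
      "\<And>\<nu>. \<nu> \<in> keys p \<Longrightarrow> \<nu> \<noteq> monom y s \<Longrightarrow> lookup \<nu> y < s"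
    and g: "g \<in> PR N" "p * g \<in> Idl_PR N (power_gens e L)"
  shows "g \<in> Idl_PR N (power_gens e L)"
proof (rule ccontr)
  let ?M = "Idl_PR N (power_gens e L) :: 'k mpoly set"
  note M = Idl_PR_ideal[OF power_gens_PR[OF L(1), where e = e and ?'a = 'k]]
  assume "g \<notin> ?M"
  define S where "S = {\<mu> \<in> keys g. \<not> (\<exists>l\<in>L. e l \<le> lookup \<mu> l)}"
  define g' where "g' = (\<Sum>\<mu>\<in>S. monom \<mu> (lookup g \<mu>))"
  have lookup_g': "lookup g' \<mu> = (if \<mu> \<in> S then lookup g \<mu> else 0)" for \<mu>
    by (simp add: g'_def lookup_sum lookup_single when_def S_def)
  have keys_g': "keys g' = S" unfolding set_eq_iff in_keys_iff lookup_g'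
    by (auto simp: S_def in_keys_iff)
  have "g' \<in> PR N" using g(1) by (auto simp: PR_iff keys_g' S_def)
  have "lookup (g - g') \<mu> = (if \<mu> \<in> S then 0 else lookup g \<mu>)" for \<mu>
    by (simp add: lookup_minus lookup_g')
  then have "keys (g - g') = keys g - S" by (simp add: set_eq_iff in_keys_iff)
  then have rest: "g - g' \<in> ?M"
    using PR_diff[OF g(1) \<open>g' \<in> PR N\<close>] by (simp add: mem_power_ideal_iff[OF L(1)] S_def)
  have "p * g - p * (g - g') \<in> ?M"
    by (rule ideal_diff[OF M g(2) ideal_mult[OF M p rest]])
  then have pg': "p * g' \<in> ?M" by (simp add: algebra_simps)
  have "S \<noteq> {}" using \<open>g \<notin> ?M\<close> g(1) by (auto simp: mem_power_ideal_iff[OF L(1)] S_def)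
  have finS: "finite S" by (simp add: S_def)
  then have "Max ((\<lambda>\<mu>. lookup \<mu> y) ` S) \<in> (\<lambda>\<mu>. lookup \<mu> y) ` S"
    using \<open>S \<noteq> {}\<close> by (intro Max_in) auto
  then obtain \<mu> where \<mu>: "\<mu> \<in> S" "lookup \<mu> y = Max ((\<lambda>\<mu>. lookup \<mu> y) ` S)" by force
  have max: "lookup \<nu> y \<le> lookup \<mu> y" if "\<nu> \<in> S" for \<nu>
    unfolding \<mu>(2) using finS that by simp
  define p' where "p' = p - monom (monom y s) (lookup p (monom y s))"
  have p': "lookup \<nu> y < s" if "\<nu> \<in> keys p'" for \<nu>
  proof (rule lead(2))
    show "\<nu> \<noteq> monom y s"
      using that by (auto simp: p'_def in_keys_iff lookup_minus)
    then show "\<nu> \<in> keys p"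
      using that by (simp add: p'_def in_keys_iff lookup_minus lookup_single_not_eq)
  qed
  have "monom y s + \<mu> \<notin> keys (p' * g')"
  proof
    assume "monom y s + \<mu> \<in> keys (p' * g')"
    then obtain a b where ab: "monom y s + \<mu> = a + b" "a \<in> keys p'" "b \<in> S"
      using keys_mult[of p' g'] keys_g' by blast
    have "s + lookup \<mu> y = lookup a y + lookup b y"
      using arg_cong[OF ab(1), of "\<lambda>\<nu>. lookup \<nu> y"] by (simp add: lookup_add)
    then show False using p'[OF ab(2)] max[OF ab(3)] by simp
  qed
  then have "lookup (p' * g') (monom y s + \<mu>) = 0" by (simp add: in_keys_iff)
  moreover have "p * g' = monom (monom y s) (lookup p (monom y s)) * g' + p' * g'"
    by (simp add: p'_def algebra_simps)
  moreover have "lookup (monom (monom y s) (lookup p (monom y s)) * g') (monom y s + \<mu>) =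
      lookup p (monom y s) * lookup g \<mu>"
    using \<mu>(1) by (simp add: lookup_monom_mult lookup_add lookup_g')
  ultimately have "monom y s + \<mu> \<in> keys (p * g')"
    using lead(1) \<mu>(1) by (simp add: in_keys_iff lookup_add S_def)
  then obtain l where "l \<in> L" "e l \<le> lookup (monom y s + \<mu>) l"
    using pg' by (auto simp: mem_power_ideal_iff[OF L(1)])
  then show False using \<mu>(1) L(2) by (auto simp: S_def lookup_add lookup_single when_def split: if_splits)
qed

lemma var_power_nonzerodivisor:
  fixes g :: "'k::field mpoly"
  assumes "L \<subseteq> {1..N}" "x \<notin> L" "x \<in> {1..N}" "g \<in> PR N" "var x ^ s * g \<in> Idl_PR N (power_gens e L)"
  shows "g \<in> Idl_PR N (power_gens e L)"
  by (rule monic_nonzerodivisor[OF assms(1,2) PR_var_power[OF assms(3), of s] _ _ assms(4,5), of s])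
    (auto simp: var_power)

lemma complete_intersection_powers_append:
  fixes ps :: "'k::field mpoly list"
  assumes ls: "distinct ls" "set ls \<subseteq> {1..N}" and ps: "set ps \<subseteq> PR N"
    and proper: "1 \<notin> Idl_PR N (power_gens e (set ls) \<union> set ps)"
    and nzd: "\<And>i g. i < length ps \<Longrightarrow> g \<in> PR N \<Longrightarrow>
      ps ! i * g \<in> Idl_PR N (power_gens e (set ls) \<union> set (take i ps)) \<Longrightarrow>
      g \<in> Idl_PR N (power_gens e (set ls) \<union> set (take i ps))"
  shows "quotient_complete_intersection (polynomial_ring N)
    (Idl_PR N (power_gens e (set ls) \<union> set ps))"
proof -
  define fs where "fs = map (\<lambda>l. var l ^ e l) ls @ ps"
  have set_fs: "set fs = power_gens e (set ls) \<union> set ps"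
    by (simp add: fs_def power_gens_def)
  have "regular_sequence (polynomial_ring N) fs"
    unfolding regular_sequence_def
  proof (intro conjI allI impI ballI)
    show "set fs \<subseteq> PR N" using power_gens_PR[OF ls(2)] ps by (simp add: set_fs)
    show "Idl_PR N (set fs) \<noteq> PR N" using proper PR_1 unfolding set_fs by metis
    fix i g assume i: "i < length fs" and g: "g \<in> PR N"
      and fg: "fs ! i \<otimes>\<^bsub>polynomial_ring N\<^esub> g \<in> Idl_PR N (set (take i fs))"
    show "g \<in> Idl_PR N (set (take i fs))"
    proof (cases "i < length ls")
      case True
      then have take: "set (take i fs) = power_gens e (set (take i ls))"
        by (simp add: fs_def power_gens_def take_map)
      have "ls ! i \<notin> set (take i ls)"
        using ls(1) True by (auto simp: in_set_conv_nth nth_eq_iff_index_eq)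
      moreover have "ls ! i \<in> {1..N}" using ls(2) True nth_mem by blast
      moreover have "set (take i ls) \<subseteq> {1..N}" using ls(2) set_take_subset by fast
      moreover have "fs ! i = var (ls ! i) ^ e (ls ! i)"
        using True by (simp add: fs_def nth_append)
      ultimately show ?thesis
        using var_power_nonzerodivisor[OF _ _ _ g] fg unfolding take by simp
    next
      case False
      then have "set (take i fs) = power_gens e (set ls) \<union> set (take (i - length ls) ps)"
        by (simp add: fs_def power_gens_def)
      moreover have "fs ! i = ps ! (i - length ls)" using False by (simp add: fs_def nth_append)
      moreover have "i - length ls < length ps" using i False by (auto simp: fs_def)
      ultimately show ?thesis using nzd g fg by simp
    qed
  qed
  then show ?thesis unfolding quotient_complete_intersection_def set_fs[symmetric] by blast
qed

text \<open>If \<open>X, p\<close> is regular modulo \<open>S\<close>, then \<open>X\<close> is also a nonzerodivisor modulo \<open>p\<close> and \<open>S\<close>: in a relation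
  \<open>X g = h p + m\<close> the factor \<open>h\<close> is a multiple of \<open>X\<close> modulo \<open>S\<close>, and \<open>X\<close> can be cancelled.  As \<open>X\<close> is
  a multiple of \<open>q\<close> modulo \<open>p\<close>, the same holds for \<open>q\<close>.\<close>

lemma nonzerodivisor_of_relation:
  fixes p q X :: "'k::field mpoly"
  assumes S: "S \<subseteq> PR N" and PR: "p \<in> PR N" "q \<in> PR N" "X \<in> PR N"
    and X_nzd: "\<And>g. g \<in> PR N \<Longrightarrow> X * g \<in> Idl_PR N S \<Longrightarrow> g \<in> Idl_PR N S"
    and p_nzd: "\<And>g. g \<in> PR N \<Longrightarrow> p * g \<in> Idl_PR N (insert X S) \<Longrightarrow> g \<in> Idl_PR N (insert X S)"
    and rel: "X = g1 * p + g2 * q" "g1 \<in> PR N" "g2 \<in> PR N"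
    and g: "g \<in> PR N" "q * g \<in> Idl_PR N (insert p S)"
  shows "g \<in> Idl_PR N (insert p S)"
proof -
  have sub: "insert p S \<subseteq> PR N" "insert X S \<subseteq> PR N" using S PR by auto
  note M = Idl_PR_ideal[OF S] and Mp = Idl_PR_ideal[OF sub(1)] and MX = Idl_PR_ideal[OF sub(2)]
  have pMp: "p \<in> Idl_PR N (insert p S)" by (rule Idl_PR_self[OF sub(1)]) simp
  have XMX: "X \<in> Idl_PR N (insert X S)" by (rule Idl_PR_self[OF sub(2)]) simp
  have M_Mp: "Idl_PR N S \<subseteq> Idl_PR N (insert p S)" by (rule Idl_PR_mono[OF _ sub(1)]) auto
  have M_MX: "Idl_PR N S \<subseteq> Idl_PR N (insert X S)" by (rule Idl_PR_mono[OF _ sub(2)]) auto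
  have "X * g = (g1 * g) * p + g2 * (q * g)" by (simp add: rel(1) algebra_simps)
  also have "\<dots> \<in> Idl_PR N (insert p S)"
    by (intro ideal_add[OF Mp] ideal_mult[OF Mp] PR_mult rel g pMp)
  finally have "X * g \<in> Idl_PR N (insert p S)" .
  from Idl_PR_insertE[OF PR(1) S this]
  obtain h m where h: "h \<in> PR N" "m \<in> Idl_PR N S" "X * g = h * p + m" .
  have "p * h = g * X - m" using h(3) by (simp add: algebra_simps)
  also have "\<dots> \<in> Idl_PR N (insert X S)"
    by (intro ideal_diff[OF MX] ideal_mult[OF MX] g XMX) (use h(2) M_MX in blast)
  finally have "h \<in> Idl_PR N (insert X S)" by (rule p_nzd[OF h(1)])
  from Idl_PR_insertE[OF PR(3) S this]
  obtain h' m' where h': "h' \<in> PR N" "m' \<in> Idl_PR N S" "h = h' * X + m'" .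
  have "X * (g - h' * p) = p * m' + m" using h(3) h'(3) by (simp add: algebra_simps)
  also have "\<dots> \<in> Idl_PR N S" by (intro ideal_add[OF M] ideal_mult[OF M] PR h h')
  finally have "g - h' * p \<in> Idl_PR N S"
    by (rule X_nzd[rotated]) (intro PR_diff PR_mult g(1) h'(1) PR(1))
  then have "(g - h' * p) + h' * p \<in> Idl_PR N (insert p S)"
    using M_Mp by (intro ideal_add[OF Mp] ideal_mult[OF Mp h'(1) pMp]) blast
  then show ?thesis by simp
qed


context binomial_system
begin

section \<open>Generators of the annihilator\<close>

lemma one_notin_A: "1 \<notin> A"
proof
  assume one: "1 \<in> A"
  obtain u where "U u \<noteq> 0" using supports by blast
  then have "shift (ivec 0) (-1) u < 0" using positive by (simp add: shift_def)
  then have "coeff_at 1 (ivec 0) = (0 :: 'k)"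
    by (rule step_zero[OF one, rotated]) (simp add: below_top_def)
  then show False unfolding coeff_at_ivec by simp
qed

text \<open>If the coefficients outside the region of the recurrence vanish, then going down along the line from
  any point ends outside the region or at a negative entry.\<close>

lemma zero_if_supported_below_top:
  assumes r: "r \<in> A" and supp: "\<And>z. \<not> below_top z \<Longrightarrow> coeff_at r z = 0"
  shows "r = 0"
proof (rule poly_zeroI)
  obtain u where u: "U u \<noteq> 0" using supports by blast
  fix z show "coeff_at r z = 0"
  proof (induction "nat (z u)" arbitrary: z rule: less_induct)
    case less
    show ?case
    proof (cases "below_top z \<and> 0 \<le> z u")
      case False
      then show ?thesis using supp coeff_at_negative[of z u r] by auto
    next
      case True
      have "coeff_at r (shift z (-1)) = 0"
      proof (cases "shift z (-1) u < 0")
        case False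
        then have "nat (shift z (-1) u) < nat (z u)"
          using positive[of u] u by (simp add: shift_def)
        then show ?thesis by (rule less)
      qed (rule coeff_at_negative)
      then show ?thesis using A_recurrence[OF r, of z] True units by simp
    qed
  qed
qed

text \<open>The remainder of an element of \<open>A\<close> modulo \<open>J\<close> is again in \<open>A\<close>, as \<open>J \<subseteq> A\<close>; so it is enough that \<open>A\<close>
  has no nonzero remainders.\<close>

lemma eq_A_I:
  assumes J: "ideal J (polynomial_ring N)" "J \<subseteq> A"
    and step: "\<And>\<mu>. keys \<mu> \<subseteq> {1..N} \<Longrightarrow> \<mu> \<notin> B \<Longrightarrow>
      \<exists>g\<in>J. lookup g \<mu> \<noteq> 0 \<and> (\<forall>\<nu>\<in>keys g. \<nu> \<noteq> \<mu> \<longrightarrow> lookup \<nu> y < lookup \<mu> y)"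
    and zero: "\<And>r. r \<in> A \<Longrightarrow> keys r \<subseteq> B \<Longrightarrow> r = 0"
  shows "A = J"
proof
  show "A \<subseteq> J"
  proof
    fix f assume f: "f \<in> A"
    then have "f \<in> PR N" by (simp add: A_iff)
    from remainder_exists[OF J(1) step this] obtain r where
      r: "r \<in> PR N" "f - r \<in> J" "keys r \<subseteq> B" by blast
    have "f - r \<in> A" using r(2) J(2) by blast
    then have "f - (f - r) \<in> A" by (rule ideal_diff[OF ideal_A f])
    then have "r = 0" using zero[of r] r(3) by simp
    then show "f \<in> J" using r(2) by simp
  qed
qed (rule J(2))

lemma power_in_A:
  assumes l: "l \<in> {1..N}" and e: "\<alpha> l + U l < int e" "\<alpha> l + W l < int e"
  shows "var l ^ e \<in> A"
proof -
  have "chain_poly (ivec (monom l e)) 0 \<in> A"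
  proof (rule chain_poly_in_A)
    show "exponent_vector N (shift (ivec (monom l e)) (int i))" if "i \<le> 0" for i
      using that l by (simp add: exponent_vector_ivec)
    show "\<not> below_top (ivec (monom l e))"
      unfolding below_top_def not_all
      by (rule exI[of _ l]) (use e in \<open>simp add: ivec_single\<close>)
    show "\<not> below_top (shift (ivec (monom l e)) (int 0 + 1))"
      unfolding below_top_def not_all
      by (rule exI[of _ l]) (use e in \<open>simp add: ivec_single shift_def\<close>)
  qed
  then show ?thesis by (simp add: chain_poly_def var_power)
qed

lemma lookup_chain_poly_start:
  assumes "\<And>i. i \<le> s \<Longrightarrow> exponent_vector N (shift z (int i))" "z = ivec \<mu>"
  shows "lookup (chain_poly z s) \<mu> = c ^ s"
  using coeff_at_chain_poly_start[OF assms(1)] coeff_at_ivec[of "chain_poly z s" \<mu>] assms(2) by simp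

lemma keys_chain_poly:
  assumes vec: "\<And>i. i \<le> s \<Longrightarrow> exponent_vector N (shift z (int i))"
    and \<nu>: "\<nu> \<in> keys (chain_poly z s)"
  obtains t where "t \<le> s" "ivec \<nu> = shift z (int t)"
proof -
  have "coeff_at (chain_poly z s) (ivec \<nu>) \<noteq> 0" using \<nu> by (simp add: in_keys_iff)
  then show ?thesis using coeff_at_chain_poly_zero[OF vec, of s "ivec \<nu>"] that by blast
qed

lemma chain_poly_leading:
  assumes vec: "\<And>i. i \<le> s \<Longrightarrow> exponent_vector N (shift z (int i))"
    and z: "z = ivec \<mu>" and y: "W y \<noteq> 0"
    and \<nu>: "\<nu> \<in> keys (chain_poly z s)" "\<nu> \<noteq> \<mu>"
  shows "lookup \<nu> y < lookup \<mu> y"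
proof -
  obtain t where t: "t \<le> s" "ivec \<nu> = shift z (int t)" using keys_chain_poly[OF vec \<nu>(1)] .
  have "t \<noteq> 0"
  proof
    assume "t = 0"
    then show False using t(2) \<nu>(2) z by simp
  qed
  moreover have "int (lookup \<nu> y) = int (lookup \<mu> y) - int t * W y"
    using fun_cong[OF t(2), of y] y positive by (simp add: z shift_def ivec_def)
  moreover have "0 < int t * W y" using \<open>t \<noteq> 0\<close> y positive(2)[of y] by simp
  ultimately show ?thesis by linarith
qed

lemma chain_poly_PR:
  assumes "\<And>i. i \<le> s \<Longrightarrow> exponent_vector N (shift z (int i))"
  shows "chain_poly z s \<in> PR N"
  unfolding chain_poly_def
  by (intro PR_sum PR_monom)
    (simp add: ivec_expo[OF assms] assms del: One_nat_def flip: exponent_vector_ivec)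

text \<open>The chain polynomial is monic in \<open>x\<^sub>y\<close> of degree \<open>\<alpha> y + 1\<close>.  Together with the powers of the
  other variables its leading monomial leaves exactly the divisors of \<open>x\<^bsup>\<alpha>+U\<^esup>\<close> as remainders, which is
  the region of the recurrence.\<close>

lemma generators_long_second:
  assumes y: "U y = 0" "\<And>i. i \<noteq> y \<Longrightarrow> W i = 0"
    and vU: "\<alpha> u < int v * U u" and vW: "int v * W y \<le> \<alpha> y + 1"
  defines "z \<equiv> (\<lambda>i. if i = y then \<alpha> y + 1 else 0)"
    and "e \<equiv> (\<lambda>l. nat (\<alpha> l + U l) + 1)" and "L \<equiv> {1..N} - {y}"
  shows "A = Idl_PR N (power_gens e L \<union> {chain_poly z v})"
    and "quotient_complete_intersection (polynomial_ring N) A"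
proof -
  let ?p = "chain_poly z v"
  have Wy: "0 < W y" using supports(2) y(2) positive by metis
  have yN: "y \<in> {1..N}" using outside[of y] Wy by force
  have U_u: "0 < U u" "W u = 0" "u \<noteq> y" using positive_of_exceeds(1)[OF vU] y by auto
  have vec: "exponent_vector N (shift z (int t))" if "t \<le> v" for t
    unfolding exponent_vector_def
  proof (intro conjI allI impI)
    fix i
    have "int t * W y \<le> int v * W y" using that by (intro mult_right_mono) auto
    then have "int t * W y \<le> \<alpha> y + 1" using vW by (rule order_trans)
    then show "0 \<le> shift z (int t) i" using y by (simp add: shift_def z_def)
  next
    fix i assume "i \<notin> {1..N}"
    then show "shift z (int t) i = 0" using outside[of i] yN by (auto simp: shift_def z_def)
  qed
  define \<mu>\<^sub>0 where "\<mu>\<^sub>0 = monom y (nat (\<alpha> y + 1))"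
  have z_eq: "z = ivec \<mu>\<^sub>0" by (auto simp: \<mu>\<^sub>0_def ivec_single z_def fun_eq_iff)
  have lead: "lookup ?p \<mu>\<^sub>0 \<noteq> 0"
    using lookup_chain_poly_start[OF vec z_eq] units by simp
  note lower = chain_poly_leading[OF vec z_eq Wy[THEN less_imp_neq, symmetric]]
  have L: "L \<subseteq> {1..N}" "y \<notin> L" by (auto simp: L_def)
  have sub: "power_gens e L \<union> {?p} \<subseteq> PR N"
    using power_gens_PR[OF L(1)] chain_poly_PR[OF vec] by auto
  let ?J = "Idl_PR N (power_gens e L \<union> {?p})"
  note J = Idl_PR_ideal[OF sub]
  have p_A: "?p \<in> A"
  proof (rule chain_poly_in_A[OF vec])
    show "\<not> below_top z"
      unfolding below_top_def not_all by (rule exI[of _ y]) (simp add: z_def y)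
    show "\<not> below_top (shift z (int v + 1))"
      unfolding below_top_def not_all
      by (rule exI[of _ u]) (use vU U_u in \<open>simp add: z_def shift_def algebra_simps\<close>)
  qed
  have pow_J: "var l ^ e l \<in> ?J" if "l \<in> L" for l
    by (rule Idl_PR_self[OF sub]) (use that in \<open>auto simp: power_gens_def\<close>)
  have p_J: "?p \<in> ?J" by (rule Idl_PR_self[OF sub]) simp
  show A_eq: "A = ?J"
  proof (rule eq_A_I[OF J, where y = y and B = "{\<mu>. below_top (ivec \<mu>)}"])
    show "?J \<subseteq> A"
    proof (rule Idl_PR_minimal[OF ideal_A])
      have "var l ^ e l \<in> A" if "l \<in> L" for l
      proof -
        have "0 < 1 + U l" using nonneg(2)[of l] by linarith
        then show ?thesis
          using that y(2)[of l] by (intro power_in_A) (auto simp: L_def e_def)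
      qed
      then show "power_gens e L \<union> {?p} \<subseteq> A" using p_A by (auto simp: power_gens_def)
    qed
  next
    fix \<mu> assume \<mu>: "keys \<mu> \<subseteq> {1..N}" "\<mu> \<notin> {\<mu>. below_top (ivec \<mu>)}"
    then obtain i where i: "\<alpha> i + U i < int (lookup \<mu> i)"
      by (auto simp: below_top_def ivec_def not_le)
    then have "0 < int (lookup \<mu> i)" using nonneg(1,2)[of i] by linarith
    then have iN: "i \<in> {1..N}" using \<mu>(1) by (auto simp: in_keys_iff subset_iff)
    let ?goal = "\<exists>g\<in>?J. lookup g \<mu> \<noteq> 0 \<and>
      (\<forall>\<nu>\<in>keys g. \<nu> \<noteq> \<mu> \<longrightarrow> lookup \<nu> y < lookup \<mu> y)"
    have power: ?goal if "var l ^ s \<in> ?J" "s \<le> lookup \<mu> l" for l s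
      by (rule leading_multiple[OF J that(1), where \<mu>\<^sub>0 = "monom l s"])
        (use \<mu>(1) that(2) in \<open>auto simp: var_power lookup_single when_def\<close>)
    show ?goal
    proof (cases "i = y")
      case True
      have "lookup \<mu>\<^sub>0 j \<le> lookup \<mu> j" for j
        using i True y by (auto simp: \<mu>\<^sub>0_def lookup_single when_def)
      then show ?thesis by (intro leading_multiple[OF J p_J lead lower \<mu>(1)])
    next
      case False
      then have "i \<in> L" using iN by (simp add: L_def)
      moreover have "e i \<le> lookup \<mu> i" using i by (simp add: e_def nat_less_iff Suc_le_eq)
      ultimately show ?thesis by (intro power[OF pow_J])
    qed
  next
    fix r assume r: "r \<in> A" "keys r \<subseteq> {\<mu>. below_top (ivec \<mu>)}"
    show "r = 0"
    proof (rule zero_if_supported_below_top[OF r(1)])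
      fix z assume z: "\<not> below_top z"
      show "coeff_at r z = 0"
      proof (rule ccontr)
        assume nz: "coeff_at r z \<noteq> 0"
        then obtain \<mu> where "z = ivec \<mu>" by (auto simp: coeff_at_def split: if_splits)
        then show False using nz r(2) z by (auto simp: in_keys_iff)
      qed
    qed
  qed
  obtain ls where ls: "set ls = L" "distinct ls"
    using finite_distinct_list[of L] by (auto simp: L_def)
  have "quotient_complete_intersection (polynomial_ring N)
      (Idl_PR N (power_gens e (set ls) \<union> set [?p]))"
  proof (rule complete_intersection_powers_append[OF ls(2)])
    show "1 \<notin> Idl_PR N (power_gens e (set ls) \<union> set [?p])"
      using one_notin_A A_eq ls(1) by simp
    fix i g assume i: "i < length [?p]" and g: "g \<in> PR N"
      "[?p] ! i * g \<in> Idl_PR N (power_gens e (set ls) \<union> set (take i [?p]))"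
    have "g \<in> Idl_PR N (power_gens e L)"
    proof (rule monic_nonzerodivisor[OF L _ _ _ g(1), where p = ?p])
      show "lookup ?p (monom y (nat (\<alpha> y + 1))) \<noteq> 0" using lead by (simp add: \<mu>\<^sub>0_def)
      show "lookup \<nu> y < nat (\<alpha> y + 1)"
        if "\<nu> \<in> keys ?p" "\<nu> \<noteq> monom y (nat (\<alpha> y + 1))" for \<nu>
        using lower[where \<nu> = \<nu>] that by (simp add: \<mu>\<^sub>0_def)
    qed (use i g(2) ls sub in auto)
    then show "g \<in> Idl_PR N (power_gens e (set ls) \<union> set (take i [?p]))" using i ls by simp
  qed (use ls L sub in auto)
  then show "quotient_complete_intersection (polynomial_ring N) A"
    using A_eq ls(1) by simp
qed

lemma chain_poly_Suc:
  "chain_poly z (Suc s) =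
     monom 0 c * chain_poly z s + monom (expo (shift z (int (Suc s)))) (d ^ Suc s)"
  unfolding chain_poly_def sum_distrib_left
  by (simp add: mult_single Suc_diff_le mult.assoc cong: sum.cong_simp)

lemma monom_mult_chain_poly:
  assumes vec: "\<And>i. i \<le> s \<Longrightarrow> exponent_vector N (shift z (int i))" and \<kappa>: "keys \<kappa> \<subseteq> {1..N}"
  shows "monom \<kappa> 1 * chain_poly z s = chain_poly (\<lambda>i. z i + ivec \<kappa> i) s"
proof -
  have "\<kappa> + expo (shift z (int t)) = expo (shift (\<lambda>i. z i + ivec \<kappa> i) (int t))"
    if t: "t \<le> s" for t
  proof -
    have "ivec (\<kappa> + expo (shift z (int t))) = shift (\<lambda>i. z i + ivec \<kappa> i) (int t)"
      unfolding ivec_add ivec_expo[OF vec[OF t]] by (simp add: shift_def fun_eq_iff)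
    then show ?thesis by (metis expo_ivec)
  qed
  then show ?thesis
    by (simp add: chain_poly_def sum_distrib_left mult_single cong: sum.cong_simp)
qed

end


context binomial_system
begin

text \<open>Let \<open>p\<close>, \<open>q\<close> be the two chain polynomials.  Up to constants, \<open>p\<close> times \<open>x\<^sub>x\<^bsup>\<alpha>'\<^esup>\<close> and \<open>q\<close> times a power of \<open>x\<^sub>y\<close>
  are segments with the same start, and differ only by the last point of the first one, which is the
  power \<open>x\<^sub>x\<^sup>E\<close>.  So this power lies in the ideal, and its exponent \<open>E = \<alpha> x + U x + 1\<close> bounds the remainders.  The
  relation also makes \<open>q\<close> a nonzerodivisor modulo \<open>p\<close> and the other powers.

  The leading monomials \<open>x\<^sub>y\<^bsup>v W y\<^esup>\<close> of \<open>p\<close>, \<open>x\<^sub>x\<^bsup>\<alpha>'\<^esup> x\<^sub>y\<^bsup>\<alpha> y + 1\<^esup>\<close> of \<open>q\<close> and \<open>x\<^sub>x\<^sup>E\<close> leave an L-shaped set \<open>B\<close>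
  of remainders, which exceeds the region of the recurrence by the points with \<open>z x < \<alpha>'\<close> and
  \<open>\<alpha> y < z y < v W y\<close>.  From these, \<open>v\<close> steps up stay in the region and end with a negative entry at \<open>y\<close>.\<close>

lemma generators_equal:
  assumes x: "\<And>i. i \<noteq> x \<Longrightarrow> U i = 0" and y: "\<And>i. i \<noteq> y \<Longrightarrow> W i = 0"
    and v: "1 \<le> v" and vU: "\<alpha> x < int v * U x" and prevU: "(int v - 1) * U x \<le> \<alpha> x"
    and vW: "\<alpha> y < int v * W y" and prevW: "(int v - 1) * W y \<le> \<alpha> y"
  defines "z \<equiv> (\<lambda>i. int v * W i)"
    and "q\<^sub>0 \<equiv> (\<lambda>i. if i = x then \<alpha> x + 1 - (int v - 1) * U x else if i = y then \<alpha> y + 1 else 0)"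
    and "e \<equiv> (\<lambda>l. nat (\<alpha> l) + 1)" and "L \<equiv> {1..N} - {x, y}"
  shows "A = Idl_PR N (power_gens e L \<union> {chain_poly z v, chain_poly q\<^sub>0 (v - 1)})"
    and "quotient_complete_intersection (polynomial_ring N) A"
proof -
  let ?p = "chain_poly z v" and ?q = "chain_poly q\<^sub>0 (v - 1)"
  have Ux: "0 < U x" "W x = 0" using positive_of_exceeds(1)[OF vU] by auto
  have Wy: "0 < W y" "U y = 0" using positive_of_exceeds(2)[OF vW] by auto
  have ne: "x \<noteq> y" using Ux Wy by auto
  have xyN: "x \<in> {1..N}" "y \<in> {1..N}" using outside Ux Wy by force+
  have prevU': "(int v - 1) * U i \<le> \<alpha> i" for i using prevU x[of i] by (cases "i = x") auto
  have prevW': "(int v - 1) * W i \<le> \<alpha> i" for i using prevW y[of i] by (cases "i = y") auto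
  note equal = corner_equal(2,3)[OF v vU prevU' vW prevW', folded z_def]
  have mixed: "?q \<in> A" "\<And>i. i \<le> v - 1 \<Longrightarrow> exponent_vector N (shift q\<^sub>0 (int i))"
    using mixed_chain[OF v prevU y prevW, folded q\<^sub>0_def] Ux Wy by auto
  have L: "L \<subseteq> {1..N}" "x \<notin> L" "y \<notin> L" by (auto simp: L_def)
  have pq_PR: "?p \<in> PR N" "?q \<in> PR N"
    using chain_poly_PR[OF equal(2)] chain_poly_PR[OF mixed(2)] by auto
  have sub: "power_gens e L \<union> {?p, ?q} \<subseteq> PR N"
    using power_gens_PR[OF L(1)] pq_PR by auto
  let ?J = "Idl_PR N (power_gens e L \<union> {?p, ?q})"
  note J = Idl_PR_ideal[OF sub]
  have pow_J: "var l ^ e l \<in> ?J" if "l \<in> L" for l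
    by (rule Idl_PR_self[OF sub]) (use that in \<open>auto simp: power_gens_def\<close>)
  have p_J: "?p \<in> ?J" and q_J: "?q \<in> ?J" by (rule Idl_PR_self[OF sub]; simp)+

  define E where "E = nat (\<alpha> x + U x) + 1"
  define \<alpha>' where "\<alpha>' = nat (\<alpha> x + 1 - (int v - 1) * U x)"
  have \<alpha>': "int \<alpha>' = \<alpha> x + 1 - (int v - 1) * U x" using prevU by (simp add: \<alpha>'_def)
  define k where "k = nat (int v * W y - (\<alpha> y + 1))"
  have k: "int k = int v * W y - (\<alpha> y + 1)" using vW by (simp add: k_def)
  define g1 :: "'k mpoly" where "g1 = monom 0 (inverse (d ^ v)) * monom (monom x \<alpha>') 1"
  define g2 :: "'k mpoly" where "g2 = - (monom 0 (inverse (d ^ v) * c) * monom (monom y k) 1)"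
  have g_PR: "g1 \<in> PR N" "g2 \<in> PR N"
    unfolding g1_def g2_def using xyN by (auto intro!: PR_uminus PR_mult PR_monom split: if_splits)
  have rel: "var x ^ E = g1 * ?p + g2 * ?q"
  proof -
    have vS: "v = Suc (v - 1)" using v by simp
    have keys_xy: "keys (monom x \<alpha>') \<subseteq> {1..N}" "keys (monom y k) \<subseteq> {1..N}"
      using xyN by auto
    let ?z' = "\<lambda>i. z i + ivec (monom x \<alpha>') i"
    have z'_eq: "?z' = (\<lambda>i. q\<^sub>0 i + ivec (monom y k) i)"
      using ne Ux y by (auto simp: z_def q\<^sub>0_def ivec_single fun_eq_iff k \<alpha>')
    have end_eq: "shift ?z' (int v) = ivec (monom x E)"
    proof
      fix i show "shift ?z' (int v) i = ivec (monom x E) i"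
        using x[of i] Ux by (simp add: shift_def z_def ivec_single \<alpha>' E_def algebra_simps)
    qed
    have "chain_poly ?z' v = monom 0 c * chain_poly ?z' (v - 1) + monom (monom x E) (d ^ v)"
      using chain_poly_Suc[of ?z' "v - 1"]
      unfolding vS[symmetric] end_eq expo_ivec .
    moreover have "monom (monom x \<alpha>') 1 * ?p = chain_poly ?z' v"
      using equal(2) keys_xy(1) by (rule monom_mult_chain_poly)
    moreover have "monom (monom y k) 1 * ?q = chain_poly ?z' (v - 1)"
      unfolding z'_eq using mixed(2) keys_xy(2) by (rule monom_mult_chain_poly)
    ultimately have "monom (monom x \<alpha>') 1 * ?p =
        monom 0 c * (monom (monom y k) 1 * ?q) + monom (monom x E) (d ^ v)" by simp
    then have diff: "monom (monom x \<alpha>') 1 * ?p - monom 0 c * (monom (monom y k) 1 * ?q) =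
        monom (monom x E) (d ^ v)" by simp
    have "g1 * ?p + g2 * ?q = monom 0 (inverse (d ^ v)) *
        (monom (monom x \<alpha>') 1 * ?p - monom 0 c * (monom (monom y k) 1 * ?q))"
      by (simp add: g1_def g2_def right_diff_distrib mult_single flip: mult.assoc)
    then have "g1 * ?p + g2 * ?q = monom 0 (inverse (d ^ v)) * monom (monom x E) (d ^ v)"
      unfolding diff .
    then show ?thesis using units by (simp add: mult_single var_power)
  qed
  have X_J: "var x ^ E \<in> ?J"
    unfolding rel by (intro ideal_add[OF J] ideal_mult[OF J] g_PR p_J q_J)

  define \<mu>p where "\<mu>p = monom y (nat (int v * W y))"
  have z_eq: "z = ivec \<mu>p" using y Wy by (auto simp: \<mu>p_def ivec_single z_def fun_eq_iff)
  define \<mu>q where "\<mu>q = monom x \<alpha>' + monom y (nat (\<alpha> y + 1))"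
  have q_eq: "q\<^sub>0 = ivec \<mu>q"
    using ne by (auto simp: \<mu>q_def ivec_add ivec_single q\<^sub>0_def fun_eq_iff \<alpha>')
  have lead: "lookup ?p \<mu>p \<noteq> 0" "lookup ?q \<mu>q \<noteq> 0"
    using lookup_chain_poly_start[OF equal(2) z_eq] lookup_chain_poly_start[OF mixed(2) q_eq] units
    by simp_all
  note lower_p = chain_poly_leading[OF equal(2) z_eq Wy(1)[THEN less_imp_neq, symmetric]]
  note lower_q = chain_poly_leading[OF mixed(2) q_eq Wy(1)[THEN less_imp_neq, symmetric]]

  define B where "B = {\<mu>. (\<forall>l. l \<noteq> x \<longrightarrow> l \<noteq> y \<longrightarrow> int (lookup \<mu> l) \<le> \<alpha> l) \<and>
    int (lookup \<mu> x) \<le> \<alpha> x + U x \<and> int (lookup \<mu> y) < int v * W y \<and>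
    (\<alpha>' \<le> lookup \<mu> x \<longrightarrow> int (lookup \<mu> y) \<le> \<alpha> y)}"
  show A_eq: "A = ?J"
  proof (rule eq_A_I[OF J, where y = y and B = B])
    show "?J \<subseteq> A"
    proof (rule Idl_PR_minimal[OF ideal_A])
      have "var l ^ e l \<in> A" if "l \<in> L" for l
        using that x[of l] y[of l] by (intro power_in_A) (auto simp: L_def e_def)
      then show "power_gens e L \<union> {?p, ?q} \<subseteq> A"
        using equal(1) mixed(1) by (auto simp: power_gens_def)
    qed
  next
    fix \<mu> assume \<mu>: "keys \<mu> \<subseteq> {1..N}" "\<mu> \<notin> B"
    let ?goal = "\<exists>g\<in>?J. lookup g \<mu> \<noteq> 0 \<and>
      (\<forall>\<nu>\<in>keys g. \<nu> \<noteq> \<mu> \<longrightarrow> lookup \<nu> y < lookup \<mu> y)"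
    have power: ?goal if "var l ^ s \<in> ?J" "s \<le> lookup \<mu> l" for l s
      by (rule leading_multiple[OF J that(1), where \<mu>\<^sub>0 = "monom l s"])
        (use \<mu>(1) that(2) in \<open>auto simp: var_power lookup_single when_def\<close>)
    consider l where "l \<noteq> x" "l \<noteq> y" "\<alpha> l < int (lookup \<mu> l)"
      | "\<alpha> x + U x < int (lookup \<mu> x)"
      | "int v * W y \<le> int (lookup \<mu> y)"
      | "\<alpha>' \<le> lookup \<mu> x" "\<alpha> y < int (lookup \<mu> y)"
      using \<mu>(2) unfolding B_def by force
    then show ?goal
    proof cases
      case (1 l)
      then have "0 < int (lookup \<mu> l)" using nonneg(1)[of l] by linarith
      then have "l \<in> {1..N}" using \<mu>(1) by (auto simp: in_keys_iff subset_iff)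
      then have "l \<in> L" using 1 by (simp add: L_def)
      then show ?thesis using 1 by (intro power[OF pow_J]) (auto simp: e_def nat_less_iff Suc_le_eq)
    next
      case 2
      then show ?thesis by (intro power[OF X_J]) (auto simp: E_def nat_less_iff Suc_le_eq)
    next
      case 3
      have "lookup \<mu>p i \<le> lookup \<mu> i" for i
        using 3 by (auto simp: \<mu>p_def lookup_single when_def)
      then show ?thesis by (intro leading_multiple[OF J p_J lead(1) lower_p \<mu>(1)])
    next
      case 4
      have "lookup \<mu>q i \<le> lookup \<mu> i" for i
        using 4 ne by (auto simp: \<mu>q_def lookup_add lookup_single when_def)
      then show ?thesis by (intro leading_multiple[OF J q_J lead(2) lower_q \<mu>(1)])
    qed
  next
    fix r assume r: "r \<in> A" "keys r \<subseteq> B"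
    show "r = 0"
    proof (rule zero_if_supported_below_top[OF r(1)])
      fix z assume z: "\<not> below_top z"
      show "coeff_at r z = 0"
      proof (rule ccontr)
        assume nz: "coeff_at r z \<noteq> 0"
        then obtain \<mu> where z_\<mu>: "z = ivec \<mu>" by (auto simp: coeff_at_def split: if_splits)
        then have "\<mu> \<in> keys r" using nz by (simp add: in_keys_iff)
        then have \<mu>: "\<mu> \<in> B" using r(2) by blast
        then have others: "z l \<le> \<alpha> l" if "l \<noteq> x" "l \<noteq> y" for l
          using that by (simp add: B_def z_\<mu> ivec_def)
        obtain i where "\<alpha> i + U i < z i" using z by (auto simp: below_top_def not_le)
        moreover have "z x \<le> \<alpha> x + U x" using \<mu> by (simp add: B_def z_\<mu> ivec_def)
        moreover have "i = x \<or> i = y" using calculation(1) others[of i] nonneg(2)[of i] by linarith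
        ultimately have "i = y" "\<alpha> y < z y" using Wy by auto
        then have zx: "z x < int \<alpha>'" and zy: "z y < int v * W y"
          using \<mu> Wy by (auto simp: B_def z_\<mu> ivec_def)
        \<comment> \<open>\<open>z\<close> is in the part of \<open>B\<close> outside the region of the recurrence\<close>
        have "coeff_at r z = 0"
        proof (rule chain_zero[OF r(1), where s = v])
          show "coeff_at r (shift z (int v)) = 0"
            by (rule coeff_at_negative[of _ y]) (use zy Wy in \<open>simp add: shift_def\<close>)
          fix t assume t: "1 \<le> t" "t \<le> v"
          have "int t * U x \<le> int v * U x" using t by (intro mult_right_mono) auto
          then have "z x + int t * U x \<le> \<alpha> x + U x" using zx by (simp add: \<alpha>' algebra_simps)
          moreover have "1 * W y \<le> int t * W y" using t by (intro mult_right_mono) auto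
          then have "z y - int t * W y \<le> \<alpha> y" using zy prevW by (simp add: algebra_simps)
          ultimately show "below_top (shift z (int t))"
            unfolding below_top_def
          proof (intro allI)
            fix i show "shift z (int t) i \<le> \<alpha> i + U i"
              if "z x + int t * U x \<le> \<alpha> x + U x" "z y - int t * W y \<le> \<alpha> y"
              using that others[of i] x[of i] y[of i] Ux Wy
              by (cases "i = x"; cases "i = y") (auto simp: shift_def)
          qed
        qed
        then show False using nz by contradiction
      qed
    qed
  qed

  obtain ls where ls: "set ls = L" "distinct ls"
    using finite_distinct_list[of L] by (auto simp: L_def)
  have p_monic: "lookup ?p (monom y (nat (int v * W y))) \<noteq> 0"
    "\<nu> \<in> keys ?p \<Longrightarrow> \<nu> \<noteq> monom y (nat (int v * W y)) \<Longrightarrow> lookup \<nu> y < nat (int v * W y)" for \<nu>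
    using lead(1) lower_p[where \<nu> = \<nu>] by (simp_all add: \<mu>p_def)
  have insert_X: "insert (var x ^ E) (power_gens e L) = power_gens (e(x := E)) (insert x L)"
    using L(2) by (auto simp: power_gens_def)
  have "quotient_complete_intersection (polynomial_ring N)
      (Idl_PR N (power_gens e (set ls) \<union> set [?p, ?q]))"
  proof (rule complete_intersection_powers_append[OF ls(2)])
    show "1 \<notin> Idl_PR N (power_gens e (set ls) \<union> set [?p, ?q])"
      using one_notin_A A_eq ls(1) by simp
    fix i g assume i: "i < length [?p, ?q]" and g: "g \<in> PR N"
      "[?p, ?q] ! i * g \<in> Idl_PR N (power_gens e (set ls) \<union> set (take i [?p, ?q]))"
    consider "i = 0" | "i = 1" using i by fastforce
    then show "g \<in> Idl_PR N (power_gens e (set ls) \<union> set (take i [?p, ?q]))"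
    proof cases
      case 1
      then show ?thesis
        using monic_nonzerodivisor[OF L(1,3) pq_PR(1) p_monic g(1)] g(2) ls(1) by simp
    next
      case 2
      have "g \<in> Idl_PR N (insert ?p (power_gens e L))"
      proof (rule nonzerodivisor_of_relation[OF power_gens_PR[OF L(1)] pq_PR _ _ _ rel g_PR g(1)])
        show "var x ^ E \<in> PR N" by (rule PR_var_power[OF xyN(1)])
        show "h \<in> Idl_PR N (power_gens e L)"
          if "h \<in> PR N" "var x ^ E * h \<in> Idl_PR N (power_gens e L)" for h
          by (rule var_power_nonzerodivisor[OF L(1,2) xyN(1) that])
        show "h \<in> Idl_PR N (insert (var x ^ E) (power_gens e L))"
          if "h \<in> PR N" "?p * h \<in> Idl_PR N (insert (var x ^ E) (power_gens e L))" for h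
          using that L xyN ne unfolding insert_X
          by (intro monic_nonzerodivisor[OF _ _ pq_PR(1) p_monic that(1)]) auto
        show "?q * g \<in> Idl_PR N (insert ?p (power_gens e L))"
          using g(2) 2 ls(1) by simp
      qed
      then show ?thesis using 2 ls(1) by simp
    qed
  qed (use ls L sub in auto)
  then show "quotient_complete_intersection (polynomial_ring N) A"
    using A_eq ls(1) by simp
qed

end

section \<open>Contraction and the annihilator of a binomial\<close>

lemma lookup_contract:
  fixes f F :: "'k::field mpoly"
  shows "lookup (contract f F) \<nu> =
    (\<Sum>\<beta>\<in>keys F. lookup F \<beta> * coeff_at f (\<lambda>i. ivec \<beta> i - ivec \<nu> i))"
proof -
  have term_eq: "lookup (if \<forall>i. lookup \<alpha> i \<le> lookup \<beta> i
        then monom (\<beta> - \<alpha>) (lookup f \<alpha> * lookup F \<beta>) else 0) \<nu> =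
      (if ivec \<alpha> = (\<lambda>i. ivec \<beta> i - ivec \<nu> i) then lookup f \<alpha> * lookup F \<beta> else 0)" for \<alpha> \<beta>
  proof -
    have "(\<forall>i. lookup \<alpha> i \<le> lookup \<beta> i) \<and> \<beta> - \<alpha> = \<nu> \<longleftrightarrow>
        ivec \<alpha> = (\<lambda>i. ivec \<beta> i - ivec \<nu> i)"
    proof
      assume "(\<forall>i. lookup \<alpha> i \<le> lookup \<beta> i) \<and> \<beta> - \<alpha> = \<nu>"
      then show "ivec \<alpha> = (\<lambda>i. ivec \<beta> i - ivec \<nu> i)"
        by (auto simp: ivec_def lookup_minus fun_eq_iff of_nat_diff)
    next
      assume "ivec \<alpha> = (\<lambda>i. ivec \<beta> i - ivec \<nu> i)"
      then have eq: "lookup \<beta> i = lookup \<alpha> i + lookup \<nu> i" for i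
        by (auto simp: ivec_def fun_eq_iff algebra_simps simp flip: of_nat_add)
      then show "(\<forall>i. lookup \<alpha> i \<le> lookup \<beta> i) \<and> \<beta> - \<alpha> = \<nu>"
        by (auto simp: lookup_minus intro: poly_mapping_eqI)
    qed
    then show ?thesis by (auto simp: lookup_single when_def)
  qed
  have inner: "(\<Sum>\<alpha>\<in>keys f. if ivec \<alpha> = z then lookup f \<alpha> * k else 0) = k * coeff_at f z" for z k
  proof (cases "z \<in> range ivec")
    case True
    then show ?thesis by (auto simp: in_keys_iff eq_commute[of _ "_ :: nat \<Rightarrow>\<^sub>0 nat"])
  next
    case False
    then have "ivec \<alpha> \<noteq> z" for \<alpha> by auto
    then show ?thesis using False by (simp add: coeff_at_def)
  qed
  have "lookup (contract f F) \<nu> = (\<Sum>\<alpha>\<in>keys f. \<Sum>\<beta>\<in>keys F.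
      if ivec \<alpha> = (\<lambda>i. ivec \<beta> i - ivec \<nu> i) then lookup f \<alpha> * lookup F \<beta> else 0)"
    unfolding contract_def lookup_sum term_eq ..
  also have "\<dots> = (\<Sum>\<beta>\<in>keys F. lookup F \<beta> * coeff_at f (\<lambda>i. ivec \<beta> i - ivec \<nu> i))"
    by (subst sum.swap) (simp add: inner)
  finally show ?thesis .
qed

definition evec :: "nat set \<Rightarrow> (nat \<Rightarrow> nat) \<Rightarrow> nat \<Rightarrow>\<^sub>0 nat" where
  "evec S e = (\<Sum>i\<in>S. monom i (e i))"

lemma ivec_evec: "finite S \<Longrightarrow> ivec (evec S e) = (\<lambda>i. if i \<in> S then int (e i) else 0)"
  by (simp add: ivec_def evec_def lookup_sum lookup_single when_def fun_eq_iff)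

lemma prod_var_power: "finite S \<Longrightarrow> (\<Prod>i\<in>S. var i ^ e i) = monom (evec S e) (1::'k::field)"
  by (induction S rule: finite_induct) (simp_all add: evec_def var_power mult_single)

context binomial_system
begin

text \<open>The coefficient of the contraction at \<open>\<nu>\<close> is the recurrence at \<open>z = \<alpha> + U - \<nu>\<close>.  Vectors \<open>z\<close> that are not of
  this form have a nonzero entry outside \<open>{1..N}\<close>, where both sides of the recurrence are zero.\<close>

lemma Ann_eq_A:
  assumes \<beta>1: "ivec \<beta>1 = (\<lambda>i. \<alpha> i + U i)" and \<beta>2: "ivec \<beta>2 = (\<lambda>i. \<alpha> i + W i)"
  shows "Ann (polynomial_ring N) (monom \<beta>1 c - monom \<beta>2 d) = A"
proof -
  let ?F = "monom \<beta>1 c - monom \<beta>2 d"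
  have "\<beta>1 \<noteq> \<beta>2"
  proof
    assume eq: "\<beta>1 = \<beta>2"
    obtain u where u: "U u \<noteq> 0" using supports by blast
    have "\<alpha> u + U u = \<alpha> u + W u" using eq fun_cong[OF \<beta>1, of u] fun_cong[OF \<beta>2, of u] by simp
    then show False using u disjoint[of u] by simp
  qed
  then have lookups: "lookup ?F \<beta>1 = c" "lookup ?F \<beta>2 = - d"
    by (simp_all add: lookup_minus lookup_single_not_eq)
  have keys_F: "keys ?F \<subseteq> {\<beta>1, \<beta>2}"
    by (auto simp: in_keys_iff lookup_minus lookup_single when_def split: if_splits)
  have coeff: "lookup (contract f ?F) \<nu> =
      c * coeff_at f (\<lambda>i. \<alpha> i + U i - ivec \<nu> i) - d * coeff_at f (\<lambda>i. \<alpha> i + W i - ivec \<nu> i)"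
    for f \<nu>
  proof -
    have "lookup (contract f ?F) \<nu> =
        (\<Sum>\<beta>\<in>{\<beta>1, \<beta>2}. lookup ?F \<beta> * coeff_at f (\<lambda>i. ivec \<beta> i - ivec \<nu> i))"
      unfolding lookup_contract by (rule sum.mono_neutral_left) (use keys_F in \<open>auto simp: in_keys_iff\<close>)
    then show ?thesis using \<open>\<beta>1 \<noteq> \<beta>2\<close> by (simp add: lookups \<beta>1 \<beta>2)
  qed
  show ?thesis
  proof (intro equalityI subsetI)
    fix f assume "f \<in> Ann (polynomial_ring N) ?F"
    then have f: "f \<in> PR N" "contract f ?F = 0" by (auto simp: Ann_def)
    show "f \<in> A"
      unfolding A_iff
    proof (intro conjI allI impI f)
      fix z assume z: "below_top z"
      have shift_z: "shift z (-1) = (\<lambda>i. z i - U i + W i)"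
        by (simp add: shift_def fun_eq_iff)
      show "c * coeff_at f z = d * coeff_at f (shift z (-1))"
      proof (cases "coeff_at f z = 0 \<and> coeff_at f (shift z (-1)) = 0")
        case False
        then have "exponent_vector N z \<or> exponent_vector N (shift z (-1))"
          using coeff_at_nonzeroD[OF f(1)] by blast
        then have "z i = 0" if "i \<notin> {1..N}" for i
          using that outside[OF that] by (auto simp: exponent_vector_def shift_z)
        then have "exponent_vector N (\<lambda>i. \<alpha> i + U i - z i)"
          using z outside by (auto simp: exponent_vector_def below_top_def)
        then obtain \<nu> where \<nu>: "(\<lambda>i. \<alpha> i + U i - z i) = ivec \<nu>"
          using exponent_vector_in_range by blast
        then have \<nu>': "ivec \<nu> i = \<alpha> i + U i - z i" for i by metis
        have "(\<lambda>i. \<alpha> i + U i - ivec \<nu> i) = z" "(\<lambda>i. \<alpha> i + W i - ivec \<nu> i) = shift z (-1)"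
          by (simp_all add: \<nu>' shift_z fun_eq_iff)
        then show ?thesis using coeff[of f \<nu>] f(2) by simp
      qed simp
    qed
  next
    fix f assume f: "f \<in> A"
    have "lookup (contract f ?F) \<nu> = 0" for \<nu>
    proof -
      have "below_top (\<lambda>i. \<alpha> i + U i - ivec \<nu> i)" by (simp add: below_top_def)
      moreover have "shift (\<lambda>i. \<alpha> i + U i - ivec \<nu> i) (-1) = (\<lambda>i. \<alpha> i + W i - ivec \<nu> i)"
        by (simp add: shift_def fun_eq_iff)
      ultimately show ?thesis unfolding coeff using A_recurrence[OF f] by fastforce
    qed
    then have "contract f ?F = 0" by (intro poly_mapping_eqI) simp
    then show "f \<in> Ann (polynomial_ring N) ?F" using f by (simp add: Ann_def A_iff)
  qed
qed

lemma least_exceeding: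
  assumes "v = (LEAST i. 1 \<le> i \<and> (\<exists>j. \<alpha> j < int i * U j))"
  shows "1 \<le> v" "\<exists>j. \<alpha> j < int v * U j" "t < v \<Longrightarrow> int t * U i \<le> \<alpha> i"
proof -
  obtain u where u: "U u \<noteq> 0" using supports by blast
  have "int (nat (\<alpha> u) + 1) * 1 \<le> int (nat (\<alpha> u) + 1) * U u"
    using positive(1)[OF u] by (intro mult_left_mono) auto
  then have "\<alpha> u < int (nat (\<alpha> u) + 1) * U u" by simp
  then have "1 \<le> nat (\<alpha> u) + 1 \<and> (\<exists>j. \<alpha> j < int (nat (\<alpha> u) + 1) * U j)" by auto
  from LeastI[of "\<lambda>i. 1 \<le> i \<and> (\<exists>j. \<alpha> j < int i * U j)", OF this]
  show "1 \<le> v" "\<exists>j. \<alpha> j < int v * U j" unfolding assms by auto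
  assume t: "t < v"
  show "int t * U i \<le> \<alpha> i"
  proof (cases "t = 0")
    case False
    then show ?thesis
      using not_less_Least[of t "\<lambda>i. 1 \<le> i \<and> (\<exists>j. \<alpha> j < int i * U j)"] t
      unfolding assms by (force simp: not_less)
  qed simp
qed

end

lemma set_add_Idl_PR:
  fixes S T :: "'k::field mpoly set"
  assumes "S \<subseteq> PR N" "T \<subseteq> PR N"
  shows "Idl_PR N S <+>\<^bsub>polynomial_ring N\<^esub> Idl_PR N T = Idl_PR N (S \<union> T)"
proof -
  interpret R: cring "polynomial_ring N :: 'k mpoly ring" by (rule cring_polynomial_ring)
  have ST: "S \<union> T \<subseteq> PR N" using assms by blast
  have "Idl_PR N (Idl_PR N S \<union> Idl_PR N T) = Idl_PR N S <+>\<^bsub>polynomial_ring N\<^esub> Idl_PR N T"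
    by (rule R.union_genideal) (intro Idl_PR_ideal assms)+
  moreover have "Idl_PR N (Idl_PR N S \<union> Idl_PR N T) = Idl_PR N (S \<union> T)"
  proof (rule equalityI; rule Idl_PR_minimal)
    show "Idl_PR N S \<union> Idl_PR N T \<subseteq> Idl_PR N (S \<union> T)"
      using Idl_PR_mono[OF _ ST] by auto
    have "Idl_PR N S \<union> Idl_PR N T \<subseteq> PR N"
      using ideal_subset[OF Idl_PR_ideal] assms by auto
    then show "ideal (Idl_PR N (Idl_PR N S \<union> Idl_PR N T)) (polynomial_ring N)"
      "S \<union> T \<subseteq> Idl_PR N (Idl_PR N S \<union> Idl_PR N T)"
      using Idl_PR_self[OF assms(1)] Idl_PR_self[OF assms(2)] Idl_PR_self[of "Idl_PR N S \<union> Idl_PR N T"]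
      by (auto intro: Idl_PR_ideal)
  qed (rule Idl_PR_ideal[OF ST])
  ultimately show ?thesis by simp
qed

lemma const_mult_monoms: "const k * monom \<mu> 1 * monom \<nu> 1 = monom (\<mu> + \<nu>) k"
  by (simp add: const_def mult_single)

lemma expo_eqI: "ivec \<mu> = z \<Longrightarrow> expo z = \<mu>"
  by auto

text \<open>The two cases \<open>v < w\<close> and \<open>v > w\<close> with \<open>d\<^sub>1 = d\<^sub>2 = 1\<close> are \<open>generators_long_second\<close> for the two orders of the
  blocks, the first of which is also the case \<open>d\<^sub>2 = 1\<close>, \<open>a\<^bsub>m+1\<^esub> + 1 \<ge> v b\<^bsub>m+1\<^esub>\<close>; \<open>v = w\<close> is \<open>generators_equal\<close>.  For the necessity of the conditions with \<open>d\<^sub>2 \<ge> 2\<close>, the numbers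
  \<open>v\<close> and \<open>w'\<close> are compared, where \<open>w'\<close> is the analogue of \<open>v\<close> for the second block and equals \<open>w\<close> if
  \<open>d\<^sub>2 = 1\<close>.\<close>

theorem theorem1p3:
  fixes m n d\<^sub>1 d\<^sub>2 v w :: nat
    and a b :: "nat \<Rightarrow> nat"
    and c\<^sub>1 c\<^sub>2 :: "'k::field"
    and R :: "'k mpoly ring"
    and F :: "'k mpoly"
    and I :: "'k mpoly set"
  assumes "m \<ge> 1" and "n \<ge> 1"
    and R: "R = polynomial_ring (m + n)"
    and "c\<^sub>1 \<noteq> 0" and "c\<^sub>2 \<noteq> 0"
    and F: "F = (\<Prod>i=1..m+n. var i ^ a i) *
              (const c\<^sub>1 * (\<Prod>i=1..m. var i ^ b i) - const c\<^sub>2 * (\<Prod>i=m+1..m+n. var i ^ b i))"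
    and d1: "d\<^sub>1 = card {i \<in> {1..m}. b i \<noteq> 0}"
    and d2: "d\<^sub>2 = card {i \<in> {m+1..m+n}. b i \<noteq> 0}"
    and "d\<^sub>1 \<ge> d\<^sub>2" and "d\<^sub>2 \<ge> 1"
    and "\<forall>i\<in>{d\<^sub>1+1..m}. b i = 0"
    and "\<forall>i\<in>{m+d\<^sub>2+1..m+n}. b i = 0"
    and v: "v = (LEAST i. i \<ge> 1 \<and>
              contract ((\<Prod>j=1..m. var j ^ b j) ^ i) (\<Prod>j=1..m. var j ^ a j :: 'k mpoly) = 0)"
    and w: "w = (LEAST i. i \<ge> 1 \<and> a (m+1) + 1 \<le> i * b (m+1))"
    and I: "I = Idl\<^bsub>R\<^esub> ((\<lambda>i. var i ^ (a i + 1)) ` ({2..m} \<union> {m+2..m+n}))"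
  shows
    "(quotient_complete_intersection R (Ann R F) \<longleftrightarrow>
        (d\<^sub>1 = 1 \<and> d\<^sub>2 = 1) \<or> (d\<^sub>1 \<ge> 2 \<and> d\<^sub>2 = 1 \<and> a (m+1) + 1 \<ge> v * b (m+1)))
     \<and>
     (d\<^sub>1 = 1 \<and> d\<^sub>2 = 1 \<longrightarrow>
        (v < w \<longrightarrow>
           Ann R F =
             Idl\<^bsub>R\<^esub> {var 1 ^ (a 1 + b 1 + 1),
                   \<Sum>i=0..v. const (c\<^sub>1 ^ (v - i) * c\<^sub>2 ^ i) * var 1 ^ (i * b 1)
                             * var (m+1) ^ (a (m+1) + 1 - i * b (m+1))}
             <+>\<^bsub>R\<^esub> I) \<and>
        (v > w \<longrightarrow>
           Ann R F =
             Idl\<^bsub>R\<^esub> {var (m+1) ^ (a (m+1) + b (m+1) + 1),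
                   \<Sum>i=0..w. const (c\<^sub>1 ^ i * c\<^sub>2 ^ (w - i)) * var 1 ^ (a 1 + 1 - i * b 1)
                             * var (m+1) ^ (i * b (m+1))}
             <+>\<^bsub>R\<^esub> I) \<and>
        (v = w \<longrightarrow>
           Ann R F =
             Idl\<^bsub>R\<^esub> {\<Sum>i=0..v. const (c\<^sub>1 ^ (v - i) * c\<^sub>2 ^ i) * var 1 ^ (i * b 1)
                             * var (m+1) ^ ((v - i) * b (m+1)),
                   \<Sum>i=0..v-1. const (c\<^sub>1 ^ (v - 1 - i) * c\<^sub>2 ^ i)
                             * var 1 ^ (a 1 + 1 - (v - 1 - i) * b 1)
                             * var (m+1) ^ (a (m+1) + 1 - i * b (m+1))}
             <+>\<^bsub>R\<^esub> I))
     \<and>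
     (d\<^sub>2 = 1 \<and> a (m+1) + 1 \<ge> v * b (m+1) \<longrightarrow>
        Ann R F =
          Idl\<^bsub>R\<^esub> ((\<lambda>i. var i ^ (a i + b i + 1)) ` {1..m}
                \<union> {\<Sum>i=0..v. const (c\<^sub>1 ^ (v - i) * c\<^sub>2 ^ i) * (\<Prod>j=1..m. var j ^ b j) ^ i
                             * var (m+1) ^ (a (m+1) + 1 - i * b (m+1))}
                \<union> (\<lambda>i. var i ^ (a i + 1)) ` {m+2..m+n}))"
proof -
  define N where "N = m + n"
  define y where "y = m + 1"
  define \<alpha> where "\<alpha> i = (if i \<in> {1..N} then int (a i) else 0)" for i
  define U where "U i = (if i \<in> {1..m} then int (b i) else 0)" for i
  define W where "W i = (if i \<in> {y..N} then int (b i) else 0)" for i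
  have yN: "y \<in> {1..N}" and oneN: "1 \<in> {1..N}" using \<open>n \<ge> 1\<close> \<open>m \<ge> 1\<close> by (auto simp: N_def y_def)

  have supp1: "{i \<in> {1..m}. b i \<noteq> 0} = {1..d\<^sub>1}"
  proof (rule card_subset_eq)
    have "i \<le> d\<^sub>1" if "i \<in> {1..m}" "b i \<noteq> 0" for i
      using that \<open>\<forall>i\<in>{d\<^sub>1+1..m}. b i = 0\<close> by (cases "i \<le> d\<^sub>1") auto
    then show "{i \<in> {1..m}. b i \<noteq> 0} \<subseteq> {1..d\<^sub>1}" by auto
  qed (use d1 in auto)
  have supp2: "{i \<in> {m+1..m+n}. b i \<noteq> 0} = {m+1..m+d\<^sub>2}"
  proof (rule card_subset_eq)
    have "i \<le> m + d\<^sub>2" if "i \<in> {m+1..m+n}" "b i \<noteq> 0" for i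
      using that \<open>\<forall>i\<in>{m+d\<^sub>2+1..m+n}. b i = 0\<close> by (cases "i \<le> m + d\<^sub>2") auto
    then show "{i \<in> {m+1..m+n}. b i \<noteq> 0} \<subseteq> {m+1..m+d\<^sub>2}" by auto
  qed (use d2 in auto)
  have U_iff: "U i \<noteq> 0 \<longleftrightarrow> i \<in> {1..d\<^sub>1}" for i
    unfolding supp1[symmetric] by (auto simp: U_def)
  have W_iff: "W i \<noteq> 0 \<longleftrightarrow> i \<in> {y..m+d\<^sub>2}" for i
    unfolding y_def supp2[symmetric] by (auto simp: W_def y_def N_def)
  have d1_pos: "1 \<le> d\<^sub>1" using \<open>d\<^sub>1 \<ge> d\<^sub>2\<close> \<open>d\<^sub>2 \<ge> 1\<close> by simp
  have U1: "U 1 \<noteq> 0" and Wy: "W y \<noteq> 0"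
    using d1_pos \<open>d\<^sub>2 \<ge> 1\<close> unfolding U_iff W_iff by (auto simp: y_def)

  interpret B: binomial_system N \<alpha> U W c\<^sub>1 c\<^sub>2
  proof
    show "exponent_vector N \<alpha>" "exponent_vector N U" "exponent_vector N W"
      by (auto simp: exponent_vector_def \<alpha>_def U_def W_def N_def y_def)
    show "U i = 0 \<or> W i = 0" for i by (simp add: U_def W_def y_def)
    show "\<exists>i. U i \<noteq> 0" "\<exists>i. W i \<noteq> 0" using U1 Wy by blast+
  qed fact+
  interpret S: binomial_system N \<alpha> W U c\<^sub>2 c\<^sub>1 by (rule B.swap)
  have S_A: "S.A = B.A" by (rule binomial_ann_swap)

  have \<alpha>_y: "\<alpha> y = int (a (m+1))" and \<alpha>_1: "\<alpha> 1 = int (a 1)"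
    using yN oneN by (simp_all add: \<alpha>_def y_def)
  have U_1: "U 1 = int (b 1)" and W_y: "W y = int (b (m+1))"
    using yN \<open>m \<ge> 1\<close> by (simp_all add: U_def W_def y_def)
  have U_y: "U y = 0" and W_1: "W 1 = 0" using B.positive U1 Wy by auto

  have Ann: "Ann R F = B.A"
  proof -
    let ?\<beta> = "\<lambda>S. evec {1..m+n} a + evec S b"
    have "F = monom (?\<beta> {1..m}) c\<^sub>1 - monom (?\<beta> {m+1..m+n}) c\<^sub>2"
      unfolding F by (simp add: prod_var_power const_def right_diff_distrib mult_single)
    moreover have "ivec (?\<beta> {1..m}) = (\<lambda>i. \<alpha> i + U i)"
      "ivec (?\<beta> {m+1..m+n}) = (\<lambda>i. \<alpha> i + W i)"
      by (auto simp: ivec_add ivec_evec \<alpha>_def U_def W_def N_def y_def fun_eq_iff)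
    ultimately show ?thesis using B.Ann_eq_A by (simp add: R N_def)
  qed

  have u_pow: "(\<Prod>j=1..m. var j ^ b j :: 'k mpoly) ^ i = monom (evec {1..m} (\<lambda>j. i * b j)) 1" for i
  proof -
    have "(\<Prod>j=1..m. var j ^ b j :: 'k mpoly) ^ i = (\<Prod>j=1..m. var j ^ (i * b j))"
      by (simp only: prod_power_distrib mult.commute[of i] power_mult)
    then show ?thesis by (simp add: prod_var_power)
  qed
  have monom_nz: "monom \<mu> (1 :: 'k) \<noteq> 0" for \<mu> :: "nat \<Rightarrow>\<^sub>0 nat"
    by (metis lookup_single_eq lookup_zero zero_neq_one)
  have "contract ((\<Prod>j=1..m. var j ^ b j) ^ i) (\<Prod>j=1..m. var j ^ a j :: 'k mpoly) = 0 \<longleftrightarrow>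
      (\<exists>j. \<alpha> j < int i * U j)" for i
  proof -
    have "contract ((\<Prod>j=1..m. var j ^ b j) ^ i) (\<Prod>j=1..m. var j ^ a j :: 'k mpoly) = 0 \<longleftrightarrow>
        (\<exists>j. ivec (evec {1..m} a) j < ivec (evec {1..m} (\<lambda>j. i * b j)) j)"
      unfolding u_pow unfolding prod_var_power[OF finite_atLeastAtMost] contract_monomial
      using monom_nz by (auto simp: ivec_def not_le dest: leD)
    also have "\<dots> \<longleftrightarrow> (\<exists>j. \<alpha> j < int i * U j)"
      by (auto simp: ivec_evec \<alpha>_def U_def N_def split: if_splits)
    finally show ?thesis .
  qed
  then have "v = (LEAST i. 1 \<le> i \<and> (\<exists>j. \<alpha> j < int i * U j))" using v by simp
  note v_facts = B.least_exceeding[OF this]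
  define w' where "w' = (LEAST i. 1 \<le> i \<and> (\<exists>j. \<alpha> j < int i * W j))"
  note w_facts = S.least_exceeding[OF w'_def]
  have v_pred: "int v - 1 = int (v - 1)" and w_pred: "int w' - 1 = int (w' - 1)"
    using v_facts(1) w_facts(1) by auto
  have prevU: "(int v - 1) * U i \<le> \<alpha> i" for i
    unfolding v_pred by (rule v_facts(3)) (use v_facts(1) in simp)
  have prevW: "(int w' - 1) * W i \<le> \<alpha> i" for i
    unfolding w_pred by (rule w_facts(3)) (use w_facts(1) in simp)
  have W_single: "W i = 0" if "d\<^sub>2 = 1" "i \<noteq> y" for i
    using W_iff[of i] that by (auto simp: y_def)
  have U_single: "U i = 0" if "d\<^sub>1 = 1" "i \<noteq> 1" for i
    using U_iff[of i] that by auto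
  have w_y: "\<alpha> y < int w' * W y" if "d\<^sub>2 = 1"
    using w_facts(2) W_single[OF that] B.nonneg(1) by (metis mult_zero_right not_less)
  have w_eq: "w = w'" if "d\<^sub>2 = 1"
  proof -
    have "a (m+1) + 1 \<le> i * b (m+1) \<longleftrightarrow> (\<exists>j. \<alpha> j < int i * W j)" for i
    proof -
      have "(\<exists>j. \<alpha> j < int i * W j) \<longleftrightarrow> \<alpha> y < int i * W y"
        using W_single[OF that] B.nonneg(1) by (metis mult_zero_right not_less)
      then show ?thesis
        unfolding \<alpha>_y W_y by (simp add: Suc_le_eq flip: of_nat_mult)
    qed
    then show ?thesis unfolding w w'_def by simp
  qed

  have long: "Ann R F = Idl_PR N (power_gens (\<lambda>l. nat (\<alpha> l + U l) + 1) ({1..N} - {y}) \<union>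
        {B.chain_poly (\<lambda>i. if i = y then \<alpha> y + 1 else 0) v})"
    "quotient_complete_intersection R (Ann R F)"
    if "d\<^sub>2 = 1" "v * b (m+1) \<le> a (m+1) + 1"
  proof -
    obtain u where u: "\<alpha> u < int v * U u" using v_facts(2) by blast
    have "int (v * b (m+1)) \<le> int (a (m+1) + 1)" using that(2) by (simp only: of_nat_le_iff)
    then have "int v * W y \<le> \<alpha> y + 1" by (simp add: \<alpha>_y W_y)
    note gens = B.generators_long_second[OF U_y W_single[OF that(1)] u this]
    show "Ann R F = Idl_PR N (power_gens (\<lambda>l. nat (\<alpha> l + U l) + 1) ({1..N} - {y}) \<union>
        {B.chain_poly (\<lambda>i. if i = y then \<alpha> y + 1 else 0) v})"
      unfolding Ann by (rule gens(1))
    show "quotient_complete_intersection R (Ann R F)"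
      unfolding Ann unfolding R N_def[symmetric] by (rule gens(2))
  qed
  have N_minus_y: "{1..N} - {y} = {1..m} \<union> {m+2..m+n}"
    by (auto simp: N_def y_def)

  have part3: "Ann R F =
      Idl\<^bsub>R\<^esub> ((\<lambda>i. var i ^ (a i + b i + 1)) ` {1..m}
            \<union> {\<Sum>i=0..v. const (c\<^sub>1 ^ (v - i) * c\<^sub>2 ^ i) * (\<Prod>j=1..m. var j ^ b j) ^ i
                         * var (m+1) ^ (a (m+1) + 1 - i * b (m+1))}
            \<union> (\<lambda>i. var i ^ (a i + 1)) ` {m+2..m+n})"
    if d2_1: "d\<^sub>2 = 1" and vb: "v * b (m+1) \<le> a (m+1) + 1"
  proof -
    have chain: "B.chain_poly (\<lambda>i. if i = y then \<alpha> y + 1 else 0) v =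
        (\<Sum>i=0..v. const (c\<^sub>1 ^ (v - i) * c\<^sub>2 ^ i) * (\<Prod>j=1..m. var j ^ b j) ^ i
                         * var (m+1) ^ (a (m+1) + 1 - i * b (m+1)))"
      unfolding B.chain_poly_def
    proof (rule sum.cong[OF refl])
      fix i assume "i \<in> {0..v}"
      then have "i * b (m+1) \<le> v * b (m+1)" by (intro mult_le_mono1) simp
      then have "i * b (m+1) \<le> a (m+1) + 1" using vb by (rule order_trans)
      then have "ivec (evec {1..m} (\<lambda>j. i * b j) + monom (m+1) (a (m+1) + 1 - i * b (m+1))) =
          B.shift (\<lambda>i. if i = y then \<alpha> y + 1 else 0) (int i)"
        using W_single[OF d2_1] W_y \<alpha>_y U_y
        by (auto simp: B.shift_def ivec_add ivec_evec ivec_single U_def y_def fun_eq_iff of_nat_diff)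
      from expo_eqI[OF this]
      show "monom (expo (B.shift (\<lambda>i. if i = y then \<alpha> y + 1 else 0) (int i))) (c\<^sub>1 ^ (v - i) * c\<^sub>2 ^ i) =
        const (c\<^sub>1 ^ (v - i) * c\<^sub>2 ^ i) * (\<Prod>j=1..m. var j ^ b j) ^ i
          * var (m+1) ^ (a (m+1) + 1 - i * b (m+1))"
        unfolding u_pow unfolding var_power const_mult_monoms by simp
    qed
    have gens: "(power_gens (\<lambda>l. nat (\<alpha> l + U l) + 1) ({1..N} - {y}) :: 'k mpoly set) =
        (\<lambda>i. var i ^ (a i + b i + 1)) ` {1..m} \<union> (\<lambda>i. var i ^ (a i + 1)) ` {m+2..m+n}"
      unfolding power_gens_def N_minus_y image_Un
      by (intro arg_cong2[of _ _ _ _ "(\<union>)"] image_cong)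
        (auto simp: \<alpha>_def U_def N_def nat_add_distrib)
    show ?thesis
      unfolding long(1)[OF that] chain gens unfolding R N_def by (simp only: Un_ac)
  qed

  have I_gens: "I = Idl_PR N (power_gens (\<lambda>i. a i + 1) ({1..N} - {1, y}))"
  proof -
    have "{1..N} - {1, y} = {2..m} \<union> {m+2..m+n}" using \<open>m \<ge> 1\<close> by (auto simp: N_def y_def)
    then show ?thesis by (simp add: I R N_def power_gens_def)
  qed
  have I_sum: "Idl_PR N (power_gens (\<lambda>i. a i + 1) ({1..N} - {1, y}) \<union> {f, g}) =
      Idl\<^bsub>R\<^esub> {f, g} <+>\<^bsub>R\<^esub> I" if "f \<in> PR N" "g \<in> PR N" for f g
    unfolding I_gens R N_def[symmetric]
    using set_add_Idl_PR[OF _ power_gens_PR, of "{f, g}" N "{1..N} - {1, y}" "\<lambda>i. a i + 1"] that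
    by (simp only: Un_commute insert_subset empty_subsetI Diff_subset simp_thms)
  have mono_PR: "const k * var 1 ^ r * var (m+1) ^ s \<in> PR N" for r s and k :: 'k
    using oneN yN unfolding const_def y_def by (intro PR_mult PR_var_power PR_monom) auto
  have mono_expo: "monom (expo z) k = const k * var 1 ^ r * var (m+1) ^ s"
    if "\<And>i. z i = (if i = 1 then int r else if i = y then int s else 0)" for z k r s
  proof -
    have "ivec (monom 1 r + monom (m+1) s) = z"
      using that \<open>m \<ge> 1\<close> by (auto simp: ivec_add ivec_single fun_eq_iff y_def)
    then show ?thesis unfolding var_power const_mult_monoms by (simp add: expo_eqI)
  qed
  have single_var: "power_gens e ({1..N} - {s}) =
      (power_gens (\<lambda>i. a i + 1) ({1..N} - {1, y}) \<union> {var t ^ e t} :: 'k mpoly set)"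
    if "s = 1 \<and> t = y \<or> s = y \<and> t = 1" "\<And>i. i \<in> {1..N} - {1, y} \<Longrightarrow> e i = a i + 1" for e s t
  proof -
    have "{1..N} - {s} = insert t ({1..N} - {1, y})"
      using that(1) oneN yN \<open>m \<ge> 1\<close> by (auto simp: y_def)
    then show ?thesis using that(2) by (simp add: power_gens_def)
  qed

  have part2: "(v < w \<longrightarrow>
           Ann R F =
             Idl\<^bsub>R\<^esub> {var 1 ^ (a 1 + b 1 + 1),
                   \<Sum>i=0..v. const (c\<^sub>1 ^ (v - i) * c\<^sub>2 ^ i) * var 1 ^ (i * b 1)
                             * var (m+1) ^ (a (m+1) + 1 - i * b (m+1))}
             <+>\<^bsub>R\<^esub> I)" (is "_ \<longrightarrow> ?A1")
    "(v > w \<longrightarrow>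
           Ann R F =
             Idl\<^bsub>R\<^esub> {var (m+1) ^ (a (m+1) + b (m+1) + 1),
                   \<Sum>i=0..w. const (c\<^sub>1 ^ i * c\<^sub>2 ^ (w - i)) * var 1 ^ (a 1 + 1 - i * b 1)
                             * var (m+1) ^ (i * b (m+1))}
             <+>\<^bsub>R\<^esub> I)" (is "_ \<longrightarrow> ?A2")
    "(v = w \<longrightarrow>
           Ann R F =
             Idl\<^bsub>R\<^esub> {\<Sum>i=0..v. const (c\<^sub>1 ^ (v - i) * c\<^sub>2 ^ i) * var 1 ^ (i * b 1)
                             * var (m+1) ^ ((v - i) * b (m+1)),
                   \<Sum>i=0..v-1. const (c\<^sub>1 ^ (v - 1 - i) * c\<^sub>2 ^ i)
                             * var 1 ^ (a 1 + 1 - (v - 1 - i) * b 1)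
                             * var (m+1) ^ (a (m+1) + 1 - i * b (m+1))}
             <+>\<^bsub>R\<^esub> I)" (is "_ \<longrightarrow> ?A3")
    "quotient_complete_intersection R (Ann R F)"
    if d: "d\<^sub>1 = 1" "d\<^sub>2 = 1"
  proof -
    have w: "w = w'" by (rule w_eq[OF d(2)])
    have v_1: "\<alpha> 1 < int v * U 1"
      using v_facts(2) U_single[OF d(1)] B.nonneg(1) by (metis mult_zero_right not_less)
    have le_a1: "t * b 1 \<le> a 1" if "t < v" for t
      using v_facts(3)[OF that, of 1] unfolding \<alpha>_1 U_1 by (simp flip: of_nat_mult)
    have le_ay: "t * b (m+1) \<le> a (m+1)" if "t < w" for t
      using w_facts(3)[of t y] that unfolding w \<alpha>_y W_y by (simp flip: of_nat_mult)
    have shift: "B.shift z (int i) l = (if l = 1 then z 1 + int i * U 1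
        else if l = y then z y - int i * W y else z l)"
      "S.shift z (int i) l = (if l = 1 then z 1 - int i * U 1
        else if l = y then z y + int i * W y else z l)" for z i l
      using U_single[OF d(1)] W_single[OF d(2)] U_y W_1
      by (auto simp: B.shift_def S.shift_def)
    have ne: "y \<noteq> 1" using \<open>m \<ge> 1\<close> by (simp add: y_def)
    have others: "nat (\<alpha> i + U i) + 1 = a i + 1" "nat (\<alpha> i + W i) + 1 = a i + 1"
      "nat (\<alpha> i) + 1 = a i + 1" if "i \<in> {1..N} - {1, y}" for i
      using that U_single[OF d(1), of i] W_single[OF d(2), of i] by (auto simp: \<alpha>_def)
    have first: ?A1 "quotient_complete_intersection R (Ann R F)" if "v < w"
    proof -
      have vb: "v * b (m+1) \<le> a (m+1) + 1" using le_ay[OF that] by simp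
      have chain: "B.chain_poly (\<lambda>i. if i = y then \<alpha> y + 1 else 0) v =
          (\<Sum>i=0..v. const (c\<^sub>1 ^ (v - i) * c\<^sub>2 ^ i) * var 1 ^ (i * b 1)
                             * var (m+1) ^ (a (m+1) + 1 - i * b (m+1)))"
        unfolding B.chain_poly_def
      proof (intro sum.cong[OF refl] mono_expo)
        fix i l assume "i \<in> {0..v}"
        then have "i * b (m+1) \<le> a (m+1) + 1" using le_ay[of i] that by simp
        then show "B.shift (\<lambda>i. if i = y then \<alpha> y + 1 else 0) (int i) l =
            (if l = 1 then int (i * b 1)
             else if l = y then int (a (m+1) + 1 - i * b (m+1)) else 0)"
          using ne by (simp del: One_nat_def add: shift U_1 W_y \<alpha>_y of_nat_diff)
      qed
      have pows: "power_gens (\<lambda>l. nat (\<alpha> l + U l) + 1) ({1..N} - {y}) =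
          (power_gens (\<lambda>i. a i + 1) ({1..N} - {1, y}) \<union> {var 1 ^ (a 1 + b 1 + 1)} :: 'k mpoly set)"
      proof -
        have "nat (\<alpha> 1 + U 1) + 1 = a 1 + b 1 + 1" unfolding \<alpha>_1 U_1 by simp
        then show ?thesis
          using single_var[of y 1 "\<lambda>l. nat (\<alpha> l + U l) + 1",
              OF disjI2[OF conjI[OF refl refl]] others(1)] by (simp only:)
      qed
      show ?A1
        unfolding long(1)[OF d(2) vb] chain pows Un_assoc insert_is_Un[symmetric]
        by (intro I_sum PR_sum mono_PR PR_var_power oneN)
      show "quotient_complete_intersection R (Ann R F)" by (rule long(2)[OF d(2) vb])
    qed
    have second: ?A2 "quotient_complete_intersection R (Ann R F)" if "w < v"
    proof -
      have wb: "int w' * U 1 \<le> \<alpha> 1 + 1" using v_facts(3)[of w' 1] that w by simp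
      note long_S = S.generators_long_second[OF W_1 U_single[OF d(1)] w_y[OF d(2)] wb]
      have gens: "Ann R F = Idl_PR N (power_gens (\<lambda>l. nat (\<alpha> l + W l) + 1) ({1..N} - {1}) \<union>
          {S.chain_poly (\<lambda>i. if i = 1 then \<alpha> 1 + 1 else 0) w})"
        unfolding Ann S_A[symmetric] w by (rule long_S(1))
      have ci: "quotient_complete_intersection (polynomial_ring N) (Ann R F)"
        unfolding Ann S_A[symmetric] by (rule long_S(2))
      have chain: "S.chain_poly (\<lambda>i. if i = 1 then \<alpha> 1 + 1 else 0) w =
          (\<Sum>i=0..w. const (c\<^sub>1 ^ i * c\<^sub>2 ^ (w - i)) * var 1 ^ (a 1 + 1 - i * b 1)
                             * var (m+1) ^ (i * b (m+1)))"
        unfolding S.chain_poly_def mult.commute[of "c\<^sub>2 ^ _"]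
      proof (intro sum.cong[OF refl] mono_expo)
        fix i l assume "i \<in> {0..w}"
        then have "i * b 1 \<le> a 1 + 1" using le_a1[of i] that by simp
        then show "S.shift (\<lambda>i. if i = 1 then \<alpha> 1 + 1 else 0) (int i) l =
            (if l = 1 then int (a 1 + 1 - i * b 1) else if l = y then int (i * b (m+1)) else 0)"
          using ne by (simp del: One_nat_def add: shift U_1 W_y \<alpha>_1 of_nat_diff)
      qed
      have pows: "power_gens (\<lambda>l. nat (\<alpha> l + W l) + 1) ({1..N} - {1}) =
          (power_gens (\<lambda>i. a i + 1) ({1..N} - {1, y}) \<union>
            {var (m+1) ^ (a (m+1) + b (m+1) + 1)} :: 'k mpoly set)"
      proof -
        have "nat (\<alpha> y + W y) + 1 = a (m+1) + b (m+1) + 1" unfolding \<alpha>_y W_y by simp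
        then show ?thesis
          using single_var[of 1 y "\<lambda>l. nat (\<alpha> l + W l) + 1",
              OF disjI1[OF conjI[OF refl refl]] others(2)]
          by (simp only: y_def[symmetric])
      qed
      show ?A2
        unfolding gens chain pows Un_assoc insert_is_Un[symmetric]
        by (intro I_sum PR_sum mono_PR PR_var_power yN[unfolded y_def])
      show "quotient_complete_intersection R (Ann R F)"
        using ci unfolding R N_def[symmetric] .
    qed
    have third: ?A3 "quotient_complete_intersection R (Ann R F)" if eq: "v = w"
    proof -
      have v_y: "\<alpha> y < int v * W y" using w_y[OF d(2)] eq w by simp
      have prevW_v: "(int v - 1) * W y \<le> \<alpha> y" using prevW[of y] eq w by simp
      note equal = B.generators_equal[OF U_single[OF d(1)] W_single[OF d(2)] v_facts(1) v_1
          prevU v_y prevW_v]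
      have ci: "quotient_complete_intersection (polynomial_ring N) (Ann R F)"
        unfolding Ann by (rule equal(2))
      have p: "B.chain_poly (\<lambda>i. int v * W i) v =
          (\<Sum>i=0..v. const (c\<^sub>1 ^ (v - i) * c\<^sub>2 ^ i) * var 1 ^ (i * b 1)
                             * var (m+1) ^ ((v - i) * b (m+1)))"
        unfolding B.chain_poly_def
      proof (intro sum.cong[OF refl] mono_expo)
        fix i l assume "i \<in> {0..v}"
        then show "B.shift (\<lambda>i. int v * W i) (int i) l =
            (if l = 1 then int (i * b 1) else if l = y then int ((v - i) * b (m+1)) else 0)"
          using ne W_single[OF d(2), of l]
          by (simp del: One_nat_def add: shift U_1 W_y W_1 of_nat_diff left_diff_distrib)
      qed
      have q: "B.chain_poly (\<lambda>i. if i = 1 then \<alpha> 1 + 1 - (int v - 1) * U 1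
            else if i = y then \<alpha> y + 1 else 0) (v - 1) =
          (\<Sum>i=0..v-1. const (c\<^sub>1 ^ (v - 1 - i) * c\<^sub>2 ^ i)
                             * var 1 ^ (a 1 + 1 - (v - 1 - i) * b 1)
                             * var (m+1) ^ (a (m+1) + 1 - i * b (m+1)))"
        unfolding B.chain_poly_def
      proof (intro sum.cong[OF refl] mono_expo)
        fix i l assume i: "i \<in> {0..v-1}"
        then have "i < w" "v - 1 - i < v" using eq v_facts(1) by auto
        then have "i * b (m+1) \<le> a (m+1) + 1" "(v - 1 - i) * b 1 \<le> a 1 + 1"
          using le_ay[of i] le_a1[of "v - 1 - i"] by linarith+
        moreover have vi: "int (v - 1 - i) = int v - 1 - int i" using i v_facts(1) by auto
        ultimately have "int (a 1 + 1 - (v - 1 - i) * b 1) =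
            int (a 1) + 1 - (int v - 1 - int i) * int (b 1)"
          "int (a (m+1) + 1 - i * b (m+1)) = int (a (m+1)) + 1 - int i * int (b (m+1))"
          by (simp_all only: of_nat_diff of_nat_mult of_nat_add of_nat_1 vi)
        then show "B.shift (\<lambda>i. if i = 1 then \<alpha> 1 + 1 - (int v - 1) * U 1
              else if i = y then \<alpha> y + 1 else 0) (int i) l =
            (if l = 1 then int (a 1 + 1 - (v - 1 - i) * b 1)
             else if l = y then int (a (m+1) + 1 - i * b (m+1)) else 0)"
          using ne by (simp only: shift U_1 W_y \<alpha>_1 \<alpha>_y refl if_True if_False split: if_split)
            (simp add: algebra_simps)
      qed
      have pows: "power_gens (\<lambda>l. nat (\<alpha> l) + 1) ({1..N} - {1, y}) =
          (power_gens (\<lambda>i. a i + 1) ({1..N} - {1, y}) :: 'k mpoly set)"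
        unfolding power_gens_def using others(3) by (intro image_cong) simp_all
      have "Ann R F = Idl_PR N (power_gens (\<lambda>l. nat (\<alpha> l) + 1) ({1..N} - {1, y}) \<union>
          {B.chain_poly (\<lambda>i. int v * W i) v,
           B.chain_poly (\<lambda>i. if i = 1 then \<alpha> 1 + 1 - (int v - 1) * U 1
             else if i = y then \<alpha> y + 1 else 0) (v - 1)})"
        unfolding Ann by (rule equal(1))
      then show ?A3
        unfolding p q pows by (rule trans) (intro I_sum PR_sum mono_PR)
      show "quotient_complete_intersection R (Ann R F)"
        using ci unfolding R N_def[symmetric] .
    qed
    show "v < w \<longrightarrow> ?A1" "v > w \<longrightarrow> ?A2" "v = w \<longrightarrow> ?A3" using first second third by blast+
    show "quotient_complete_intersection R (Ann R F)"
      using first(2) second(2) third(2) by (cases v w rule: linorder_cases) auto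
  qed

  have not_ci: "\<not> quotient_complete_intersection R (Ann R F)"
    if "\<not> ((d\<^sub>1 = 1 \<and> d\<^sub>2 = 1) \<or> (d\<^sub>1 \<ge> 2 \<and> d\<^sub>2 = 1 \<and> a (m+1) + 1 \<ge> v * b (m+1)))"
  proof -
    have d1_2: "2 \<le> d\<^sub>1" using that \<open>d\<^sub>1 \<ge> d\<^sub>2\<close> \<open>d\<^sub>2 \<ge> 1\<close> by linarith
    have U2: "U 1 \<noteq> 0" "U 2 \<noteq> 0" "(1::nat) \<noteq> 2" using d1_2 unfolding U_iff by auto
    obtain u where u: "\<alpha> u < int v * U u" using v_facts(2) by blast
    obtain s where s: "\<alpha> s < int w' * W s" using w_facts(2) by blast
    have "\<not> quotient_complete_intersection (polynomial_ring N) B.A"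
    proof (cases "d\<^sub>2 = 1")
      case False
      then have W2: "W y \<noteq> 0" "W (y + 1) \<noteq> 0" "y \<noteq> y + 1"
        using \<open>d\<^sub>2 \<ge> 1\<close> unfolding W_iff by (auto simp: y_def)
      show ?thesis
      proof (cases "v \<le> w'")
        case True
        have "(int v - 1) * W i \<le> \<alpha> i" for i
          unfolding v_pred by (rule w_facts(3)) (use True v_facts(1) in simp)
        then show ?thesis by (rule B.not_ci_two_two[OF v_facts(1) u prevU _ U2 W2])
      next
        case False
        have "(int w' - 1) * U i \<le> \<alpha> i" for i
          unfolding w_pred by (rule v_facts(3)) (use False w_facts(1) in simp)
        then show ?thesis
          using S.not_ci_two_two[OF w_facts(1) s prevW _ W2 U2] S_A by simp
      qed
    next
      case d2_1: True
      then have "a (m+1) + 1 < v * b (m+1)" using that d1_2 by simp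
      then have "int (a (m+1) + 1) < int (v * b (m+1))" by (simp only: of_nat_less_iff)
      then have vb: "\<alpha> y + 1 < int v * W y" by (simp add: \<alpha>_y W_y)
      have "w' \<le> v" using w_facts(3)[of v y] vb by (cases "v < w'") auto
      show ?thesis
      proof (cases "w' = v")
        case True
        show ?thesis
          by (rule B.not_ci_single_equal[OF v_facts(1) u prevU W_single[OF d2_1] _ vb U2])
            (use prevW[of y] True in auto)
      next
        case False
        then have "int w' * U i \<le> \<alpha> i" for i using v_facts(3)[of w' i] \<open>w' \<le> v\<close> by simp
        then show ?thesis
          using S.not_ci_single_strict[OF w_facts(1) W_single[OF d2_1] w_y[OF d2_1] prevW _ U2] S_A
          by simp
      qed
    qed
    then show ?thesis unfolding Ann unfolding R N_def .
  qed
  have "quotient_complete_intersection R (Ann R F) \<longleftrightarrow>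
      (d\<^sub>1 = 1 \<and> d\<^sub>2 = 1) \<or> (d\<^sub>1 \<ge> 2 \<and> d\<^sub>2 = 1 \<and> a (m+1) + 1 \<ge> v * b (m+1))"
    using not_ci part2(4) long(2) by argo
  then show ?thesis
    by (intro conjI impI; (elim conjE)?)
      (assumption | rule part2(1-3)[THEN mp] part3; assumption)+
qed

end
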